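(* Let $(X,\tau)$ be a generalized Satake diagram and $\sigma=w_X\circ\tau$. Then the restricted root system $\overline\Phi$ is $W(\overline\Phi)$-stable.
   Context: $I$ is a finite set and $A=(a_{ij})_{i,j\in I}$ is an indecomposable symmetrizable generalized Cartan matrix: $a_{ii}=2$, $a_{ij}\in\mathbb Z_{\le0}$ for $i\neq j$, $a_{ij}=0\iff a_{ji}=0$, with positive setwise-coprime integers $\epsilon_i$ such that $\epsilon_ia_{ij}=\epsilon_ja_{ji}$. $\mathrm{Aut}(A)$ is the group of bijections $\tau:I\to I$ with $a_{\tau(i)\tau(j)}=a_{ij}$. $\Phi$ is the root system (set of nonzero roots, real and imaginary) of the Kac-Moody algebra $\mathfrak g(A)$, with simple roots $\{\alpha_i\}_{i\in I}$. $V=\mathrm{span}_{\mathbb Q}\Phi$ has basis $\{\alpha_i\}_{i\in I}$ and symmetric bilinear form $(\alpha_i,\alpha_j)=\epsilon_ia_{ij}$. The Weyl group $W\le\mathrm{GL}(V)$ is generated by $s_i(\alpha_j)=\alpha_j-a_{ij}\alpha_i$; $\mathrm{Aut}(A)$ acts on $V$ by $\tau(\alpha_i)=\alpha_{\tau(i)}$. For $X\subseteq I$, $W_X=\langle s_i\rangle_{i\in X}$; $X$ is of finite type if $W_X$ is finite; then $w_X$ denotes its longest element and $\mathrm{oi}_X$ the diagram automorphism of $(a_{ij})_{i,j\in X}$ with $w_X(\alpha_i)=-\alpha_{\mathrm{oi}_X(i)}$ ($i\in X$). A compatible decoration is a pair $(X,\tau)$ with $X\subseteq I$ of finite type, $\tau\in\mathrm{Aut}(A)$,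 $\tau(X)\subseteq X$, $\tau^2=\mathrm{id}_I$, $\tau|_X=\mathrm{oi}_X$. It is a generalized Satake diagram if for all $i\in I\setminus X$ with $\tau(i)=i$ the connected component of the subdiagram on $X\cup\{i,\tau(i)\}$ containing $i$ is not of type $\mathsf A_2$. $\sigma=w_X\circ\tau$ is an isometric involution of $V$ stabilizing $\Phi$; $V^\sigma$ is its fixed subspace and $\overline\lambda=\tfrac12(\lambda+\sigma(\lambda))$. $\overline\Phi=\{\overline\alpha:\alpha\in\Phi\}\setminus\{0\}$. For $\beta\in V$ with $(\beta,\beta)>0$, $s_\beta(\gamma)=\gamma-2\frac{(\beta,\gamma)}{(\beta,\beta)}\beta$. $W(\overline\Phi)=\langle s_\beta|_{V^\sigma}:\beta\in\overline\Phi,\ (\beta,\beta)>0\rangle\le\mathrm{GL}(V^\sigma)$. *)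

theory Defs
  imports
    "HOL-Analysis.Analysis"
    "HOL-Algebra.Bij"
    "HOL-Algebra.Generated_Groups"
begin

section \<open>Generalized Cartan matrices\<close>

definition gcm :: "int ^ 'i ^ 'i \<Rightarrow> bool" where
  "gcm A \<longleftrightarrow>
     (\<forall>i. A $ i $ i = 2) \<and>
     (\<forall>i j. i \<noteq> j \<longrightarrow> A $ i $ j \<le> 0) \<and>
     (\<forall>i j. A $ i $ j = 0 \<longleftrightarrow> A $ j $ i = 0)"

definition indecomposable :: "int ^ 'i ^ 'i \<Rightarrow> bool" where
  "indecomposable A \<longleftrightarrow>
     (\<forall>J. J \<noteq> {} \<and> J \<noteq> UNIV \<longrightarrow> (\<exists>i\<in>J. \<exists>j\<in>- J. A $ i $ j \<noteq> 0))"

definition symmetrized_by :: "int ^ 'i ^ 'i \<Rightarrow> ('i \<Rightarrow> int) \<Rightarrow> bool" where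
  "symmetrized_by A eps \<longleftrightarrow>
     (\<forall>i. eps i > 0) \<and> Gcd (range eps) = 1 \<and>
     (\<forall>i j. eps i * A $ i $ j = eps j * A $ j $ i)"

definition diagram_aut :: "int ^ 'i ^ 'i \<Rightarrow> ('i \<Rightarrow> 'i) set" where
  "diagram_aut A = {\<tau>. bij \<tau> \<and> (\<forall>i j. A $ \<tau> i $ \<tau> j = A $ i $ j)}"


section \<open>Free complex Lie algebras\<close>

datatype 'x lie_term =
    Gen 'x
  | Zero
  | Plus "'x lie_term" "'x lie_term"
  | Scale complex "'x lie_term"
  | Brac "'x lie_term" "'x lie_term"

inductive lie_eq :: "'x lie_term \<Rightarrow> 'x lie_term \<Rightarrow> bool" where
  refl: "lie_eq t t"
| sym: "lie_eq t u \<Longrightarrow> lie_eq u t"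
| trans: "lie_eq t u \<Longrightarrow> lie_eq u v \<Longrightarrow> lie_eq t v"
| plus_cong: "lie_eq t t' \<Longrightarrow> lie_eq u u' \<Longrightarrow> lie_eq (Plus t u) (Plus t' u')"
| scale_cong: "lie_eq t t' \<Longrightarrow> lie_eq (Scale c t) (Scale c t')"
| brac_cong: "lie_eq t t' \<Longrightarrow> lie_eq u u' \<Longrightarrow> lie_eq (Brac t u) (Brac t' u')"
| plus_assoc: "lie_eq (Plus (Plus t u) v) (Plus t (Plus u v))"
| plus_comm: "lie_eq (Plus t u) (Plus u t)"
| plus_zero: "lie_eq (Plus Zero t) t"
| plus_neg: "lie_eq (Plus (Scale (- 1) t) t) Zero"
| scale_plus: "lie_eq (Scale c (Plus t u)) (Plus (Scale c t) (Scale c u))"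
| plus_scale: "lie_eq (Scale (c + d) t) (Plus (Scale c t) (Scale d t))"
| scale_scale: "lie_eq (Scale c (Scale d t)) (Scale (c * d) t)"
| scale_one: "lie_eq (Scale 1 t) t"
| brac_plus_left: "lie_eq (Brac (Plus t u) v) (Plus (Brac t v) (Brac u v))"
| brac_plus_right: "lie_eq (Brac t (Plus u v)) (Plus (Brac t u) (Brac t v))"
| brac_scale_left: "lie_eq (Brac (Scale c t) u) (Scale c (Brac t u))"
| brac_scale_right: "lie_eq (Brac t (Scale c u)) (Scale c (Brac t u))"
| brac_alternating: "lie_eq (Brac t t) Zero"
| jacobi: "lie_eq (Plus (Brac t (Brac u v)) (Plus (Brac u (Brac v t)) (Brac v (Brac t u)))) Zero"

quotient_type 'x free_lie = "'x lie_term" / lie_eq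
  by (rule equivpI)
    (auto intro!: reflpI sympI transpI intro: lie_eq.refl lie_eq.sym lie_eq.trans)

lift_definition lie_gen :: "'x \<Rightarrow> 'x free_lie" is Gen .

lift_definition lie_scale :: "complex \<Rightarrow> 'x free_lie \<Rightarrow> 'x free_lie" is Scale
  by (rule lie_eq.scale_cong)

lift_definition lie_bracket :: "'x free_lie \<Rightarrow> 'x free_lie \<Rightarrow> 'x free_lie" is Brac
  by (rule lie_eq.brac_cong)

instantiation free_lie :: (type) ab_group_add
begin

lift_definition zero_free_lie :: "'a free_lie" is Zero .

lift_definition plus_free_lie :: "'a free_lie \<Rightarrow> 'a free_lie \<Rightarrow> 'a free_lie" is Plus
  by (rule lie_eq.plus_cong)

definition uminus_free_lie :: "'a free_lie \<Rightarrow> 'a free_lie" where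
  "uminus_free_lie x = lie_scale (- 1) x"

definition minus_free_lie :: "'a free_lie \<Rightarrow> 'a free_lie \<Rightarrow> 'a free_lie" where
  "minus_free_lie x y = x + - y"

instance
proof
  fix a b c :: "'a free_lie"
  show "a + b + c = a + (b + c)" by transfer (rule lie_eq.plus_assoc)
  show "a + b = b + a" by transfer (rule lie_eq.plus_comm)
  show "0 + a = a" by transfer (rule lie_eq.plus_zero)
  show "- a + a = 0" unfolding uminus_free_lie_def by transfer (rule lie_eq.plus_neg)
  show "a - b = a + - b" by (rule minus_free_lie_def)
qed

end

interpretation lie: vector_space lie_scale
proof
  fix a b :: complex and x y :: "'x free_lie"
  show "lie_scale a (x + y) = lie_scale a x + lie_scale a y"
    by transfer (rule lie_eq.scale_plus)
  show "lie_scale (a + b) x = lie_scale a x + lie_scale b x"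
    by transfer (rule lie_eq.plus_scale)
  show "lie_scale a (lie_scale b x) = lie_scale (a * b) x"
    by transfer (rule lie_eq.scale_scale)
  show "lie_scale 1 x = x"
    by transfer (rule lie_eq.scale_one)
qed

definition lie_ideal :: "'x free_lie set \<Rightarrow> bool" where
  "lie_ideal J \<longleftrightarrow> lie.subspace J \<and> (\<forall>x. \<forall>y\<in>J. lie_bracket x y \<in> J)"


section \<open>Kac-Moody algebras and their roots\<close>

text \<open>The Cartan subalgebra is taken to be the space of complex vectors indexed by
  \<open>'m\<close>, and its dual is identified with the same space through the bilinear
  (not Hermitian) standard pairing.\<close>

definition pairing :: "complex ^ 'm \<Rightarrow> complex ^ 'm \<Rightarrow> complex" where
  "pairing \<alpha> h = (\<Sum>k\<in>UNIV. \<alpha> $ k * h $ k)"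

text \<open>A (minimal) realization: the last condition says that the Cartan subalgebra has
  dimension \<open>2 n - rank A\<close>, where \<open>n\<close> is the size of \<open>A\<close>.\<close>

definition realization ::
    "int ^ 'i ^ 'i \<Rightarrow> ('i \<Rightarrow> complex ^ 'm) \<Rightarrow> ('i \<Rightarrow> complex ^ 'm) \<Rightarrow> bool" where
  "realization A coroot rt \<longleftrightarrow>
     inj coroot \<and> vec.independent (range coroot) \<and>
     inj rt \<and> vec.independent (range rt) \<and>
     (\<forall>i j. pairing (rt j) (coroot i) = of_int (A $ i $ j)) \<and>
     CARD('m) + rank (\<chi> i j. (of_int (A $ i $ j) :: complex)) = 2 * CARD('i)"

datatype ('i, 'h) km_gen = E 'i | F 'i | H 'h

abbreviation "gE i \<equiv> lie_gen (E i)"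
abbreviation "gF i \<equiv> lie_gen (F i)"
abbreviation "gH h \<equiv> lie_gen (H h)"

definition km_relators ::
    "('i \<Rightarrow> complex ^ 'm) \<Rightarrow> ('i \<Rightarrow> complex ^ 'm) \<Rightarrow> ('i, complex ^ 'm) km_gen free_lie set" where
  "km_relators coroot rt =
     {gH (h + h') - (gH h + gH h') | h h'. True} \<union>
     {gH (c *s h) - lie_scale c (gH h) | c h. True} \<union>
     {lie_bracket (gH h) (gH h') | h h'. True} \<union>
     {lie_bracket (gH h) (gE i) - lie_scale (pairing (rt i) h) (gE i) | h i. True} \<union>
     {lie_bracket (gH h) (gF i) + lie_scale (pairing (rt i) h) (gF i) | h i. True} \<union>
     {lie_bracket (gE i) (gF i) - gH (coroot i) | i. True} \<union>
     {lie_bracket (gE i) (gF j) | i j. i \<noteq> j}"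

text \<open>The auxiliary algebra \<open>\<tilde>g(A)\<close> is the free Lie algebra modulo the following ideal.\<close>

definition km_aux_ideal ::
    "('i \<Rightarrow> complex ^ 'm) \<Rightarrow> ('i \<Rightarrow> complex ^ 'm) \<Rightarrow> ('i, complex ^ 'm) km_gen free_lie set" where
  "km_aux_ideal coroot rt = \<Inter>{J. lie_ideal J \<and> km_relators coroot rt \<subseteq> J}"

text \<open>The Kac-Moody algebra \<open>g(A)\<close> is the quotient of \<open>\<tilde>g(A)\<close> by the largest ideal meeting
  the Cartan subalgebra trivially, which is the sum of all such ideals. Ideals of
  \<open>\<tilde>g(A)\<close> are represented by their preimages in the free Lie algebra, so \<open>g(A)\<close> is
  the free Lie algebra modulo \<open>km_ideal\<close>.\<close>

definition km_ideal ::
    "('i \<Rightarrow> complex ^ 'm) \<Rightarrow> ('i \<Rightarrow> complex ^ 'm) \<Rightarrow> ('i, complex ^ 'm) km_gen free_lie set" where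
  "km_ideal coroot rt = lie.span (\<Union>{J. lie_ideal J \<and> km_aux_ideal coroot rt \<subseteq> J \<and>
     J \<inter> range gH \<subseteq> km_aux_ideal coroot rt})"

text \<open>The weight space of \<open>g(A)\<close> at a functional \<open>\<mu>\<close> on the Cartan subalgebra, as a subspace
  of the free Lie algebra containing \<open>km_ideal\<close>.\<close>

definition km_weight_space ::
    "('i \<Rightarrow> complex ^ 'm) \<Rightarrow> ('i \<Rightarrow> complex ^ 'm) \<Rightarrow> (complex ^ 'm \<Rightarrow> complex) \<Rightarrow>
     ('i, complex ^ 'm) km_gen free_lie set" where
  "km_weight_space coroot rt \<mu> =
     {x. \<forall>h. lie_bracket (gH h) x - lie_scale (\<mu> h) x \<in> km_ideal coroot rt}"

text \<open>The rational span of the roots has the simple roots as a basis; it is identified with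
  \<open>rat ^ 'i\<close> by sending \<open>v\<close> to the functional \<open>\<Sum>i. v\<^sub>i \<alpha>\<^sub>i\<close>. The roots are
  recorded by their coordinates.\<close>

definition root_system :: "('i \<Rightarrow> complex ^ 'm) \<Rightarrow> ('i \<Rightarrow> complex ^ 'm) \<Rightarrow> (rat ^ 'i) set" where
  "root_system coroot rt =
     {v. v \<noteq> 0 \<and> \<not> km_weight_space coroot rt (\<lambda>h. \<Sum>i\<in>UNIV. of_rat (v $ i) * pairing (rt i) h)
                     \<subseteq> km_ideal coroot rt}"


section \<open>The space \<open>V\<close>, its form and the Weyl group\<close>

abbreviation simple_root :: "'i \<Rightarrow> rat ^ 'i" where
  "simple_root i \<equiv> axis i 1"

definition root_form :: "int ^ 'i ^ 'i \<Rightarrow> ('i \<Rightarrow> int) \<Rightarrow> rat ^ 'i \<Rightarrow> rat ^ 'i \<Rightarrow> rat" where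
  "root_form A eps u v =
     (\<Sum>i\<in>UNIV. \<Sum>j\<in>UNIV. u $ i * v $ j * of_int (eps i * A $ i $ j))"

definition simple_refl :: "int ^ 'i ^ 'i \<Rightarrow> 'i \<Rightarrow> rat ^ 'i \<Rightarrow> rat ^ 'i" where
  "simple_refl A i v =
     (\<Sum>j\<in>UNIV. v $ j *s (simple_root j - of_int (A $ i $ j) *s simple_root i))"

definition diagram_act :: "('i \<Rightarrow> 'i) \<Rightarrow> rat ^ 'i \<Rightarrow> rat ^ 'i" where
  "diagram_act \<tau> v = (\<Sum>i\<in>UNIV. v $ i *s simple_root (\<tau> i))"

text \<open>Subgroups of a general linear group are generated inside the group of all bijections;
  the generators are linear.\<close>

definition weyl :: "int ^ 'i ^ 'i \<Rightarrow> 'i set \<Rightarrow> (rat ^ 'i \<Rightarrow> rat ^ 'i) set" where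
  "weyl A X = generate (BijGroup UNIV) (simple_refl A ` X)"

definition weyl_length :: "int ^ 'i ^ 'i \<Rightarrow> 'i set \<Rightarrow> (rat ^ 'i \<Rightarrow> rat ^ 'i) \<Rightarrow> nat" where
  "weyl_length A X w =
     (LEAST n. \<exists>is. length is = n \<and> set is \<subseteq> X \<and> w = foldr (\<lambda>i f. simple_refl A i \<circ> f) is id)"

text \<open>For \<open>X\<close> of finite type the maximum below is attained, at a unique element.\<close>

definition longest_elt :: "int ^ 'i ^ 'i \<Rightarrow> 'i set \<Rightarrow> rat ^ 'i \<Rightarrow> rat ^ 'i" where
  "longest_elt A X = arg_max_on (weyl_length A X) (weyl A X)"

definition finite_type :: "int ^ 'i ^ 'i \<Rightarrow> 'i set \<Rightarrow> bool" where
  "finite_type A X \<longleftrightarrow> finite (weyl A X)"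


section \<open>Generalized Satake diagrams\<close>

text \<open>The last condition is \<open>\<tau>|\<^sub>X = oi\<^sub>X\<close>, as \<open>oi\<^sub>X\<close> is the map
  \<open>X \<rightarrow> X\<close> determined by \<open>w\<^sub>X(\<alpha>\<^sub>i) = - \<alpha>\<^bsub>oi(i)\<^esub>\<close>.\<close>

definition compatible_decoration :: "int ^ 'i ^ 'i \<Rightarrow> 'i set \<Rightarrow> ('i \<Rightarrow> 'i) \<Rightarrow> bool" where
  "compatible_decoration A X \<tau> \<longleftrightarrow>
     finite_type A X \<and> \<tau> \<in> diagram_aut A \<and> \<tau> ` X \<subseteq> X \<and> \<tau> \<circ> \<tau> = id \<and>
     (\<forall>i\<in>X. longest_elt A X (simple_root i) = - simple_root (\<tau> i))"

definition component :: "int ^ 'i ^ 'i \<Rightarrow> 'i set \<Rightarrow> 'i \<Rightarrow> 'i set" where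
  "component A Y i = {j. (i, j) \<in> {(k, l). k \<in> Y \<and> l \<in> Y \<and> A $ k $ l \<noteq> 0}\<^sup>*}"

definition type_A2 :: "int ^ 'i ^ 'i \<Rightarrow> 'i set \<Rightarrow> bool" where
  "type_A2 A Z \<longleftrightarrow> (\<exists>k l. k \<noteq> l \<and> Z = {k, l} \<and> A $ k $ l = - 1 \<and> A $ l $ k = - 1)"

definition generalized_satake :: "int ^ 'i ^ 'i \<Rightarrow> 'i set \<Rightarrow> ('i \<Rightarrow> 'i) \<Rightarrow> bool" where
  "generalized_satake A X \<tau> \<longleftrightarrow>
     compatible_decoration A X \<tau> \<and>
     (\<forall>i. i \<notin> X \<and> \<tau> i = i \<longrightarrow> \<not> type_A2 A (component A (X \<union> {i, \<tau> i}) i))"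


section \<open>Restricted root systems\<close>

definition fixed_space :: "(rat ^ 'i \<Rightarrow> rat ^ 'i) \<Rightarrow> (rat ^ 'i) set" where
  "fixed_space \<sigma> = {v. \<sigma> v = v}"

definition average :: "(rat ^ 'i \<Rightarrow> rat ^ 'i) \<Rightarrow> rat ^ 'i \<Rightarrow> rat ^ 'i" where
  "average \<sigma> v = (1 / 2) *s (v + \<sigma> v)"

definition restricted_roots ::
    "(rat ^ 'i \<Rightarrow> rat ^ 'i) \<Rightarrow> (rat ^ 'i) set \<Rightarrow> (rat ^ 'i) set" where
  "restricted_roots \<sigma> \<Phi> = average \<sigma> ` \<Phi> - {0}"

definition reflection ::
    "(rat ^ 'i \<Rightarrow> rat ^ 'i \<Rightarrow> rat) \<Rightarrow> rat ^ 'i \<Rightarrow> rat ^ 'i \<Rightarrow> rat ^ 'i" where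
  "reflection B \<beta> \<gamma> = \<gamma> - (2 * (B \<beta> \<gamma> / B \<beta> \<beta>)) *s \<beta>"

definition restricted_weyl ::
    "(rat ^ 'i \<Rightarrow> rat ^ 'i \<Rightarrow> rat) \<Rightarrow> (rat ^ 'i \<Rightarrow> rat ^ 'i) \<Rightarrow> (rat ^ 'i) set \<Rightarrow>
     (rat ^ 'i \<Rightarrow> rat ^ 'i) set" where
  "restricted_weyl B \<sigma> R =
     generate (BijGroup (fixed_space \<sigma>))
       {restrict (reflection B \<beta>) (fixed_space \<sigma>) | \<beta>. \<beta> \<in> R \<and> B \<beta> \<beta> > 0}"

end

theory Submission
  imports Defs
begin

text \<open>
  Averages of roots are permuted by every linear map that preserves \<open>\<Phi>\<close> and commutes with
  \<open>\<sigma>\<close>. The theorem therefore follows once each reflection in a restricted root of positive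
  norm is realized, on \<open>V\<^sup>\<sigma>\<close>, by such a map; the maps used are elements of the Weyl group.

  They are built first for a restricted simple root \<open>\<beta> = avg \<alpha>\<^sub>i\<close>, where
  \<open>i \<notin> X\<close> (\<open>restricted_simple_reflection\<close>). Let \<open>M\<close> be the value of the coroot of
  \<open>\<alpha>\<^sub>i\<close> at \<open>\<sigma>(\<alpha>\<^sub>i)\<close>. It is an integer with \<open>M \<le> 2\<close>, and positivity
  of the norm of \<open>\<beta>\<close> says \<open>M > - 2\<close>. If \<open>M = 2\<close> then \<open>\<alpha>\<^sub>i\<close> is fixed by
  \<open>\<sigma>\<close> and its simple reflection serves; if \<open>M = 0\<close> the product of the two commuting
  reflections in \<open>\<alpha>\<^sub>i\<close> and \<open>\<sigma>(\<alpha>\<^sub>i)\<close> serves; if \<open>M = - 1\<close> the reflection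
  in \<open>\<alpha>\<^sub>i + \<sigma>(\<alpha>\<^sub>i) = 2 \<beta>\<close> serves. The remaining value \<open>M = 1\<close> occurs
  only when the component of \<open>i\<close> is of type \<open>A\<^sub>2\<close>
  (\<open>pairing_number_one_type_A2\<close>), which the definition of a generalized Satake diagram
  excludes.

  A general restricted root \<open>\<beta> = avg \<alpha>\<close> of positive norm is reduced to this case by descent
  (\<open>restricted_reflection\<close>). If \<open>\<alpha> \<ge> 0\<close>, then \<open>\<beta>\<close> is a nonnegative combination of
  restricted simple roots, and distinct ones have nonpositive products. Hence one of them has
  positive norm and positive product with \<open>\<beta>\<close>, and the map realizing its reflection
  lowers the height of \<open>\<alpha>\<close> outside \<open>X\<close>. The descent stops when the image of
  \<open>\<alpha>\<close> leaves the positive cone, which forces \<open>\<beta>\<close> to be a multiple of that restricted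
  simple root. This treats real and imaginary \<open>\<alpha>\<close> alike.

  Only two properties of \<open>\<Phi>\<close> enter: stability under simple reflections
  (\<open>root_system_simple_refl\<close>) and the integrality and common sign of the coordinates of a
  root (\<open>root_coherent\<close>). The latter comes from the triangular decomposition of \<open>g(A)\<close>.
  For the former, the Serre elements generate ideals that meet the Cartan subalgebra trivially and
  so vanish in \<open>g(A)\<close>; therefore \<open>ad e\<^sub>i\<close> and \<open>ad f\<^sub>i\<close> are locally nilpotent,
  and \<open>sl\<^sub>2\<close>-theory moves a nonzero vector of weight \<open>\<mu>\<close> to one of weight
  \<open>s\<^sub>i(\<mu>)\<close>.

  The positive definiteness needed on the span of \<open>X\<close> is taken from the \<open>W\<^sub>X\<close>-average
  of the standard inner product (\<open>averaged_form\<close>): reflections preserve both forms, so both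
  forms give the same pairings with the simple coroots of \<open>X\<close>.
\<close>

section \<open>Calculus in the free Lie algebra\<close>

lemma lie_bracket_add_left: "lie_bracket (x + y) z = lie_bracket x z + lie_bracket y z"
  by transfer (rule lie_eq.brac_plus_left)

lemma lie_bracket_add_right: "lie_bracket x (y + z) = lie_bracket x y + lie_bracket x z"
  by transfer (rule lie_eq.brac_plus_right)

lemma lie_bracket_scale_left: "lie_bracket (lie_scale c x) y = lie_scale c (lie_bracket x y)"
  by transfer (rule lie_eq.brac_scale_left)

lemma lie_bracket_scale_right: "lie_bracket x (lie_scale c y) = lie_scale c (lie_bracket x y)"
  by transfer (rule lie_eq.brac_scale_right)

lemma lie_bracket_self: "lie_bracket x x = 0"
  by transfer (rule lie_eq.brac_alternating)

lemma lie_jacobi: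
  "lie_bracket x (lie_bracket y z) + (lie_bracket y (lie_bracket z x)
     + lie_bracket z (lie_bracket x y)) = 0"
  by transfer (rule lie_eq.jacobi)

lemma lie_bracket_zero_left [simp]: "lie_bracket 0 x = 0"
  by (metis add_cancel_right_right lie_bracket_add_left add_0)

lemma lie_bracket_zero_right [simp]: "lie_bracket x 0 = 0"
  by (metis add_cancel_right_right lie_bracket_add_right add_0)

lemma lie_bracket_minus_left: "lie_bracket (- x) y = - lie_bracket x y"
  by (metis add_eq_0_iff2 lie_bracket_add_left lie_bracket_zero_left add.left_inverse)

lemma lie_bracket_minus_right: "lie_bracket x (- y) = - lie_bracket x y"
  by (metis add_eq_0_iff2 lie_bracket_add_right lie_bracket_zero_right add.left_inverse)

lemma lie_bracket_diff_left: "lie_bracket (x - y) z = lie_bracket x z - lie_bracket y z"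
  using lie_bracket_add_left[of x "- y" z] by (simp add: lie_bracket_minus_left)

lemma lie_bracket_diff_right: "lie_bracket x (y - z) = lie_bracket x y - lie_bracket x z"
  using lie_bracket_add_right[of x y "- z"] by (simp add: lie_bracket_minus_right)

lemma lie_bracket_anticomm: "lie_bracket y x = - lie_bracket x y"
proof -
  have "lie_bracket (x + y) (x + y) = 0" by (rule lie_bracket_self)
  then have "lie_bracket x y + lie_bracket y x = 0"
    unfolding lie_bracket_add_left lie_bracket_add_right
    by (simp add: lie_bracket_self add.commute)
  then show ?thesis by (metis add.commute add_eq_0_iff)
qed

lemma lie_bracket_derivation:
  "lie_bracket x (lie_bracket y z) = lie_bracket (lie_bracket x y) z + lie_bracket y (lie_bracket x z)"
proof -
  have "lie_bracket y (lie_bracket z x) = - lie_bracket y (lie_bracket x z)"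
    by (metis lie_bracket_anticomm lie_bracket_minus_right)
  moreover have "lie_bracket z (lie_bracket x y) = - lie_bracket (lie_bracket x y) z"
    by (rule lie_bracket_anticomm)
  ultimately show ?thesis using lie_jacobi[of x y z] by (simp add: algebra_simps)
qed

lemma free_lie_induct:
  assumes sub: "lie.subspace S"
    and gen: "\<And>g. lie_gen g \<in> S"
    and brac: "\<And>x y. x \<in> S \<Longrightarrow> y \<in> S \<Longrightarrow> lie_bracket x y \<in> S"
  shows "z \<in> S"
proof -
  have "abs_free_lie t \<in> S" for t
  proof (induction t)
    case (Gen x)
    then show ?case using gen by (simp add: lie_gen.abs_eq)
  next
    case Zero
    then show ?case using lie.subspace_0[OF sub] by (simp add: zero_free_lie.abs_eq)
  next
    case (Plus t u)
    then show ?case using lie.subspace_add[OF sub] by (simp flip: plus_free_lie.abs_eq)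
  next
    case (Scale c t)
    then show ?case using lie.subspace_scale[OF sub] by (simp flip: lie_scale.abs_eq)
  next
    case (Brac t u)
    then show ?case using brac by (simp flip: lie_bracket.abs_eq)
  qed
  then show ?thesis using Quotient_free_lie by (metis Quotient_def)
qed

text \<open>The elements that normalize a subspace form a subalgebra, so stability can be tested on generators.\<close>

lemma lie_idealI:
  assumes sub: "lie.subspace J"
    and gen: "\<And>g y. y \<in> J \<Longrightarrow> lie_bracket (lie_gen g) y \<in> J"
  shows "lie_ideal J"
proof -
  let ?S = "{x. \<forall>y\<in>J. lie_bracket x y \<in> J}"
  have "x \<in> ?S" for x
  proof (rule free_lie_induct[of ?S])
    show "lie.subspace ?S"
      unfolding lie.subspace_def
      using sub by (auto simp: lie_bracket_add_left lie_bracket_scale_left lie.subspace_def)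
    show "lie_gen g \<in> ?S" for g using gen by auto
    show "lie_bracket x y \<in> ?S" if "x \<in> ?S" "y \<in> ?S" for x y
    proof -
      have "lie_bracket (lie_bracket x y) z
          = lie_bracket x (lie_bracket y z) - lie_bracket y (lie_bracket x z)" for z
        using lie_bracket_derivation[of x y z] by simp
      then show ?thesis using that lie.subspace_diff[OF sub] by auto
    qed
  qed
  then show ?thesis using sub unfolding lie_ideal_def by auto
qed

lemma lie_ideal_subspace: "lie_ideal J \<Longrightarrow> lie.subspace J"
  by (simp add: lie_ideal_def)

lemma lie_ideal_bracket_right: "lie_ideal J \<Longrightarrow> y \<in> J \<Longrightarrow> lie_bracket x y \<in> J"
  by (simp add: lie_ideal_def)

lemma lie_ideal_bracket_left: "lie_ideal J \<Longrightarrow> x \<in> J \<Longrightarrow> lie_bracket x y \<in> J"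
  by (metis lie_bracket_anticomm lie_ideal_def lie.subspace_neg)

lemma bracket_span_closed:
  assumes "x \<in> lie.span B" and "\<And>b. b \<in> B \<Longrightarrow> lie_bracket a b \<in> lie.span C"
  shows "lie_bracket a x \<in> lie.span C"
  using assms(1)
proof (induction rule: lie.span_induct)
  case base
  show ?case
    unfolding lie.subspace_def
    by (auto simp: lie_bracket_add_right lie_bracket_scale_right
        intro: lie.span_zero lie.span_add lie.span_scale)
next
  case (step b)
  then show ?case by (rule assms(2))
qed


section \<open>Congruence modulo an ideal and weight vectors\<close>

text \<open>The quotients depend on parameters and are not types, so computations in them are carried out on
  representatives.\<close>

definition congr :: "'x free_lie set \<Rightarrow> 'x free_lie \<Rightarrow> 'x free_lie \<Rightarrow> bool" where
  "congr J x y \<longleftrightarrow> x - y \<in> J"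

context
  fixes J :: "'x free_lie set"
  assumes J: "lie_ideal J"
begin

lemma congr_refl: "congr J x x"
  using lie.subspace_0[OF lie_ideal_subspace[OF J]] by (simp add: congr_def)

lemma congr_sym: "congr J x y \<Longrightarrow> congr J y x"
  using lie.subspace_neg[OF lie_ideal_subspace[OF J], of "x - y"] by (simp add: congr_def)

lemma congr_trans: "congr J x y \<Longrightarrow> congr J y z \<Longrightarrow> congr J x z"
  using lie.subspace_add[OF lie_ideal_subspace[OF J], of "x - y" "y - z"] by (simp add: congr_def)

lemma congr_add: "congr J x y \<Longrightarrow> congr J x' y' \<Longrightarrow> congr J (x + x') (y + y')"
  using lie.subspace_add[OF lie_ideal_subspace[OF J], of "x - y" "x' - y'"]
  by (simp add: congr_def algebra_simps)

lemma congr_scale: "congr J x y \<Longrightarrow> congr J (lie_scale c x) (lie_scale c y)"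
  using lie.subspace_scale[OF lie_ideal_subspace[OF J], of "x - y" c]
  by (simp add: congr_def lie.scale_right_diff_distrib)

lemma congr_bracket:
  assumes "congr J x y" "congr J x' y'"
  shows "congr J (lie_bracket x x') (lie_bracket y y')"
proof -
  have "lie_bracket x x' - lie_bracket y y' = lie_bracket (x - y) x' + lie_bracket y (x' - y')"
    by (simp add: lie_bracket_diff_left lie_bracket_diff_right)
  then show ?thesis
    using assms lie.subspace_add[OF lie_ideal_subspace[OF J]]
      lie_ideal_bracket_left[OF J] lie_ideal_bracket_right[OF J]
    by (simp add: congr_def)
qed

lemma congr_mem_iff: "congr J x y \<Longrightarrow> x \<in> J \<longleftrightarrow> y \<in> J"
  unfolding congr_def
  by (metis J lie.subspace_add lie.subspace_diff lie_ideal_subspace diff_add_cancel diff_diff_eq2 add_diff_cancel_left')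

lemma congr_0_iff: "congr J x 0 \<longleftrightarrow> x \<in> J"
  by (simp add: congr_def)

end

definition weight_vectors ::
    "('i, complex ^ 'm) km_gen free_lie set \<Rightarrow> (complex ^ 'm \<Rightarrow> complex) \<Rightarrow>
     ('i, complex ^ 'm) km_gen free_lie set" where
  "weight_vectors J \<mu> = {x. \<forall>h. congr J (lie_bracket (gH h) x) (lie_scale (\<mu> h) x)}"

context
  fixes J :: "('i, complex ^ 'm) km_gen free_lie set"
  assumes J: "lie_ideal J"
begin

lemma weight_vectors_subspace: "lie.subspace (weight_vectors J \<mu>)"
  unfolding lie.subspace_def weight_vectors_def
proof (safe)
  fix h show "congr J (lie_bracket (gH h) 0) (lie_scale (\<mu> h) 0)" using congr_refl[OF J] by simp
next
  fix x y h
  assume "\<forall>h. congr J (lie_bracket (gH h) x) (lie_scale (\<mu> h) x)"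
    "\<forall>h. congr J (lie_bracket (gH h) y) (lie_scale (\<mu> h) y)"
  then show "congr J (lie_bracket (gH h) (x + y)) (lie_scale (\<mu> h) (x + y))"
    by (simp add: lie_bracket_add_right lie.scale_right_distrib congr_add[OF J])
next
  fix c x h
  assume "\<forall>h. congr J (lie_bracket (gH h) x) (lie_scale (\<mu> h) x)"
  then show "congr J (lie_bracket (gH h) (lie_scale c x)) (lie_scale (\<mu> h) (lie_scale c x))"
    using congr_scale[OF J, of "lie_bracket (gH h) x" "lie_scale (\<mu> h) x" c]
    by (simp add: lie_bracket_scale_right mult.commute)
qed

lemma ideal_subset_weight_vectors: "J \<subseteq> weight_vectors J \<mu>"
  unfolding weight_vectors_def congr_def
  using J lie_ideal_bracket_right lie.subspace_diff lie.subspace_scale lie_ideal_subspace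
  by fastforce

lemma bracket_weight_vectors:
  assumes "x \<in> weight_vectors J \<mu>" "y \<in> weight_vectors J \<nu>"
  shows "lie_bracket x y \<in> weight_vectors J (\<lambda>h. \<mu> h + \<nu> h)"
  unfolding weight_vectors_def
proof (safe)
  fix h
  have "congr J (lie_bracket (lie_bracket (gH h) x) y) (lie_bracket (lie_scale (\<mu> h) x) y)"
    "congr J (lie_bracket x (lie_bracket (gH h) y)) (lie_bracket x (lie_scale (\<nu> h) y))"
    using assms congr_bracket[OF J] congr_refl[OF J] by (auto simp: weight_vectors_def)
  from congr_add[OF J this]
  show "congr J (lie_bracket (gH h) (lie_bracket x y)) (lie_scale (\<mu> h + \<nu> h) (lie_bracket x y))"
    by (simp add: lie_bracket_derivation[of "gH h"] lie_bracket_scale_left lie_bracket_scale_right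
        lie.scale_left_distrib)
qed

lemma weight_vectors_congr:
  assumes "congr J x y" "x \<in> weight_vectors J \<mu>"
  shows "y \<in> weight_vectors J \<mu>"
proof -
  have "x - y \<in> weight_vectors J \<mu>"
    using assms(1) ideal_subset_weight_vectors by (auto simp: congr_def)
  then have "x - (x - y) \<in> weight_vectors J \<mu>"
    using assms(2) weight_vectors_subspace lie.subspace_diff by blast
  then show ?thesis by simp
qed

lemma weight_vectors_independent:
  assumes "finite M" "\<And>\<mu>. \<mu> \<in> M \<Longrightarrow> x \<mu> \<in> weight_vectors J \<mu>" "(\<Sum>\<mu>\<in>M. x \<mu>) \<in> J"
    and "\<mu> \<in> M"
  shows "x \<mu> \<in> J"
  using assms
proof (induction M arbitrary: x \<mu> rule: finite_induct)
  case empty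
  then show ?case by simp
next
  case (insert \<mu>0 M)
  note sub = lie_ideal_subspace[OF J]
  have smaller: "x \<mu> \<in> J" if \<mu>: "\<mu> \<in> M" for \<mu>
  proof -
    from \<mu> insert.hyps have "\<mu> \<noteq> \<mu>0" by blast
    then obtain h where h: "\<mu> h \<noteq> \<mu>0 h" by blast
    \<comment> \<open>Applying \<open>ad h - \<mu>0(h)\<close> removes the component of weight \<open>\<mu>0\<close>.\<close>
    let ?y = "\<lambda>\<nu>. lie_scale (\<nu> h - \<mu>0 h) (x \<nu>)"
    have br: "lie_bracket (gH h) (\<Sum>\<nu>\<in>N. x \<nu>) = (\<Sum>\<nu>\<in>N. lie_bracket (gH h) (x \<nu>))" if "finite N" for N
      using that by (induction N rule: finite_induct) (auto simp: lie_bracket_add_right)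
    let ?s = "\<Sum>\<nu>\<in>insert \<mu>0 M. x \<nu>"
    have cg: "congr J (\<Sum>\<nu>\<in>N. lie_bracket (gH h) (x \<nu>) - lie_scale (\<mu>0 h) (x \<nu>)) (\<Sum>\<nu>\<in>N. ?y \<nu>)"
      if "N \<subseteq> insert \<mu>0 M" for N
    proof -
      have "finite N" using that insert.hyps finite_subset by blast
      then show ?thesis using that
      proof (induction N rule: finite_induct)
        case empty
        show ?case using congr_refl[OF J] by simp
      next
        case (insert \<nu> N)
        have "congr J (lie_bracket (gH h) (x \<nu>)) (lie_scale (\<nu> h) (x \<nu>))"
          using insert.prems \<open>\<And>\<mu>. \<mu> \<in> insert \<mu>0 M \<Longrightarrow> x \<mu> \<in> weight_vectors J \<mu>\<close>
          by (auto simp: weight_vectors_def)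
        then have "congr J (lie_bracket (gH h) (x \<nu>) - lie_scale (\<mu>0 h) (x \<nu>)) (?y \<nu>)"
          by (simp add: congr_def lie.scale_left_diff_distrib)
        then show ?case using insert congr_add[OF J] by simp
      qed
    qed
    have "lie_bracket (gH h) ?s - lie_scale (\<mu>0 h) ?s \<in> J"
      using insert.prems(2) sub lie_ideal_bracket_right[OF J] lie.subspace_diff lie.subspace_scale by blast
    also have "lie_bracket (gH h) ?s - lie_scale (\<mu>0 h) ?s
       = (\<Sum>\<nu>\<in>insert \<mu>0 M. lie_bracket (gH h) (x \<nu>) - lie_scale (\<mu>0 h) (x \<nu>))"
      using insert.hyps by (simp add: br sum_subtractf lie.scale_sum_right del: sum.insert)
    finally have "(\<Sum>\<nu>\<in>insert \<mu>0 M. ?y \<nu>) \<in> J"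
      using cg[of "insert \<mu>0 M"] congr_mem_iff[OF J] by blast
    then have "(\<Sum>\<nu>\<in>M. ?y \<nu>) \<in> J" using insert.hyps by simp
    then have "?y \<mu> \<in> J"
      using insert.IH[of ?y \<mu>] \<mu> insert.prems(1) weight_vectors_subspace lie.subspace_scale by blast
    then have "lie_scale (1 / (\<mu> h - \<mu>0 h)) (?y \<mu>) \<in> J" using sub lie.subspace_scale by blast
    then show ?thesis using h by simp
  qed
  have "(\<Sum>\<nu>\<in>M. x \<nu>) \<in> J" using smaller sub lie.subspace_sum by blast
  then have "(x \<mu>0 + (\<Sum>\<nu>\<in>M. x \<nu>)) - (\<Sum>\<nu>\<in>M. x \<nu>) \<in> J"
    using insert.prems(2) insert.hyps sub lie.subspace_diff by fastforce
  then show ?case using smaller insert.prems(3) by auto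
qed

text \<open>Subtracting \<open>x\<close> from its decomposition into vectors with weights in \<open>P\<close> gives a relation between
  vectors of distinct weights, one of which is \<open>x\<close>.\<close>

lemma weight_vector_of_other_weight:
  assumes "x \<in> weight_vectors J \<nu>" "x \<in> lie.span (\<Union>\<mu>\<in>P. weight_vectors J \<mu>)" "\<nu> \<notin> P"
  shows "x \<in> J"
proof -
  let ?D = "{x. \<exists>M f. finite M \<and> M \<subseteq> P \<and> (\<forall>\<mu>\<in>P. f \<mu> \<in> weight_vectors J \<mu>) \<and> x = (\<Sum>\<mu>\<in>M. f \<mu>)}"
  have zero: "0 \<in> weight_vectors J \<mu>" for \<mu> by (rule lie.subspace_0[OF weight_vectors_subspace])
  have "lie.subspace ?D"
    unfolding lie.subspace_def
  proof (intro conjI ballI allI)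
    show "0 \<in> ?D" using zero by (auto intro!: exI[of _ "{}"] exI[of _ "\<lambda>_. 0"])
  next
    fix x y assume "x \<in> ?D" "y \<in> ?D"
    then obtain M f N g where M: "finite M" "M \<subseteq> P" "\<forall>\<mu>\<in>P. f \<mu> \<in> weight_vectors J \<mu>" "x = sum f M"
      and N: "finite N" "N \<subseteq> P" "\<forall>\<mu>\<in>P. g \<mu> \<in> weight_vectors J \<mu>" "y = sum g N" by auto
    let ?h = "\<lambda>\<mu>. (if \<mu> \<in> M then f \<mu> else 0) + (if \<mu> \<in> N then g \<mu> else 0)"
    have "(\<Sum>\<mu>\<in>M \<union> N. if \<mu> \<in> M then f \<mu> else 0) = sum f M"
      "(\<Sum>\<mu>\<in>M \<union> N. if \<mu> \<in> N then g \<mu> else 0) = sum g N"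
      using M N by (auto intro!: sum.mono_neutral_cong_right)
    then have "x + y = sum ?h (M \<union> N)"
      using M N by (simp add: sum.distrib)
    moreover have "?h \<mu> \<in> weight_vectors J \<mu>" if "\<mu> \<in> P" for \<mu>
    proof (rule lie.subspace_add[OF weight_vectors_subspace])
      show "(if \<mu> \<in> M then f \<mu> else 0) \<in> weight_vectors J \<mu>" using M(3) that zero by simp
      show "(if \<mu> \<in> N then g \<mu> else 0) \<in> weight_vectors J \<mu>" using N(3) that zero by simp
    qed
    ultimately show "x + y \<in> ?D"
      using M(1,2) N(1,2) by (intro CollectI exI[of _ "M \<union> N"] exI[of _ ?h]) simp
  next
    fix c x assume "x \<in> ?D"
    then obtain M f where M: "finite M" "M \<subseteq> P" "\<forall>\<mu>\<in>P. f \<mu> \<in> weight_vectors J \<mu>" "x = sum f M" by auto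
    have "lie_scale c x = (\<Sum>\<mu>\<in>M. lie_scale c (f \<mu>))" using M by (simp add: lie.scale_sum_right)
    moreover have "\<forall>\<mu>\<in>P. lie_scale c (f \<mu>) \<in> weight_vectors J \<mu>"
      using M(3) by (auto intro: lie.subspace_scale[OF weight_vectors_subspace])
    ultimately show "lie_scale c x \<in> ?D" using M
      by (intro CollectI exI[of _ M] exI[of _ "\<lambda>\<mu>. lie_scale c (f \<mu>)"]) auto
  qed
  moreover have "(\<Union>\<mu>\<in>P. weight_vectors J \<mu>) \<subseteq> ?D"
  proof
    fix x assume "x \<in> (\<Union>\<mu>\<in>P. weight_vectors J \<mu>)"
    then obtain \<mu> where "\<mu> \<in> P" "x \<in> weight_vectors J \<mu>" by blast
    then show "x \<in> ?D" using zero
      by (intro CollectI exI[of _ "{\<mu>}"] exI[of _ "\<lambda>\<nu>. if \<nu> = \<mu> then x else 0"]) auto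
  qed
  ultimately have "lie.span (\<Union>\<mu>\<in>P. weight_vectors J \<mu>) \<subseteq> ?D" by (intro lie.span_minimal)
  with assms(2) have "x \<in> ?D" by (rule rev_subsetD)
  then obtain M f where M: "finite M" "M \<subseteq> P" "\<forall>\<mu>\<in>P. f \<mu> \<in> weight_vectors J \<mu>" "x = sum f M" by auto
  let ?g = "\<lambda>\<mu>. if \<mu> = \<nu> then - x else f \<mu>"
  have "sum ?g (insert \<nu> M) = 0"
  proof -
    have "\<nu> \<notin> M" using M assms(3) by blast
    then have "sum ?g M = sum f M" by (intro sum.cong) auto
    then show ?thesis using M \<open>\<nu> \<notin> M\<close> by simp
  qed
  moreover have "?g \<mu> \<in> weight_vectors J \<mu>" if "\<mu> \<in> insert \<nu> M" for \<mu>
  proof (cases "\<mu> = \<nu>")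
    case True
    then show ?thesis using lie.subspace_neg[OF weight_vectors_subspace assms(1)] by simp
  next
    case False
    then show ?thesis using that M(2,3) by auto
  qed
  ultimately have "?g \<nu> \<in> J"
    using M(1) weight_vectors_independent[of "insert \<nu> M" ?g \<nu>] lie.subspace_0[OF lie_ideal_subspace[OF J]]
    by auto
  then show ?thesis using lie.subspace_neg[OF lie_ideal_subspace[OF J], of "- x"] by simp
qed

end


section \<open>Algebras with triangular relations\<close>

definition weight :: "('i \<Rightarrow> complex ^ 'm) \<Rightarrow> ('i \<Rightarrow> complex) \<Rightarrow> complex ^ 'm \<Rightarrow> complex" where
  "weight rt u h = (\<Sum>i\<in>UNIV. u i * pairing (rt i) h)"

text \<open>Iterated brackets by the \<open>Z i\<close>, starting from \<open>B\<close>. With \<open>B = range Z\<close> they span the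
  subalgebra generated by the \<open>Z i\<close>; with \<open>B\<close> a single Serre element they span the
  ideal that it generates modulo the relations below.\<close>

inductive_set monomials ::
    "('i \<Rightarrow> 'x free_lie) \<Rightarrow> 'x free_lie set \<Rightarrow> 'x free_lie set"
  for Z :: "'i \<Rightarrow> 'x free_lie" and B :: "'x free_lie set" where
  base: "b \<in> B \<Longrightarrow> b \<in> monomials Z B"
| step: "y \<in> monomials Z B \<Longrightarrow> lie_bracket (Z i) y \<in> monomials Z B"

abbreviation ad_pow :: "'x free_lie \<Rightarrow> nat \<Rightarrow> 'x free_lie \<Rightarrow> 'x free_lie" where
  "ad_pow x n \<equiv> lie_bracket x ^^ n"

lemma ad_pow_add: "ad_pow x n (y + z) = ad_pow x n y + ad_pow x n z"
  by (induction n) (auto simp: lie_bracket_add_right)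

lemma ad_pow_scale: "ad_pow x n (lie_scale c y) = lie_scale c (ad_pow x n y)"
  by (induction n) (auto simp: lie_bracket_scale_right)

lemma ad_pow_diff: "ad_pow x n (y - z) = ad_pow x n y - ad_pow x n z"
  by (induction n) (auto simp: lie_bracket_diff_right)

lemma ad_pow_ideal:
  assumes "lie_ideal J" "y \<in> J"
  shows "ad_pow x n y \<in> J"
  using assms by (induction n) (auto intro: lie_ideal_bracket_right)

lemma ad_pow_congr:
  assumes "lie_ideal J" "congr J y z"
  shows "congr J (ad_pow x n y) (ad_pow x n z)"
  using ad_pow_ideal[OF assms(1), of "y - z" n x] assms(2) by (simp add: congr_def ad_pow_diff)

lemma ad_pow_ideal_mono:
  assumes "lie_ideal J" "ad_pow x n y \<in> J" "n \<le> m"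
  shows "ad_pow x m y \<in> J"
proof -
  have "ad_pow x m y = ad_pow x (m - n) (ad_pow x n y)"
    using assms(3) by (metis funpow_add comp_apply le_add_diff_inverse2)
  then show ?thesis using ad_pow_ideal assms by metis
qed

text \<open>Induction on \<open>M + N\<close>: by the derivation rule one application of \<open>ad e\<close> lowers the exponent
  of one of the two factors.\<close>

lemma ad_pow_bracket:
  assumes "lie_ideal J" "ad_pow e M x \<in> J" "ad_pow e N y \<in> J"
  shows "ad_pow e (M + N) (lie_bracket x y) \<in> J"
  using assms(2,3)
proof (induction "M + N" arbitrary: M N x y)
  case 0
  then show ?case using lie_ideal_bracket_right[OF assms(1)] by simp
next
  case (Suc n)
  show ?case
  proof (cases "M = 0 \<or> N = 0")
    case True
    then have "x \<in> J \<or> y \<in> J" using Suc.prems by auto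
    then have "lie_bracket x y \<in> J"
      using lie_ideal_bracket_right[OF assms(1)] lie_ideal_bracket_left[OF assms(1)] by blast
    then show ?thesis using ad_pow_ideal[OF assms(1)] by blast
  next
    case False
    then obtain M' N' where MN: "M = Suc M'" "N = Suc N'" by (meson not0_implies_Suc)
    have "ad_pow e (M' + N) (lie_bracket (lie_bracket e x) y) \<in> J"
      using Suc.hyps(1)[of M' N "lie_bracket e x" y] Suc.hyps(2) Suc.prems MN
      by (simp add: funpow_swap1)
    moreover have "ad_pow e (M + N') (lie_bracket x (lie_bracket e y)) \<in> J"
      using Suc.hyps(1)[of M N' x "lie_bracket e y"] Suc.hyps(2) Suc.prems MN
      by (simp add: funpow_swap1)
    moreover have "M' + N = n" "M + N' = n" using Suc.hyps(2) MN by auto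
    ultimately have "ad_pow e n (lie_bracket e (lie_bracket x y)) \<in> J"
      using lie.subspace_add[OF lie_ideal_subspace[OF assms(1)]]
      by (simp add: lie_bracket_derivation[of e x y] ad_pow_add)
    then show ?thesis using Suc.hyps(2) by (metis funpow_simps_right(2) comp_apply)
  qed
qed

text \<open>The relations are stated modulo an ideal \<open>J\<close>, so that they cover both the auxiliary
  algebra and \<open>g(A)\<close> itself; and for arbitrary \<open>X\<close> and \<open>Y\<close>, so that every result also
  holds with the roles of the \<open>e\<^sub>i\<close> and \<open>f\<^sub>i\<close> exchanged (\<open>swapped\<close>).\<close>

locale triangular_relations =
  fixes J :: "('i::finite, complex ^ 'm) km_gen free_lie set"
    and X Y :: "'i::finite \<Rightarrow> ('i, complex ^ 'm) km_gen free_lie"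
    and coroot rt :: "'i::finite \<Rightarrow> complex ^ 'm"
    and A :: "int ^ 'i ^ 'i"
  assumes ideal: "lie_ideal J"
    and H_neg: "congr J (gH (- h)) (- gH h)"
    and H_H: "lie_bracket (gH h) (gH h') \<in> J"
    and H_X: "congr J (lie_bracket (gH h) (X i)) (lie_scale (pairing (rt i) h) (X i))"
    and H_Y: "congr J (lie_bracket (gH h) (Y i)) (lie_scale (- pairing (rt i) h) (Y i))"
    and X_Y: "congr J (lie_bracket (X i) (Y j)) (if i = j then gH (coroot i) else 0)"
    and gens: "lie_gen g \<in> range X \<union> range Y \<union> range gH"
    and cartan: "pairing (rt j) (coroot i) = of_int (A $ i $ j)"
    and gcm: "gcm A"
    and weight_inj: "weight rt u = (\<lambda>h. 0) \<Longrightarrow> u = (\<lambda>i. 0)"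
begin

lemmas sub = lie_ideal_subspace[OF ideal]

lemma swapped: "triangular_relations J Y X (\<lambda>i. - coroot i) (\<lambda>i. - rt i) A"
proof
  have neg: "pairing (- a) h = - pairing a h" "pairing a (- h) = - pairing a h" for a h :: "complex ^ 'm"
    by (simp_all add: pairing_def sum_negf)
  fix h h' :: "complex ^ 'm" and i j :: 'i and g :: "('i, complex ^ 'm) km_gen" and u :: "'i \<Rightarrow> complex"
  show "congr J (lie_bracket (Y i) (X j)) (if i = j then gH (- coroot i) else 0)"
  proof -
    have "congr J (- lie_bracket (X j) (Y i)) (- (if j = i then gH (coroot j) else 0))"
      using congr_scale[OF ideal X_Y, of "-1" j i] by (simp add: lie.scale_minus_left[of 1, simplified])
    moreover have "congr J (- (if j = i then gH (coroot j) else 0)) (if i = j then gH (- coroot i) else 0)"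
      using congr_sym[OF ideal H_neg] congr_refl[OF ideal] by auto
    ultimately show ?thesis
      unfolding lie_bracket_anticomm[of "Y i" "X j"] by (rule congr_trans[OF ideal])
  qed
  show "lie_gen g \<in> range Y \<union> range X \<union> range gH" using gens by blast
  show "u = (\<lambda>i. 0)" if "weight (\<lambda>i. - rt i) u = (\<lambda>h. 0)"
  proof (rule weight_inj, rule ext)
    fix h
    have "weight (\<lambda>i. - rt i) u h = 0" using that by simp
    then show "weight rt u h = 0" by (simp add: weight_def neg sum_negf)
  qed
  show "congr J (lie_bracket (gH h) (Y i)) (lie_scale (pairing (- rt i) h) (Y i))"
    using H_Y by (simp add: neg)
  show "congr J (lie_bracket (gH h) (X i)) (lie_scale (- pairing (- rt i) h) (X i))"
    using H_X by (simp add: neg)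
  show "pairing (- rt j) (- coroot i) = of_int (A $ i $ j)" using cartan by (simp add: neg)
qed (use ideal H_neg H_H gcm in auto)

lemma H_weight: "gH h \<in> weight_vectors J (\<lambda>h. 0)"
  using H_H by (simp add: weight_vectors_def congr_0_iff[OF ideal])

lemma Y_weight: "Y i \<in> weight_vectors J (\<lambda>h. - pairing (rt i) h)"
  using H_Y by (simp add: weight_vectors_def)

text \<open>Negative multi-degrees, as functionals on the Cartan subalgebra.\<close>

definition negative_weights :: "(complex ^ 'm \<Rightarrow> complex) set" where
  "negative_weights = {weight rt (\<lambda>i. - of_nat (u i)) | u. \<exists>i. u i \<noteq> (0::nat)}"

lemma zero_not_negative: "(\<lambda>h. 0) \<notin> negative_weights"
proof
  assume "(\<lambda>h. 0) \<in> negative_weights"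
  then obtain u :: "'i \<Rightarrow> nat" and i where u: "(\<lambda>h. 0) = weight rt (\<lambda>i. - of_nat (u i))" "u i \<noteq> 0"
    unfolding negative_weights_def by blast
  then show False using weight_inj[OF u(1)[symmetric]] by (metis neg_equal_0_iff_equal of_nat_eq_0_iff)
qed

lemma weight_indicator:
  "weight rt (\<lambda>k. - of_nat (if k = i then 1 else 0)) = (\<lambda>h. - pairing (rt i) h)"
  unfolding weight_def by (rule ext, subst sum.remove[of _ i]) auto

lemma Y_negative: "Y i \<in> (\<Union>\<mu>\<in>negative_weights. weight_vectors J \<mu>)"
proof -
  have "weight rt (\<lambda>k. - of_nat (if k = i then 1 else 0)) \<in> negative_weights"
    unfolding negative_weights_def by (intro CollectI exI[of _ "\<lambda>k. if k = i then 1 else 0"]) auto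
  then show ?thesis unfolding weight_indicator using Y_weight by blast
qed

lemma monomials_negative:
  assumes "y \<in> monomials Y B" "B \<subseteq> (\<Union>\<mu>\<in>negative_weights. weight_vectors J \<mu>)"
  shows "y \<in> (\<Union>\<mu>\<in>negative_weights. weight_vectors J \<mu>)"
  using assms(1)
proof induction
  case (base b)
  then show ?case using assms(2) by blast
next
  case (step y i)
  then obtain u where u: "y \<in> weight_vectors J (weight rt (\<lambda>i. - of_nat (u i)))" "\<exists>i. u i \<noteq> (0::nat)"
    unfolding negative_weights_def by blast
  let ?u = "u(i := Suc (u i))"
  have "weight rt (\<lambda>k. - of_nat (?u k)) = (\<lambda>h. - pairing (rt i) h + weight rt (\<lambda>i. - of_nat (u i)) h)"
    unfolding weight_def
    by (rule ext, subst (1 2) sum.remove[of _ i]) (auto simp: algebra_simps)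
  then have "lie_bracket (Y i) y \<in> weight_vectors J (weight rt (\<lambda>k. - of_nat (?u k)))"
    using bracket_weight_vectors[OF ideal Y_weight u(1)] by simp
  moreover have "weight rt (\<lambda>k. - of_nat (?u k)) \<in> negative_weights"
    unfolding negative_weights_def by (intro CollectI exI[of _ ?u]) auto
  ultimately show ?case by blast
qed

text \<open>By the derivation rule, \<open>ad X i\<close> either passes to the inner factors of a monomial or meets \<open>Y i\<close>
  and produces an element of the Cartan subalgebra, which acts on the rest by a scalar. The set
  \<open>C\<close> accommodates the two uses: \<open>range gH\<close> for the monomials in the \<open>Y i\<close>, and the
  empty set for the ideal generated by a Serre element.\<close>

lemma X_bracket_monomial:
  fixes B C
  defines "T \<equiv> lie.span (J \<union> C \<union> monomials Y B)"
  assumes "y \<in> monomials Y B" "B \<subseteq> (\<Union>\<mu>\<in>negative_weights. weight_vectors J \<mu>)"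
    and XB: "\<And>i b. b \<in> B \<Longrightarrow> lie_bracket (X i) b \<in> T"
    and YC: "\<And>i c. c \<in> C \<Longrightarrow> lie_bracket (Y i) c \<in> T"
  shows "lie_bracket (X i) y \<in> T"
  using assms(2)
proof induction
  case (base b)
  then show ?case by (rule XB)
next
  case (step y j)
  have JT: "J \<subseteq> T" unfolding T_def by (auto intro: lie.span_base)
  have yT: "y \<in> T" unfolding T_def using step.hyps by (intro lie.span_base) auto
  have Tadd: "a + b \<in> T" if "a \<in> T" "b \<in> T" for a b using that unfolding T_def by (rule lie.span_add)
  have Tcongr: "a \<in> T" if "congr J a b" "b \<in> T" for a b
    using Tadd[of "a - b" b] that JT by (auto simp: congr_def)
  have "lie_bracket (Y j) (lie_bracket (X i) y) \<in> T"
    unfolding T_def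
  proof (rule bracket_span_closed)
    show "lie_bracket (X i) y \<in> lie.span (J \<union> C \<union> monomials Y B)" using step.IH unfolding T_def .
  next
    fix b assume "b \<in> J \<union> C \<union> monomials Y B"
    then consider "b \<in> J" | "b \<in> C" | "b \<in> monomials Y B" by blast
    then have "lie_bracket (Y j) b \<in> T"
    proof cases
      case 1 then show ?thesis using lie_ideal_bracket_right[OF ideal, of b "Y j"] JT by auto
    next
      case 2 then show ?thesis by (rule YC)
    next
      case 3 then show ?thesis unfolding T_def by (intro lie.span_base UnI2 monomials.step)
    qed
    then show "lie_bracket (Y j) b \<in> lie.span (J \<union> C \<union> monomials Y B)" unfolding T_def .
  qed
  moreover have "lie_bracket (lie_bracket (X i) (Y j)) y \<in> T"
  proof -
    obtain \<mu> where \<mu>: "y \<in> weight_vectors J \<mu>" using monomials_negative[OF step.hyps assms(3)] by blast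
    have "congr J (lie_bracket (lie_bracket (X i) (Y j)) y)
        (lie_bracket (if i = j then gH (coroot i) else 0) y)"
      by (rule congr_bracket[OF ideal X_Y congr_refl[OF ideal]])
    moreover have "congr J (lie_bracket (if i = j then gH (coroot i) else 0) y) (lie_scale (if i = j then \<mu> (coroot i) else 0) y)"
      using \<mu> congr_refl[OF ideal] by (auto simp: weight_vectors_def)
    ultimately have "congr J (lie_bracket (lie_bracket (X i) (Y j)) y)
        (lie_scale (if i = j then \<mu> (coroot i) else 0) y)"
      by (rule congr_trans[OF ideal])
    then show ?thesis
    proof (rule Tcongr)
      show "lie_scale (if i = j then \<mu> (coroot i) else 0) y \<in> T"
        using yT unfolding T_def by (rule lie.span_scale)
    qed
  qed
  ultimately show ?case unfolding lie_bracket_derivation[of "X i"] by (intro Tadd)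
qed

lemma H_bracket_span:
  assumes "B \<subseteq> (\<Union>\<mu>. weight_vectors J \<mu>)" "J \<subseteq> B" "z \<in> lie.span B"
  shows "lie_bracket (gH h) z \<in> lie.span B"
  using assms(3)
proof (rule bracket_span_closed)
  fix b assume "b \<in> B"
  then obtain \<mu> where "b \<in> weight_vectors J \<mu>" using assms(1) by blast
  then have "lie_bracket (gH h) b - lie_scale (\<mu> h) b \<in> J" by (auto simp: weight_vectors_def congr_def)
  then have "(lie_bracket (gH h) b - lie_scale (\<mu> h) b) + lie_scale (\<mu> h) b \<in> lie.span B"
    using assms(2) \<open>b \<in> B\<close> by (intro lie.span_add lie.span_scale lie.span_base) auto
  then show "lie_bracket (gH h) b \<in> lie.span B" by simp
qed

lemma X_bracket_negative_part:
  assumes "y \<in> monomials Y (range Y)"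
  shows "lie_bracket (X i) y \<in> lie.span (J \<union> range gH \<union> monomials Y (range Y))"
proof (rule X_bracket_monomial[OF assms])
  show "range Y \<subseteq> (\<Union>\<mu>\<in>negative_weights. weight_vectors J \<mu>)" using Y_negative by blast
next
  fix i b assume "b \<in> range Y"
  then obtain j where b: "b = Y j" by blast
  have "(lie_bracket (X i) b - (if i = j then gH (coroot i) else 0)) + (if i = j then gH (coroot i) else 0)
     \<in> lie.span (J \<union> range gH \<union> monomials Y (range Y))"
    using X_Y[of i j] b by (intro lie.span_add) (auto simp: congr_def intro: lie.span_base lie.span_zero)
  then show "lie_bracket (X i) b \<in> lie.span (J \<union> range gH \<union> monomials Y (range Y))" by simp
next
  fix i c assume "c \<in> range (gH :: _ \<Rightarrow> ('i, complex ^ 'm) km_gen free_lie)"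
  then obtain h where c: "c = gH h" by blast
  have Yi: "Y i \<in> monomials Y (range Y)" by (auto intro: monomials.base)
  let ?s = "lie_scale (- pairing (rt i) h) (Y i)"
  have "- ((lie_bracket c (Y i) - ?s) + ?s) \<in> lie.span (J \<union> range gH \<union> monomials Y (range Y))"
    using H_Y[of h i] c Yi
    by (intro lie.span_neg lie.span_add lie.span_scale) (auto simp: congr_def intro: lie.span_base)
  then show "lie_bracket (Y i) c \<in> lie.span (J \<union> range gH \<union> monomials Y (range Y))"
    by (simp add: lie_bracket_anticomm[of "Y i" c])
qed

end

context triangular_relations
begin

interpretation swap: triangular_relations J Y X "\<lambda>i. - coroot i" "\<lambda>i. - rt i" A
  by (rule swapped)

text \<open>The span is stable under \<open>ad\<close> of every generator, hence an ideal, and it contains the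
  generators.\<close>

theorem triangular_decomposition:
  "z \<in> lie.span (J \<union> range gH \<union> monomials X (range X) \<union> monomials Y (range Y))"
    (is "z \<in> lie.span ?B")
proof -
  let ?N = "J \<union> range gH \<union> monomials Y (range Y)" and ?P = "J \<union> range gH \<union> monomials X (range X)"
  have N: "lie.span ?N \<subseteq> lie.span ?B" and P: "lie.span ?P \<subseteq> lie.span ?B"
    by (rule lie.span_mono, blast)+
  have B_weight: "?B \<subseteq> (\<Union>\<mu>. weight_vectors J \<mu>)"
  proof -
    have "monomials Y (range Y) \<subseteq> (\<Union>\<mu>. weight_vectors J \<mu>)"
      using monomials_negative[of _ "range Y"] Y_negative by blast
    moreover have "monomials X (range X) \<subseteq> (\<Union>\<mu>. weight_vectors J \<mu>)"
      using swap.monomials_negative[of _ "range X"] swap.Y_negative by blast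
    ultimately show ?thesis using H_weight ideal_subset_weight_vectors[OF ideal] by blast
  qed
  have HB: "lie_bracket (Z i) (gH h) \<in> lie.span ?B" if "Z = X \<or> Z = Y" for Z i h
  proof -
    have "Z i \<in> ?B" using that by (auto intro: monomials.base)
    then have "lie_bracket (gH h) (Z i) \<in> lie.span ?B"
      by (intro H_bracket_span[OF B_weight] lie.span_base) auto
    then show ?thesis unfolding lie_bracket_anticomm[of "Z i" "gH h"] by (rule lie.span_neg)
  qed
  have "lie_bracket (lie_gen g) y \<in> lie.span ?B" if "y \<in> lie.span ?B" for g y
  proof -
    have "lie_bracket (X i) b \<in> lie.span ?B" if "b \<in> ?B" for i b
    proof -
      consider "b \<in> J" | "b \<in> range gH" | "b \<in> monomials X (range X)" | "b \<in> monomials Y (range Y)"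
        using \<open>b \<in> ?B\<close> by blast
      then show ?thesis
      proof cases
        case 1 then show ?thesis using lie_ideal_bracket_right[OF ideal] by (blast intro: lie.span_base)
      next
        case 2 then show ?thesis using HB by blast
      next
        case 3 then show ?thesis by (blast intro: lie.span_base monomials.step)
      next
        case 4 then show ?thesis using X_bracket_negative_part N by blast
      qed
    qed
    moreover have "lie_bracket (Y i) b \<in> lie.span ?B" if "b \<in> ?B" for i b
    proof -
      consider "b \<in> J" | "b \<in> range gH" | "b \<in> monomials X (range X)" | "b \<in> monomials Y (range Y)"
        using \<open>b \<in> ?B\<close> by blast
      then show ?thesis
      proof cases
        case 1 then show ?thesis using lie_ideal_bracket_right[OF ideal] by (blast intro: lie.span_base)
      next
        case 2 then show ?thesis using HB by blast
      next
        case 3 then show ?thesis using swap.X_bracket_negative_part P by blast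
      next
        case 4 then show ?thesis by (blast intro: lie.span_base monomials.step)
      qed
    qed
    moreover have "lie_bracket (gH h) y \<in> lie.span ?B" for h
      by (rule H_bracket_span[OF B_weight _ that]) blast
    ultimately show ?thesis
      using gens[of g] bracket_span_closed[OF that, of "lie_gen g" ?B] by auto
  qed
  then have ideal_B: "lie_ideal (lie.span ?B)" by (intro lie_idealI lie.subspace_span)
  show ?thesis
  proof (rule free_lie_induct)
    show "lie_gen g \<in> lie.span ?B" for g
      using gens[of g] by (auto intro!: lie.span_base monomials.base)
  qed (use ideal_B in \<open>auto intro: lie_ideal_bracket_right\<close>)
qed

text \<open>All weights occurring in the triangular decomposition have coordinates of one sign.\<close>

lemma weights_coherent:
  assumes "x \<in> weight_vectors J \<mu>" "x \<notin> J"
  shows "\<exists>u s. \<mu> = weight rt (\<lambda>i. s * of_nat (u i)) \<and> (s = 1 \<or> s = - 1)"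
proof (rule ccontr)
  assume no: "\<not> ?thesis"
  let ?P = "insert (\<lambda>h. 0) (negative_weights \<union> swap.negative_weights)"
  have swp: "weight (\<lambda>i. - rt i) (\<lambda>i. - of_nat (u i)) = weight rt (\<lambda>i. 1 * of_nat (u i))" for u
    by (rule ext) (simp add: weight_def pairing_def sum_negf)
  have no': "\<mu> \<noteq> weight rt (\<lambda>i. s * of_nat (u i))" if "s = 1 \<or> s = - 1" for u s
    using no that by blast
  have "(\<lambda>h. 0) = weight rt (\<lambda>i. 1 * of_nat 0)" by (rule ext) (simp add: weight_def)
  then have "\<mu> \<noteq> (\<lambda>h. 0)" using no'[of 1 "\<lambda>_. 0"] by simp
  moreover have "\<mu> \<notin> negative_weights"
  proof
    assume "\<mu> \<in> negative_weights"
    then obtain u where "\<mu> = weight rt (\<lambda>i. - 1 * of_nat (u i))"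
      unfolding negative_weights_def by auto
    then show False using no by blast
  qed
  moreover have "\<mu> \<notin> swap.negative_weights"
    using no unfolding swap.negative_weights_def swp by blast
  ultimately have P: "\<mu> \<notin> ?P" by blast
  have "J \<union> range gH \<union> monomials X (range X) \<union> monomials Y (range Y)
      \<subseteq> (\<Union>\<mu>\<in>?P. weight_vectors J \<mu>)"
  proof (intro Un_least subsetI)
    show "z \<in> (\<Union>\<mu>\<in>?P. weight_vectors J \<mu>)" if "z \<in> J" for z
      using subsetD[OF ideal_subset_weight_vectors[OF ideal, of "\<lambda>h. 0"] that] by auto
    show "z \<in> (\<Union>\<mu>\<in>?P. weight_vectors J \<mu>)" if "z \<in> range gH" for z
      using that H_weight by auto
    show "z \<in> (\<Union>\<mu>\<in>?P. weight_vectors J \<mu>)" if "z \<in> monomials X (range X)" for z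
      using swap.monomials_negative[OF that image_subsetI[OF swap.Y_negative]] by auto
    show "z \<in> (\<Union>\<mu>\<in>?P. weight_vectors J \<mu>)" if "z \<in> monomials Y (range Y)" for z
      using monomials_negative[OF that image_subsetI[OF Y_negative]] by auto
  qed
  then have "x \<in> lie.span (\<Union>\<mu>\<in>?P. weight_vectors J \<mu>)"
    by (rule subsetD[OF lie.span_mono triangular_decomposition])
  then show False using weight_vector_of_other_weight[OF ideal assms(1) _ P] assms(2) by blast
qed

end


section \<open>Integrability and invariance of weights\<close>

context triangular_relations
begin

lemma A_diag: "A $ i $ i = 2"
  using gcm by (simp add: gcm_def)

text \<open>The \<open>sl\<^sub>2\<close>-identity \<open>[e, f\<^sup>k\<^sup>+\<^sup>1] = (k + 1) f\<^sup>k (h - k)\<close>, applied to a vector on which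
  \<open>h\<close> acts by \<open>c\<close>.\<close>

lemma sl2_raise:
  assumes x: "congr J (lie_bracket (gH (coroot i)) x) (lie_scale c x)"
  shows "congr J (lie_bracket (X i) (ad_pow (Y i) (Suc k) x))
      (ad_pow (Y i) (Suc k) (lie_bracket (X i) x)
         + lie_scale (of_nat (Suc k) * (c - of_nat k)) (ad_pow (Y i) k x))"
proof -
  let ?h = "gH (coroot i) :: ('i, complex ^ 'm) km_gen free_lie" and ?f = "\<lambda>k. ad_pow (Y i) k"
  have hY: "congr J (lie_bracket ?h (Y i)) (lie_scale (- 2) (Y i))"
    using H_Y[of "coroot i" i] by (simp add: cartan A_diag)
  have weight: "congr J (lie_bracket ?h (?f k x)) (lie_scale (c - 2 * of_nat k) (?f k x))" for k
  proof (induction k)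
    case 0
    then show ?case using x by simp
  next
    case (Suc k)
    have "congr J (lie_bracket (lie_bracket ?h (Y i)) (?f k x) + lie_bracket (Y i) (lie_bracket ?h (?f k x)))
       (lie_bracket (lie_scale (- 2) (Y i)) (?f k x)
         + lie_bracket (Y i) (lie_scale (c - 2 * of_nat k) (?f k x)))"
      by (intro congr_add[OF ideal] congr_bracket[OF ideal] hY Suc congr_refl[OF ideal])
    moreover have "lie_bracket (lie_scale (- 2) (Y i)) (?f k x)
         + lie_bracket (Y i) (lie_scale (c - 2 * of_nat k) (?f k x))
       = lie_scale (c - 2 * of_nat (Suc k)) (?f (Suc k) x)"
      unfolding lie_bracket_scale_left lie_bracket_scale_right funpow.simps comp_apply
        lie.scale_left_distrib[symmetric]
      by (rule arg_cong[where f = "\<lambda>t. lie_scale t _"]) (simp add: algebra_simps)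
    ultimately show ?case using lie_bracket_derivation[of ?h "Y i" "?f k x"] by simp
  qed
  have eY: "congr J (lie_bracket (X i) (Y i)) ?h" using X_Y[of i i] by simp
  show "congr J (lie_bracket (X i) (?f (Suc k) x))
      (?f (Suc k) (lie_bracket (X i) x) + lie_scale (of_nat (Suc k) * (c - of_nat k)) (?f k x))"
  proof (induction k)
    case 0
    have "congr J (lie_bracket (lie_bracket (X i) (Y i)) x + lie_bracket (Y i) (lie_bracket (X i) x))
       (lie_scale c x + lie_bracket (Y i) (lie_bracket (X i) x))"
      using congr_trans[OF ideal congr_bracket[OF ideal eY congr_refl[OF ideal]] x]
      by (intro congr_add[OF ideal] congr_refl[OF ideal])
    then show ?case by (simp add: lie_bracket_derivation[of "X i" "Y i" x] add.commute)
  next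
    case (Suc k)
    let ?y = "?f (Suc k) x"
    have "congr J (lie_bracket (lie_bracket (X i) (Y i)) ?y) (lie_scale (c - 2 * of_nat (Suc k)) ?y)"
      using congr_trans[OF ideal congr_bracket[OF ideal eY congr_refl[OF ideal]] weight[of "Suc k"]] .
    moreover have "congr J (lie_bracket (Y i) (lie_bracket (X i) ?y))
      (lie_bracket (Y i) (?f (Suc k) (lie_bracket (X i) x)
        + lie_scale (of_nat (Suc k) * (c - of_nat k)) (?f k x)))"
      by (intro congr_bracket[OF ideal congr_refl[OF ideal]] Suc)
    ultimately have "congr J (lie_bracket (X i) (lie_bracket (Y i) ?y))
      (lie_scale (c - 2 * of_nat (Suc k)) ?y + lie_bracket (Y i) (?f (Suc k) (lie_bracket (X i) x)
        + lie_scale (of_nat (Suc k) * (c - of_nat k)) (?f k x)))"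
      unfolding lie_bracket_derivation[of "X i" "Y i" ?y] by (rule congr_add[OF ideal])
    moreover have "lie_scale (c - 2 * of_nat (Suc k)) ?y + lie_bracket (Y i) (?f (Suc k) (lie_bracket (X i) x)
        + lie_scale (of_nat (Suc k) * (c - of_nat k)) (?f k x))
      = ?f (Suc (Suc k)) (lie_bracket (X i) x)
         + lie_scale ((c - 2 * of_nat (Suc k)) + of_nat (Suc k) * (c - of_nat k)) ?y"
      unfolding lie.scale_left_distrib
      by (simp add: lie_bracket_add_right lie_bracket_scale_right add_ac)
    moreover have "(c - 2 * of_nat (Suc k)) + of_nat (Suc k) * (c - of_nat k)
        = of_nat (Suc (Suc k)) * (c - of_nat (Suc k))"
      by (simp add: algebra_simps)
    ultimately show ?case by simp
  qed
qed

text \<open>If \<open>f\<^sup>n x = 0\<close> and \<open>x\<close> has weight \<open>n\<close>, then \<open>f\<^sup>n\<^sup>+\<^sup>1 e x = 0\<close> by the commutation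
  rule, and \<open>e x\<close> has weight \<open>n + 2\<close>. Thus vanishing climbs along the string of \<open>x\<close>.\<close>

lemma raised_power_vanishes:
  assumes "congr J (lie_bracket (gH (coroot i)) x) (lie_scale (of_nat n) x)"
    and "ad_pow (Y i) n x \<in> J"
  shows "ad_pow (Y i) (n + p) (ad_pow (X i) p x) \<in> J"
    and "congr J (lie_bracket (gH (coroot i)) (ad_pow (X i) p x))
           (lie_scale (of_nat (n + 2 * p)) (ad_pow (X i) p x))"
proof -
  have hX: "congr J (lie_bracket (gH (coroot i)) (X i)) (lie_scale 2 (X i))"
    using H_X[of "coroot i" i] by (simp add: cartan A_diag)
  have "ad_pow (Y i) (n + p) (ad_pow (X i) p x) \<in> J \<and>
    congr J (lie_bracket (gH (coroot i)) (ad_pow (X i) p x))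
      (lie_scale (of_nat (n + 2 * p)) (ad_pow (X i) p x))"
  proof (induction p)
    case 0
    then show ?case using assms by simp
  next
    case (Suc p)
    let ?y = "ad_pow (X i) p x"
    from Suc have y: "ad_pow (Y i) (n + p) ?y \<in> J"
      "congr J (lie_bracket (gH (coroot i)) ?y) (lie_scale (of_nat (n + 2 * p)) ?y)" by auto
    let ?d = "lie_scale (of_nat (Suc (n + p)) * (of_nat (n + 2 * p) - of_nat (n + p)))
       (ad_pow (Y i) (n + p) ?y)"
    have "ad_pow (Y i) (Suc (n + p)) ?y \<in> J" by (rule ad_pow_ideal_mono[OF ideal y(1)]) simp
    then have "lie_bracket (X i) (ad_pow (Y i) (Suc (n + p)) ?y) \<in> J"
      by (rule lie_ideal_bracket_right[OF ideal])
    then have "ad_pow (Y i) (Suc (n + p)) (lie_bracket (X i) ?y) + ?d \<in> J"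
      using sl2_raise[OF y(2), of "n + p"] congr_mem_iff[OF ideal] by blast
    moreover have "?d \<in> J" using y(1) by (rule lie.subspace_scale[OF sub])
    ultimately have "ad_pow (Y i) (Suc (n + p)) (lie_bracket (X i) ?y) \<in> J"
      using lie.subspace_diff[OF sub, of "ad_pow (Y i) (Suc (n + p)) (lie_bracket (X i) ?y) + ?d" ?d]
      by simp
    moreover have "congr J (lie_bracket (gH (coroot i)) (lie_bracket (X i) ?y))
       (lie_bracket (lie_scale 2 (X i)) ?y + lie_bracket (X i) (lie_scale (of_nat (n + 2 * p)) ?y))"
      unfolding lie_bracket_derivation[of "gH (coroot i)" "X i" ?y]
      by (intro congr_add[OF ideal] congr_bracket[OF ideal] hX y congr_refl[OF ideal])
    moreover have "lie_bracket (lie_scale 2 (X i)) ?y + lie_bracket (X i) (lie_scale (of_nat (n + 2 * p)) ?y)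
       = lie_scale (of_nat (n + 2 * Suc p)) (lie_bracket (X i) ?y)"
      by (simp add: lie_bracket_scale_left lie_bracket_scale_right flip: lie.scale_left_distrib)
    ultimately show ?case by simp
  qed
  then show "ad_pow (Y i) (n + p) (ad_pow (X i) p x) \<in> J"
    "congr J (lie_bracket (gH (coroot i)) (ad_pow (X i) p x))
           (lie_scale (of_nat (n + 2 * p)) (ad_pow (X i) p x))" by auto
qed

text \<open>Applying \<open>e\<close> to \<open>f\<^sup>k\<^sup>+\<^sup>1 y\<close> gives back \<open>f\<^sup>k y\<close> times \<open>(k + 1) (M - k)\<close>, which is nonzero for
  \<open>k < M\<close>.\<close>

lemma highest_weight_string:
  assumes "congr J (lie_bracket (gH (coroot i)) y) (lie_scale (of_nat M) y)"
    and "lie_bracket (X i) y \<in> J" "y \<notin> J" "k \<le> M"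
  shows "ad_pow (Y i) k y \<notin> J"
  using assms(4)
proof (induction k)
  case 0
  then show ?case using assms(3) by simp
next
  case (Suc k)
  show ?case
  proof
    assume "ad_pow (Y i) (Suc k) y \<in> J"
    then have "lie_bracket (X i) (ad_pow (Y i) (Suc k) y) \<in> J"
      by (rule lie_ideal_bracket_right[OF ideal])
    let ?a = "ad_pow (Y i) (Suc k) (lie_bracket (X i) y)"
    let ?c = "of_nat (Suc k) * (of_nat M - of_nat k) :: complex"
    have "?a + lie_scale ?c (ad_pow (Y i) k y) \<in> J"
      using \<open>lie_bracket (X i) (ad_pow (Y i) (Suc k) y) \<in> J\<close> sl2_raise[OF assms(1), of k]
        congr_mem_iff[OF ideal] by blast
    moreover have "?a \<in> J" by (rule ad_pow_ideal[OF ideal assms(2)])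
    ultimately have "lie_scale ?c (ad_pow (Y i) k y) \<in> J"
      using lie.subspace_diff[OF sub, of "?a + lie_scale ?c (ad_pow (Y i) k y)" ?a] by simp
    then have "lie_scale (1 / ?c) (lie_scale ?c (ad_pow (Y i) k y)) \<in> J"
      by (rule lie.subspace_scale[OF sub])
    moreover have "?c \<noteq> 0"
    proof -
      have "of_nat M \<noteq> (of_nat k :: complex)" using Suc.prems by (simp del: of_nat_diff)
      then show ?thesis by (simp del: of_nat_Suc)
    qed
    ultimately have "ad_pow (Y i) k y \<in> J" by (simp del: of_nat_Suc)
    then show False using Suc by simp
  qed
qed

text \<open>Let \<open>y = e\<^sup>p x\<close> be the last nonzero vector obtained from \<open>x\<close> by raising. It is a highest
  weight vector of weight \<open>n + 2 p\<close>, so \<open>f\<^sup>n\<^sup>+\<^sup>p y\<close> is nonzero. If \<open>f\<^sup>n x\<close> vanished, so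
  would \<open>f\<^sup>n\<^sup>+\<^sup>p y\<close>.\<close>

lemma lowering_power_nonzero:
  assumes x: "congr J (lie_bracket (gH (coroot i)) x) (lie_scale (of_nat n) x)" "x \<notin> J"
    and nil: "\<exists>N. ad_pow (X i) N x \<in> J"
  shows "ad_pow (Y i) n x \<notin> J"
proof
  assume fx: "ad_pow (Y i) n x \<in> J"
  define N where "N = (LEAST N. ad_pow (X i) N x \<in> J)"
  have N: "ad_pow (X i) N x \<in> J" unfolding N_def using nil by (rule LeastI_ex)
  with x(2) have "N \<noteq> 0" by (intro notI) simp
  then obtain p where p: "N = Suc p" using not0_implies_Suc by blast
  let ?y = "ad_pow (X i) p x"
  have "?y \<notin> J" using not_less_Least[of p "\<lambda>N. ad_pow (X i) N x \<in> J"] p N_def by simp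
  moreover have "lie_bracket (X i) ?y \<in> J" using N p by simp
  ultimately have "ad_pow (Y i) (n + p) ?y \<notin> J"
    using raised_power_vanishes(2)[OF x(1) fx, of p] by (rule_tac highest_weight_string[of _ _ "n + 2 * p"]) auto
  then show False using raised_power_vanishes(1)[OF x(1) fx, of p] by simp
qed

lemma lowering_power_weight:
  assumes "x \<in> weight_vectors J \<mu>"
  shows "ad_pow (Y i) n x \<in> weight_vectors J (\<lambda>h. \<mu> h - of_nat n * pairing (rt i) h)"
proof (induction n)
  case 0
  then show ?case using assms by simp
next
  case (Suc n)
  from bracket_weight_vectors[OF ideal Y_weight this, of i]
  show ?case by (simp add: algebra_simps)
qed

definition serre_element :: "'i \<Rightarrow> 'i \<Rightarrow> ('i, complex ^ 'm) km_gen free_lie" where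
  "serre_element i j = ad_pow (Y i) (Suc (nat (- A $ i $ j))) (Y j)"

lemma X_ad_pow_other:
  assumes "k \<noteq> i"
  shows "congr J (lie_bracket (X k) (ad_pow (Y i) n y)) (ad_pow (Y i) n (lie_bracket (X k) y))"
proof (induction n)
  case 0
  then show ?case using congr_refl[OF ideal] by simp
next
  case (Suc n)
  have "congr J (lie_bracket (lie_bracket (X k) (Y i)) (ad_pow (Y i) n y)
      + lie_bracket (Y i) (lie_bracket (X k) (ad_pow (Y i) n y)))
    (lie_bracket 0 (ad_pow (Y i) n y) + lie_bracket (Y i) (ad_pow (Y i) n (lie_bracket (X k) y)))"
    using X_Y[of k i] assms Suc
    by (intro congr_add[OF ideal] congr_bracket[OF ideal] congr_refl[OF ideal]) auto
  then show ?case by (simp add: lie_bracket_derivation[of "X k"])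
qed

text \<open>For \<open>k = i\<close> this is the vanishing of the \<open>sl\<^sub>2\<close>-coefficient at the end of the string through
  \<open>Y j\<close>; for \<open>k = j\<close> the innermost bracket becomes a coroot, which two applications of
  \<open>ad Y i\<close> kill, and one suffices when \<open>A\<^sub>i\<^sub>j = 0\<close> because then \<open>A\<^sub>j\<^sub>i = 0\<close>.\<close>

lemma X_kills_serre_element:
  assumes ij: "i \<noteq> j"
  shows "lie_bracket (X k) (serre_element i j) \<in> J"
proof -
  let ?m = "nat (- A $ i $ j)"
  have Aij: "A $ i $ j \<le> 0" "A $ i $ j = 0 \<longleftrightarrow> A $ j $ i = 0" using gcm ij unfolding gcm_def by auto
  have XYj: "lie_bracket (X k) (Y j) \<in> J" if "k \<noteq> j" for k
    using X_Y[of k j] that congr_0_iff[OF ideal] by simp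
  consider "k = i" | "k \<noteq> i" "k \<noteq> j" | "k \<noteq> i" "k = j" by blast
  then show ?thesis
  proof cases
    case 1
    have "congr J (lie_bracket (gH (coroot i)) (Y j)) (lie_scale (of_nat ?m) (Y j))"
      using H_Y[of "coroot i" j] Aij(1) by (simp add: cartan)
    from sl2_raise[OF this, of ?m]
    have "congr J (lie_bracket (X i) (serre_element i j)) (ad_pow (Y i) (Suc ?m) (lie_bracket (X i) (Y j)))"
      by (simp add: serre_element_def)
    moreover have "ad_pow (Y i) (Suc ?m) (lie_bracket (X i) (Y j)) \<in> J"
      by (rule ad_pow_ideal[OF ideal XYj[OF ij]])
    ultimately show ?thesis using 1 congr_mem_iff[OF ideal] by blast
  next
    case 2
    have "ad_pow (Y i) (Suc ?m) (lie_bracket (X k) (Y j)) \<in> J"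
      by (rule ad_pow_ideal[OF ideal XYj[OF 2(2)]])
    then show ?thesis
      unfolding serre_element_def using X_ad_pow_other[OF 2(1)] congr_mem_iff[OF ideal] by blast
  next
    case 3
    let ?H = "gH (coroot j) :: ('i, complex ^ 'm) km_gen free_lie"
    have "congr J (ad_pow (Y i) (Suc ?m) (lie_bracket (X j) (Y j))) (ad_pow (Y i) (Suc ?m) ?H)"
      using X_Y[of j j] by (intro ad_pow_congr[OF ideal]) simp
    moreover have "ad_pow (Y i) (Suc ?m) ?H \<in> J"
    proof -
      have "congr J (lie_scale (- 1) (lie_bracket ?H (Y i))) (lie_scale (- 1) (lie_scale (- pairing (rt i) (coroot j)) (Y i)))"
        by (rule congr_scale[OF ideal H_Y])
      then have YH: "congr J (lie_bracket (Y i) ?H) (lie_scale (of_int (A $ j $ i)) (Y i))"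
        by (simp add: lie_bracket_anticomm[of "Y i" ?H] cartan)
      show ?thesis
      proof (cases "A $ i $ j = 0")
        case True
        then have "lie_bracket (Y i) ?H \<in> J" using YH Aij(2) congr_0_iff[OF ideal] by simp
        then have "ad_pow (Y i) ?m (lie_bracket (Y i) ?H) \<in> J" by (rule ad_pow_ideal[OF ideal])
        then show ?thesis by (simp add: funpow_swap1)
      next
        case False
        then obtain m' where m': "?m = Suc m'" using Aij(1) not0_implies_Suc[of ?m] by auto
        have "congr J (lie_bracket (Y i) (lie_bracket (Y i) ?H))
            (lie_bracket (Y i) (lie_scale (of_int (A $ j $ i)) (Y i)))"
          by (intro congr_bracket[OF ideal congr_refl[OF ideal] YH])
        then have "lie_bracket (Y i) (lie_bracket (Y i) ?H) \<in> J"
          by (simp add: lie_bracket_scale_right lie_bracket_self congr_0_iff[OF ideal])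
        then have "ad_pow (Y i) m' (lie_bracket (Y i) (lie_bracket (Y i) ?H)) \<in> J"
          by (rule ad_pow_ideal[OF ideal])
        then show ?thesis by (simp add: funpow_swap1 m')
      qed
    qed
    ultimately have "ad_pow (Y i) (Suc ?m) (lie_bracket (X j) (Y j)) \<in> J"
      using congr_mem_iff[OF ideal] by blast
    then show ?thesis
      unfolding serre_element_def using 3 X_ad_pow_other[OF 3(1)] congr_mem_iff[OF ideal] by blast
  qed
qed

lemma serre_element_monomial: "serre_element i j \<in> monomials Y (range Y)"
proof -
  have "ad_pow (Y i) n (Y j) \<in> monomials Y (range Y)" for n
    by (induction n) (auto intro: monomials.intros)
  then show ?thesis unfolding serre_element_def .
qed

text \<open>Since the Serre element is annihilated by every \<open>ad X k\<close>, the ideal it generates is spanned by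
  vectors of negative weight, and weight \<open>0\<close> is not among these.\<close>

theorem serre_ideal:
  assumes ij: "i \<noteq> j"
  obtains J' where "lie_ideal J'" "J \<subseteq> J'" "serre_element i j \<in> J'"
    "\<And>h. gH h \<in> J' \<Longrightarrow> gH h \<in> J"
proof -
  let ?\<theta> = "serre_element i j" and ?W = "\<Union>\<mu>\<in>negative_weights. weight_vectors J \<mu>"
  let ?M = "monomials Y {?\<theta>}"
  define T where "T = lie.span (J \<union> {} \<union> ?M)"
  have \<theta>: "{?\<theta>} \<subseteq> ?W"
    using monomials_negative[OF serre_element_monomial image_subsetI[OF Y_negative]] by blast
  have M: "?M \<subseteq> ?W" using monomials_negative[OF _ \<theta>] by blast
  have JT: "y \<in> T" if "y \<in> J" for y using that unfolding T_def by (intro lie.span_base) auto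
  have MT: "y \<in> T" if "y \<in> ?M" for y using that unfolding T_def by (intro lie.span_base) auto
  have "lie_bracket (lie_gen g) y \<in> T" if y: "y \<in> T" for g y
  proof -
    have X: "lie_bracket (X k) b \<in> T" if "b \<in> J \<union> {} \<union> ?M" for k b
    proof (cases "b \<in> J")
      case True
      then show ?thesis by (intro JT lie_ideal_bracket_right[OF ideal])
    next
      case False
      with that have "b \<in> ?M" by simp
      then show ?thesis
        unfolding T_def
      proof (rule X_bracket_monomial[OF _ \<theta>])
        fix k b assume "b \<in> {?\<theta>}"
        then show "lie_bracket (X k) b \<in> lie.span (J \<union> {} \<union> ?M)"
          using JT[OF X_kills_serre_element[OF ij, of k]] unfolding T_def by simp
      qed simp
    qed
    have Y: "lie_bracket (Y k) b \<in> T" if "b \<in> J \<union> {} \<union> ?M" for k b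
      using that JT[OF lie_ideal_bracket_right[OF ideal, of b "Y k"]] MT[OF monomials.step[of b Y _ k]]
      by auto
    have H: "lie_bracket (gH h) y \<in> T" for h
      unfolding T_def
    proof (rule H_bracket_span)
      show "J \<union> {} \<union> ?M \<subseteq> (\<Union>\<mu>. weight_vectors J \<mu>)"
        using M ideal_subset_weight_vectors[OF ideal, of "\<lambda>h. 0"] by blast
    qed (use y T_def in auto)
    show ?thesis
      using gens[of g] H bracket_span_closed[OF y[unfolded T_def], of "lie_gen g"] X Y
      unfolding T_def by auto
  qed
  then have "lie_ideal T" unfolding T_def by (intro lie_idealI lie.subspace_span)
  moreover have "J \<subseteq> T" using JT by blast
  moreover have "?\<theta> \<in> T" by (intro MT monomials.base) simp
  moreover have "gH h \<in> J" if h: "gH h \<in> T" for h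
  proof -
    obtain a b where ab: "gH h = a + b" "a \<in> lie.span J" "b \<in> lie.span ?M"
      using h unfolding T_def Un_empty_right lie.span_Un by blast
    have a: "a \<in> J" using subsetD[OF lie.span_minimal[OF subset_refl sub] ab(2)] .
    have "congr J (gH h) b" using ab(1) a by (simp add: congr_def)
    then have "b \<in> weight_vectors J (\<lambda>h. 0)" using weight_vectors_congr[OF ideal] H_weight by blast
    moreover have "b \<in> lie.span ?W" by (rule subsetD[OF lie.span_mono[OF M] ab(3)])
    ultimately have "b \<in> J" by (rule weight_vector_of_other_weight[OF ideal _ _ zero_not_negative])
    then show ?thesis using ab(1) a lie.subspace_add[OF sub] by simp
  qed
  ultimately show ?thesis by (rule that)
qed

text \<open>The vectors killed by a power of a derivation form a subalgebra, so only the generators matter;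
  for the \<open>Y j\<close> this is the Serre relation.\<close>

lemma ad_Y_locally_nilpotent:
  assumes serre: "\<And>j. i \<noteq> j \<Longrightarrow> serre_element i j \<in> J"
  shows "\<exists>N. ad_pow (Y i) N x \<in> J"
proof -
  have Yi: "ad_pow (Y i) 1 (Y i) \<in> J"
    using lie.subspace_0[OF sub] by (simp add: lie_bracket_self)
  have H: "ad_pow (Y i) 2 (gH h) \<in> J" for h
  proof -
    have "congr J (lie_scale (- 1) (lie_bracket (gH h) (Y i))) (lie_scale (- 1) (lie_scale (- pairing (rt i) h) (Y i)))"
      by (rule congr_scale[OF ideal H_Y])
    then have "congr J (lie_bracket (Y i) (gH h)) (lie_scale (pairing (rt i) h) (Y i))"
      by (simp add: lie_bracket_anticomm[of "Y i" "gH h"])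
    then have "congr J (lie_bracket (Y i) (lie_bracket (Y i) (gH h)))
        (lie_bracket (Y i) (lie_scale (pairing (rt i) h) (Y i)))"
      by (intro congr_bracket[OF ideal congr_refl[OF ideal]])
    then show ?thesis
      by (simp add: lie_bracket_scale_right lie_bracket_self congr_0_iff[OF ideal] numeral_2_eq_2)
  qed
  then have H': "\<exists>N. ad_pow (Y i) N (gH h) \<in> J" for h by blast
  have X: "\<exists>N. ad_pow (Y i) N (X j) \<in> J" for j
  proof -
    let ?H = "if i = j then gH (- coroot i) else 0 :: ('i, complex ^ 'm) km_gen free_lie"
    have "congr J (lie_bracket (Y i) (X j)) ?H"
      using triangular_relations.X_Y[OF swapped, of i j] .
    then have "congr J (ad_pow (Y i) 2 (lie_bracket (Y i) (X j))) (ad_pow (Y i) 2 ?H)"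
      by (rule ad_pow_congr[OF ideal])
    moreover have "ad_pow (Y i) 2 ?H \<in> J"
      using H lie.subspace_0[OF sub] ad_pow_ideal[OF ideal] by auto
    ultimately have "ad_pow (Y i) 2 (lie_bracket (Y i) (X j)) \<in> J"
      using congr_mem_iff[OF ideal] by blast
    then have "ad_pow (Y i) (Suc 2) (X j) \<in> J" unfolding funpow_Suc_right comp_apply .
    then show ?thesis by blast
  qed
  have Y: "\<exists>N. ad_pow (Y i) N (Y j) \<in> J" for j
    using Yi serre[of j] unfolding serre_element_def by (cases "i = j") blast+
  let ?S = "{x. \<exists>N. ad_pow (Y i) N x \<in> J}"
  have "x \<in> ?S"
  proof (rule free_lie_induct)
    show "lie.subspace ?S"
      unfolding lie.subspace_def
    proof (intro conjI ballI allI)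
      have "ad_pow (Y i) 0 0 \<in> J" using lie.subspace_0[OF sub] by simp
      then show "0 \<in> ?S" by blast
    next
      fix x y assume "x \<in> ?S" "y \<in> ?S"
      then obtain M N where "ad_pow (Y i) M x \<in> J" "ad_pow (Y i) N y \<in> J" by blast
      then have "ad_pow (Y i) (max M N) x \<in> J" "ad_pow (Y i) (max M N) y \<in> J"
        by (auto intro: ad_pow_ideal_mono[OF ideal])
      then have "ad_pow (Y i) (max M N) (x + y) \<in> J"
        unfolding ad_pow_add by (rule lie.subspace_add[OF sub])
      then show "x + y \<in> ?S" by blast
    next
      fix c x assume "x \<in> ?S"
      then obtain M where "ad_pow (Y i) M x \<in> J" by blast
      then have "ad_pow (Y i) M (lie_scale c x) \<in> J"
        unfolding ad_pow_scale by (rule lie.subspace_scale[OF sub])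
      then show "lie_scale c x \<in> ?S" by blast
    qed
    show "lie_gen g \<in> ?S" for g using gens[of g] X Y H' by auto
    show "lie_bracket x y \<in> ?S" if "x \<in> ?S" "y \<in> ?S" for x y
      using that ad_pow_bracket[OF ideal] by blast
  qed
  then show ?thesis by blast
qed

end


section \<open>The root system of a Kac-Moody algebra\<close>

lemma lie_ideal_km_aux_ideal: "lie_ideal (km_aux_ideal coroot rt)"
  unfolding km_aux_ideal_def lie_ideal_def lie.subspace_def by auto

lemma km_relators_subset_aux: "km_relators coroot rt \<subseteq> km_aux_ideal coroot rt"
  unfolding km_aux_ideal_def by auto

lemma km_ideal_contains:
  assumes "lie_ideal J" "km_aux_ideal coroot rt \<subseteq> J" "\<And>h. gH h \<in> J \<Longrightarrow> gH h \<in> km_aux_ideal coroot rt"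
  shows "J \<subseteq> km_ideal coroot rt"
proof
  fix x assume "x \<in> J"
  then show "x \<in> km_ideal coroot rt"
    unfolding km_ideal_def using assms by (intro lie.span_base UnionI[of J]) auto
qed

lemma lie_ideal_km_ideal: "lie_ideal (km_ideal coroot rt)"
  unfolding km_ideal_def
proof (rule lie_idealI)
  fix g y
  assume "y \<in> lie.span (\<Union>{J. lie_ideal J \<and> km_aux_ideal coroot rt \<subseteq> J \<and>
     J \<inter> range gH \<subseteq> km_aux_ideal coroot rt})"
  then show "lie_bracket (lie_gen g) y \<in> lie.span (\<Union>{J. lie_ideal J \<and> km_aux_ideal coroot rt \<subseteq> J \<and>
     J \<inter> range gH \<subseteq> km_aux_ideal coroot rt})"
  proof (rule bracket_span_closed)
    fix b
    assume "b \<in> \<Union>{J. lie_ideal J \<and> km_aux_ideal coroot rt \<subseteq> J \<and>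
       J \<inter> range gH \<subseteq> km_aux_ideal coroot rt}"
    then obtain J where J: "lie_ideal J" "km_aux_ideal coroot rt \<subseteq> J"
      "J \<inter> range gH \<subseteq> km_aux_ideal coroot rt" "b \<in> J" by blast
    then show "lie_bracket (lie_gen g) b \<in> lie.span (\<Union>{J. lie_ideal J \<and>
       km_aux_ideal coroot rt \<subseteq> J \<and> J \<inter> range gH \<subseteq> km_aux_ideal coroot rt})"
      using lie_ideal_bracket_right[OF J(1,4)] by (intro lie.span_base UnionI[of J]) auto
  qed
qed (rule lie.subspace_span)

lemma km_aux_subset_km_ideal: "km_aux_ideal coroot rt \<subseteq> km_ideal coroot rt"
  by (rule km_ideal_contains) (auto intro: lie_ideal_km_aux_ideal)

lemma realization_weight_inj:
  assumes "realization A coroot rt" "weight rt u = (\<lambda>h. 0)"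
  shows "u = (\<lambda>i. 0)"
proof (rule ccontr)
  assume "u \<noteq> (\<lambda>i. 0)"
  then obtain i where i: "u i \<noteq> 0" by auto
  have inj: "inj rt" and ind: "vec.independent (range rt)"
    using assms(1) by (auto simp: realization_def)
  have "(\<Sum>i\<in>UNIV. u i *s rt i) = 0"
  proof (subst vec_eq_iff, safe)
    fix k
    have "weight rt u (axis k 1) = (\<Sum>i\<in>UNIV. u i * rt i $ k)"
      unfolding weight_def pairing_def by (simp add: axis_def if_distrib cong: if_cong)
    then show "(\<Sum>i\<in>UNIV. u i *s rt i) $ k = 0 $ k" using assms(2) by simp
  qed
  define f where "f = u \<circ> inv_into UNIV rt"
  have f: "f (rt k) = u k" for k using inj by (simp add: f_def)
  have "(\<Sum>v\<in>range rt. f v *s v) = 0"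
    using \<open>(\<Sum>i\<in>UNIV. u i *s rt i) = 0\<close> inj by (simp add: sum.reindex f)
  moreover have "\<exists>v\<in>range rt. f v \<noteq> 0" using f[of i] i by (intro bexI[of _ "rt i"]) auto
  ultimately have "vec.dependent (range rt)"
    by (intro vec.dependent_finite[OF finite_imageI[OF finite], THEN iffD2] exI[of _ f] conjI)
  with ind show False by simp
qed

lemma km_triangular_relations:
  assumes "realization A coroot rt" "gcm A" and J: "lie_ideal J" "km_relators coroot rt \<subseteq> J"
  shows "triangular_relations J gE gF coroot rt A"
proof
  note sub = lie_ideal_subspace[OF J(1)]
  fix h h' :: "complex ^ 'b" and i j :: 'a and g :: "('a, complex ^ 'b) km_gen" and u :: "'a \<Rightarrow> complex"
  have rel: "x \<in> km_relators coroot rt \<Longrightarrow> x \<in> J" for x using J(2) by blast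
  have "gH ((- 1) *s h) - lie_scale (- 1) (gH h) \<in> J"
    by (rule rel) (unfold km_relators_def, rule UnI1, rule UnI1, rule UnI1, rule UnI1, rule UnI1, rule UnI2, blast)
  moreover have "(- 1) *s h = - h" by (simp add: vec_eq_iff)
  ultimately show "congr J (gH (- h)) (- gH h)" by (simp add: congr_def)
  show "lie_bracket (gH h) (gH h') \<in> J"
    by (rule rel) (unfold km_relators_def, rule UnI1, rule UnI1, rule UnI1, rule UnI1, rule UnI2, blast)
  have "lie_bracket (gH h) (gE i) - lie_scale (pairing (rt i) h) (gE i) \<in> J"
    by (rule rel) (unfold km_relators_def, rule UnI1, rule UnI1, rule UnI1, rule UnI2, blast)
  then show "congr J (lie_bracket (gH h) (gE i)) (lie_scale (pairing (rt i) h) (gE i))"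
    by (simp add: congr_def)
  have "lie_bracket (gH h) (gF i) + lie_scale (pairing (rt i) h) (gF i) \<in> J"
    by (rule rel) (unfold km_relators_def, rule UnI1, rule UnI1, rule UnI2, blast)
  then show "congr J (lie_bracket (gH h) (gF i)) (lie_scale (- pairing (rt i) h) (gF i))"
    by (simp add: congr_def)
  have "lie_bracket (gE i) (gF i) - gH (coroot i) \<in> J"
    by (rule rel) (unfold km_relators_def, rule UnI1, rule UnI2, blast)
  moreover have "lie_bracket (gE i) (gF j) \<in> J" if "i \<noteq> j"
    by (rule rel, unfold km_relators_def, rule UnI2) (use that in blast)
  ultimately show "congr J (lie_bracket (gE i) (gF j)) (if i = j then gH (coroot i) else 0)"
    by (auto simp: congr_def)
  show "lie_gen g \<in> range gE \<union> range gF \<union> range gH" by (cases g) auto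
  show "pairing (rt j) (coroot i) = of_int (A $ i $ j)" using assms(1) by (simp add: realization_def)
  show "u = (\<lambda>i. 0)" if "weight rt u = (\<lambda>h. 0)" by (rule realization_weight_inj[OF assms(1) that])
qed (use assms in auto)

lemma simple_refl_eq:
  "simple_refl A i v = v - (\<Sum>j\<in>UNIV. of_int (A $ i $ j) * v $ j) *s simple_root i"
proof (subst vec_eq_iff, rule allI)
  fix k
  have "simple_refl A i v $ k
      = (\<Sum>j\<in>UNIV. v $ j * simple_root j $ k) - (\<Sum>j\<in>UNIV. of_int (A $ i $ j) * v $ j) * simple_root i $ k"
    unfolding simple_refl_def by (simp add: sum_distrib_left sum_distrib_right sum_subtractf algebra_simps)
  also have "(\<Sum>j\<in>UNIV. v $ j * simple_root j $ k) = v $ k"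
    by (simp add: axis_def if_distrib cong: if_cong)
  finally show "simple_refl A i v $ k
    = (v - (\<Sum>j\<in>UNIV. of_int (A $ i $ j) * v $ j) *s simple_root i) $ k" by simp
qed

lemma simple_refl_involution:
  assumes "A $ i $ i = 2"
  shows "simple_refl A i (simple_refl A i v) = v"
proof -
  let ?c = "\<lambda>v. \<Sum>j\<in>UNIV. of_int (A $ i $ j) * v $ j :: rat"
  have "?c (v - c *s simple_root i) = ?c v - 2 * c" for c
  proof -
    have "?c (v - c *s simple_root i)
        = ?c v - (\<Sum>j\<in>UNIV. of_int (A $ i $ j) * (c * simple_root i $ j))"
      by (simp add: right_diff_distrib sum_subtractf)
    also have "(\<Sum>j\<in>UNIV. of_int (A $ i $ j) * (c * simple_root i $ j)) = of_int (A $ i $ i) * c"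
      by (subst sum.remove[of _ i]) (auto simp: axis_def intro!: sum.neutral)
    finally show ?thesis using assms by simp
  qed
  then show ?thesis
    unfolding simple_refl_eq by (simp add: vec_eq_iff del: vector_minus_component)
qed

lemma root_system_iff:
  "v \<in> root_system coroot rt \<longleftrightarrow> v \<noteq> 0 \<and>
     (\<exists>x \<in> weight_vectors (km_ideal coroot rt) (weight rt (\<lambda>i. of_rat (v $ i))). x \<notin> km_ideal coroot rt)"
proof -
  have "km_weight_space coroot rt (\<lambda>h. \<Sum>i\<in>UNIV. of_rat (v $ i) * pairing (rt i) h)
      = weight_vectors (km_ideal coroot rt) (weight rt (\<lambda>i. of_rat (v $ i)))"
    by (simp add: km_weight_space_def weight_vectors_def congr_def weight_def)
  then show ?thesis unfolding root_system_def by auto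
qed

context
  fixes A :: "int ^ 'i ^ 'i" and coroot rt :: "'i \<Rightarrow> complex ^ 'm"
  assumes real: "realization A coroot rt" and gcm: "gcm A"
begin

interpretation aux: triangular_relations "km_aux_ideal coroot rt" gE gF coroot rt A
  by (rule km_triangular_relations[OF real gcm lie_ideal_km_aux_ideal km_relators_subset_aux])

interpretation aux_swap: triangular_relations "km_aux_ideal coroot rt" gF gE
    "\<lambda>i. - coroot i" "\<lambda>i. - rt i" A
  by (rule aux.swapped)

interpretation km: triangular_relations "km_ideal coroot rt" gE gF coroot rt A
  by (rule km_triangular_relations[OF real gcm lie_ideal_km_ideal])
    (use km_relators_subset_aux km_aux_subset_km_ideal in blast)

interpretation km_swap: triangular_relations "km_ideal coroot rt" gF gE
    "\<lambda>i. - coroot i" "\<lambda>i. - rt i" A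
  by (rule km.swapped)

lemma
  shows km_ad_F_locally_nilpotent: "\<exists>N. ad_pow (gF i) N x \<in> km_ideal coroot rt"
    and km_ad_E_locally_nilpotent: "\<exists>N. ad_pow (gE i) N x \<in> km_ideal coroot rt"
proof -
  have "km.serre_element i j \<in> km_ideal coroot rt" if ij: "i \<noteq> j" for j
  proof -
    obtain J where J: "lie_ideal J" "km_aux_ideal coroot rt \<subseteq> J" "aux.serre_element i j \<in> J"
      "\<And>h. gH h \<in> J \<Longrightarrow> gH h \<in> km_aux_ideal coroot rt"
      by (rule aux.serre_ideal[OF ij]) blast
    show ?thesis
      using subsetD[OF km_ideal_contains[OF J(1,2,4)] J(3)]
      unfolding aux.serre_element_def km.serre_element_def .
  qed
  then show "\<exists>N. ad_pow (gF i) N x \<in> km_ideal coroot rt" by (rule km.ad_Y_locally_nilpotent)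
  have "km_swap.serre_element i j \<in> km_ideal coroot rt" if ij: "i \<noteq> j" for j
  proof -
    obtain J where J: "lie_ideal J" "km_aux_ideal coroot rt \<subseteq> J" "aux_swap.serre_element i j \<in> J"
      "\<And>h. gH h \<in> J \<Longrightarrow> gH h \<in> km_aux_ideal coroot rt"
      by (rule aux_swap.serre_ideal[OF ij]) blast
    show ?thesis
      using subsetD[OF km_ideal_contains[OF J(1,2,4)] J(3)]
      unfolding aux_swap.serre_element_def km_swap.serre_element_def .
  qed
  then show "\<exists>N. ad_pow (gE i) N x \<in> km_ideal coroot rt" by (rule km_swap.ad_Y_locally_nilpotent)
qed

text \<open>The coordinates of a root are determined by its weight because the simple roots are
  independent functionals.\<close>

lemma root_coherent:
  assumes "v \<in> root_system coroot rt"
  shows "\<exists>u s. (s = 1 \<or> s = - 1) \<and> (\<forall>i. v $ i = s * of_nat (u i))"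
proof -
  obtain x where x: "x \<in> weight_vectors (km_ideal coroot rt) (weight rt (\<lambda>i. of_rat (v $ i)))"
    "x \<notin> km_ideal coroot rt" using assms root_system_iff by blast
  obtain u and s :: complex where us: "weight rt (\<lambda>i. of_rat (v $ i)) = weight rt (\<lambda>i. s * of_nat (u i))"
    "s = 1 \<or> s = - 1" using km.weights_coherent[OF x] by blast
  have "weight rt (\<lambda>i. of_rat (v $ i) - s * of_nat (u i)) = (\<lambda>h. 0)"
    using fun_cong[OF us(1)] by (auto simp: weight_def left_diff_distrib sum_subtractf)
  then have eq: "of_rat (v $ i) = s * of_nat (u i)" for i
    using km.weight_inj fun_cong by fastforce
  define s' :: rat where "s' = (if s = 1 then 1 else - 1)"
  have "v $ i = s' * of_nat (u i)" for i
  proof -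
    have "of_rat (v $ i) = (of_rat (s' * of_nat (u i)) :: complex)"
      using eq[of i] us(2) by (auto simp: s'_def of_rat_mult of_rat_minus)
    then show ?thesis by (simp only: of_rat_eq_iff)
  qed
  then show ?thesis using s'_def by (intro exI[of _ u] exI[of _ s']) auto
qed

text \<open>With \<open>z\<close> the value of the root at the coroot of \<open>i\<close>, the reflected root is reached by
  \<open>z\<close> applications of \<open>ad f\<^sub>i\<close> if \<open>z \<ge> 0\<close>, and by \<open>- z\<close> applications of
  \<open>ad e\<^sub>i\<close> otherwise.\<close>

theorem root_system_simple_refl:
  assumes v: "v \<in> root_system coroot rt"
  shows "simple_refl A i v \<in> root_system coroot rt"
proof -
  let ?K = "km_ideal coroot rt" and ?\<mu> = "\<lambda>v. weight rt (\<lambda>i. of_rat (v $ i))"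
  obtain u s where us: "s = 1 \<or> s = - 1" "\<And>i. v $ i = s * of_nat (u i)"
    using root_coherent[OF v] by blast
  obtain x where x: "x \<in> weight_vectors ?K (?\<mu> v)" "x \<notin> ?K" using v root_system_iff by blast
  let ?c = "\<Sum>j\<in>UNIV. of_int (A $ i $ j) * v $ j"
  define z :: int where "z = (if s = 1 then 1 else - 1) * (\<Sum>j\<in>UNIV. A $ i $ j * int (u j))"
  have z: "?c = of_int z"
    using us by (auto simp: z_def sum_distrib_left sum_negf)
  have "?\<mu> v (coroot i) = of_rat ?c"
    unfolding weight_def using km.cartan by (simp add: of_rat_sum of_rat_mult mult.commute)
  then have \<mu>z: "?\<mu> v (coroot i) = of_int z" unfolding z by simp
  have \<mu>neg: "?\<mu> v (- h) = - ?\<mu> v h" for h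
    by (simp add: weight_def pairing_def sum_negf)
  have refl: "?\<mu> (simple_refl A i v) = (\<lambda>h. ?\<mu> v h - of_int z * pairing (rt i) h)"
  proof
    fix h
    have eq: "of_rat (simple_refl A i v $ k) = of_rat (v $ k) - of_int z * (if k = i then 1 else 0 :: complex)" for k
      unfolding simple_refl_eq z by (simp add: axis_def of_rat_diff)
    show "?\<mu> (simple_refl A i v) h = ?\<mu> v h - of_int z * pairing (rt i) h"
      unfolding weight_def eq left_diff_distrib sum_subtractf
      by (simp add: if_distrib if_distribR cong: if_cong)
  qed
  have "\<exists>y \<in> weight_vectors ?K (?\<mu> (simple_refl A i v)). y \<notin> ?K"
  proof (cases "z \<ge> 0")
    case True
    let ?n = "nat z"
    have "congr ?K (lie_bracket (gH (coroot i)) x) (lie_scale (of_nat ?n) x)"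
      using x(1) \<mu>z True by (auto simp: weight_vectors_def dest: spec[of _ "coroot i"])
    from km.lowering_power_nonzero[OF this x(2) km_ad_E_locally_nilpotent]
    have "ad_pow (gF i) ?n x \<notin> ?K" .
    moreover have "ad_pow (gF i) ?n x \<in> weight_vectors ?K (?\<mu> (simple_refl A i v))"
      using km.lowering_power_weight[OF x(1), of ?n i] True unfolding refl by simp
    ultimately show ?thesis by blast
  next
    case False
    let ?n = "nat (- z)"
    have "congr ?K (lie_bracket (gH (- coroot i)) x) (lie_scale (of_nat ?n) x)"
      using x(1) \<mu>z \<mu>neg False by (auto simp: weight_vectors_def dest: spec[of _ "- coroot i"])
    from km_swap.lowering_power_nonzero[OF this x(2) km_ad_F_locally_nilpotent]
    have "ad_pow (gE i) ?n x \<notin> ?K" .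
    moreover have "pairing (- rt i) h = - pairing (rt i) h" for h
      by (simp add: pairing_def sum_negf)
    then have "ad_pow (gE i) ?n x \<in> weight_vectors ?K (?\<mu> (simple_refl A i v))"
      using km_swap.lowering_power_weight[OF x(1), of ?n i] False unfolding refl by simp
    ultimately show ?thesis by blast
  qed
  moreover have "simple_refl A i v \<noteq> 0"
  proof
    assume "simple_refl A i v = 0"
    then have "simple_refl A i 0 = v" using simple_refl_involution[OF km.A_diag, of i v] by simp
    moreover have "simple_refl A i 0 = 0" by (simp add: simple_refl_def)
    ultimately show False using v root_system_iff by auto
  qed
  ultimately show ?thesis using root_system_iff by blast
qed

end


section \<open>Isometries, reflections and parabolic subgroups\<close>

definition linear_isometry ::
    "(rat ^ 'i \<Rightarrow> rat ^ 'i \<Rightarrow> rat) \<Rightarrow> (rat ^ 'i \<Rightarrow> rat ^ 'i) \<Rightarrow> bool" where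
  "linear_isometry B f \<longleftrightarrow>
     (\<forall>x y. f (x + y) = f x + f y) \<and> (\<forall>c x. f (c *s x) = c *s f x) \<and>
     (\<forall>x y. B (f x) (f y) = B x y)"

lemma linear_isometryD:
  assumes "linear_isometry B f"
  shows "f (x + y) = f x + f y" "f (c *s x) = c *s f x" "B (f x) (f y) = B x y"
    "f (- x) = - f x" "f (x - y) = f x - f y" "f (\<Sum>i\<in>I. g i) = (\<Sum>i\<in>I. f (g i))"
proof -
  show add: "f (x + y) = f x + f y" for x y using assms by (simp add: linear_isometry_def)
  show scale: "f (c *s x) = c *s f x" for c x using assms by (simp add: linear_isometry_def)
  show "B (f x) (f y) = B x y" using assms by (simp add: linear_isometry_def)
  have "f ((- 1) *s x) = (- 1) *s f x" for x by (rule scale)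
  then show neg: "f (- x) = - f x" for x by (simp add: vector_sneg_minus1[symmetric])
  show "f (x - y) = f x - f y" using add[of x "- y"] neg[of y] by simp
  have zero: "f 0 = 0" using scale[of 0 0] by simp
  show "f (\<Sum>i\<in>I. g i) = (\<Sum>i\<in>I. f (g i))"
    by (induction I rule: infinite_finite_induct) (auto simp: zero add)
qed

lemma linear_isometry_id: "linear_isometry B id"
  by (simp add: linear_isometry_def)

lemma linear_isometry_comp:
  "linear_isometry B f \<Longrightarrow> linear_isometry B g \<Longrightarrow> linear_isometry B (f \<circ> g)"
  by (simp add: linear_isometry_def)

lemma expand_in_simple_roots:
  fixes v :: "rat ^ 'i"
  shows "v = (\<Sum>i\<in>UNIV. v $ i *s simple_root i)"
  by (rule basis_expansion[symmetric])

locale symmetrized_gcm =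
  fixes A :: "int ^ 'i ^ 'i" and eps :: "'i \<Rightarrow> int"
  assumes gcm: "gcm A" and symmetrized: "symmetrized_by A eps"
begin

abbreviation B :: "rat ^ 'i \<Rightarrow> rat ^ 'i \<Rightarrow> rat" where
  "B \<equiv> root_form A eps"

lemma eps_pos: "eps i > 0"
  using symmetrized by (simp add: symmetrized_by_def)

lemma eps_sym: "eps i * A $ i $ j = eps j * A $ j $ i"
  using symmetrized by (simp add: symmetrized_by_def)

lemma diag: "A $ i $ i = 2"
  using gcm by (simp add: gcm_def)

lemma off_diag: "i \<noteq> j \<Longrightarrow> A $ i $ j \<le> 0"
  using gcm by (simp add: gcm_def)

lemma zero_sym: "A $ i $ j = 0 \<longleftrightarrow> A $ j $ i = 0"
  using gcm by (simp add: gcm_def)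

lemma B_sym: "B x y = B y x"
proof -
  have "B x y = (\<Sum>j\<in>UNIV. \<Sum>i\<in>UNIV. x $ i * y $ j * of_int (eps i * A $ i $ j))"
    unfolding root_form_def by (rule sum.swap)
  also have "\<dots> = B y x"
    unfolding root_form_def by (rule sum.cong[OF HOL.refl], rule sum.cong[OF HOL.refl], subst eps_sym) simp
  finally show ?thesis .
qed

lemma B_add_left: "B (x + y) z = B x z + B y z"
  unfolding root_form_def by (simp add: sum.distrib distrib_right)

lemma B_scale_left: "B (c *s x) z = c * B x z"
  unfolding root_form_def by (simp add: sum_distrib_left mult_ac)

lemma B_add_right: "B z (x + y) = B z x + B z y"
  using B_add_left B_sym by metis

lemma B_scale_right: "B z (c *s x) = c * B z x"
  using B_scale_left B_sym by metis

lemma B_minus_left: "B (- x) z = - B x z"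
  unfolding root_form_def by (simp add: sum_negf)

lemma B_minus_right: "B z (- x) = - B z x"
  unfolding root_form_def by (simp add: sum_negf)

lemma B_diff_left: "B (x - y) z = B x z - B y z"
  using B_add_left[of x "- y" z] by (simp add: B_minus_left)

lemma B_diff_right: "B z (x - y) = B z x - B z y"
  using B_add_right[of z x "- y"] by (simp add: B_minus_right)

lemmas B_bilinear = B_add_left B_add_right B_scale_left B_scale_right B_minus_left B_minus_right
  B_diff_left B_diff_right

lemma B_sum_right: "B z (\<Sum>i\<in>I. f i) = (\<Sum>i\<in>I. B z (f i))"
proof -
  have "B z 0 = 0" by (simp add: root_form_def)
  then show ?thesis by (induction I rule: infinite_finite_induct) (auto simp: B_add_right)
qed

lemma B_simple_left: "B (simple_root i) v = of_int (eps i) * (\<Sum>j\<in>UNIV. of_int (A $ i $ j) * v $ j)"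
proof -
  have "B (simple_root i) v
      = (\<Sum>k\<in>UNIV. if k = i then (\<Sum>j\<in>UNIV. v $ j * of_int (eps i * A $ i $ j)) else 0)"
    unfolding root_form_def by (intro sum.cong HOL.refl) (auto simp: axis_def)
  also have "\<dots> = of_int (eps i) * (\<Sum>j\<in>UNIV. of_int (A $ i $ j) * v $ j)"
    by (simp add: sum_distrib_left mult_ac)
  finally show ?thesis .
qed

lemma B_simple: "B (simple_root i) (simple_root j) = of_int (eps i * A $ i $ j)"
proof -
  have "(\<Sum>k\<in>UNIV. of_int (A $ i $ k) * simple_root j $ k) = (of_int (A $ i $ j) :: rat)"
    by (simp add: axis_def if_distrib cong: if_cong)
  then show ?thesis by (simp add: B_simple_left)
qed

lemma B_simple_pos: "B (simple_root i) (simple_root i) > 0"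
  using eps_pos[of i] by (simp add: B_simple diag)

lemma B_simple_nonpos: "i \<noteq> j \<Longrightarrow> B (simple_root i) (simple_root j) \<le> 0"
  using eps_pos[of i] off_diag[of i j] unfolding B_simple by (simp add: mult_nonneg_nonpos)

lemma reflection_isometry:
  assumes "B a a \<noteq> 0"
  shows "linear_isometry B (reflection B a)"
  unfolding linear_isometry_def reflection_def
proof (intro conjI allI)
  fix x y c
  show "x + y - (2 * (B a (x + y) / B a a)) *s a
      = x - (2 * (B a x / B a a)) *s a + (y - (2 * (B a y / B a a)) *s a)"
    by (simp add: vec_eq_iff B_bilinear add_divide_distrib algebra_simps)
  show "c *s x - (2 * (B a (c *s x) / B a a)) *s a = c *s (x - (2 * (B a x / B a a)) *s a)"
    by (simp add: vec_eq_iff B_bilinear algebra_simps)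
  show "B (x - (2 * (B a x / B a a)) *s a) (y - (2 * (B a y / B a a)) *s a) = B x y"
    using assms B_sym[of x a] by (simp add: B_bilinear field_simps)
qed

lemma reflection_involution:
  assumes "B a a \<noteq> 0"
  shows "reflection B a (reflection B a v) = v"
  unfolding reflection_def using assms
  by (simp add: vec_eq_iff B_bilinear diff_divide_distrib algebra_simps)

lemma reflection_image:
  assumes "linear_isometry B f"
  shows "f (reflection B a v) = reflection B (f a) (f v)"
  unfolding reflection_def by (simp add: linear_isometryD[OF assms])

lemma reflection_scale: "c \<noteq> 0 \<Longrightarrow> reflection B (c *s a) = reflection B a"
  by (rule ext) (simp add: reflection_def B_bilinear vec_eq_iff)

lemma simple_refl_reflection: "simple_refl A i = reflection B (simple_root i)"
  using eps_pos[of i]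
  by (intro ext) (simp add: simple_refl_eq reflection_def B_simple_left diag
      B_simple[unfolded B_simple_left])

lemma simple_refl_isometry: "linear_isometry B (simple_refl A i)"
  unfolding simple_refl_reflection using B_simple_pos[of i] by (intro reflection_isometry) simp

lemma simple_refl_bij: "simple_refl A i \<in> Bij UNIV"
proof -
  have "bij (simple_refl A i)"
    by (rule o_bij[of "simple_refl A i"]) (auto simp: simple_refl_involution diag)
  then show ?thesis by (simp add: Bij_def)
qed

lemma weyl_id: "id \<in> weyl A X"
  using generate.one[of "BijGroup UNIV" "simple_refl A ` X"]
  by (simp add: weyl_def BijGroup_def id_def restrict_def)

lemma weyl_simple: "i \<in> X \<Longrightarrow> simple_refl A i \<in> weyl A X"
  unfolding weyl_def by (rule generate.incl) simp

lemma generate_Bij: "g \<in> generate (BijGroup UNIV) (simple_refl A ` X) \<Longrightarrow> g \<in> Bij UNIV"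
  using group.generate_in_carrier[OF group_BijGroup, of "simple_refl A ` X" UNIV g] simple_refl_bij
  by (auto simp: BijGroup_def)

lemma weyl_comp: "f \<in> weyl A X \<Longrightarrow> g \<in> weyl A X \<Longrightarrow> f \<circ> g \<in> weyl A X"
  using generate.eng[of f "BijGroup UNIV" "simple_refl A ` X" g] generate_Bij[of f X] generate_Bij[of g X]
  by (simp add: weyl_def BijGroup_def compose_def comp_def restrict_def)

text \<open>The group is generated by involutions, so inverses need no separate case.\<close>

lemma weyl_induct [consumes 1, case_names id simple comp]:
  assumes "w \<in> weyl A X" and id: "P id" and simple: "\<And>i. i \<in> X \<Longrightarrow> P (simple_refl A i)"
    and comp: "\<And>f g. f \<in> weyl A X \<Longrightarrow> g \<in> weyl A X \<Longrightarrow> P f \<Longrightarrow> P g \<Longrightarrow> P (f \<circ> g)"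
  shows "P w"
  using assms(1) unfolding weyl_def
proof (induction rule: generate.induct)
  case one
  then show ?case using id by (simp add: BijGroup_def id_def restrict_def)
next
  case (incl h)
  then show ?case using simple by blast
next
  case (inv h)
  then obtain i where i: "i \<in> X" "h = simple_refl A i" by blast
  have "inv_into UNIV (simple_refl A i) = simple_refl A i"
    by (rule inv_equality) (simp_all add: simple_refl_involution diag)
  then show ?case using simple i simple_refl_bij[of i] by (simp add: inv_BijGroup restrict_def)
next
  case (eng f g)
  then show ?case
    using comp[of f g] generate_Bij[of f X] generate_Bij[of g X]
    by (simp add: weyl_def BijGroup_def compose_def comp_def restrict_def)
qed

lemma weyl_isometry:
  assumes "w \<in> weyl A X"
  shows "linear_isometry B w"
  using assms
proof (induction rule: weyl_induct)
  case (comp f g)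
  then show ?case by (intro linear_isometry_comp)
qed (rule linear_isometry_id, rule simple_refl_isometry)

lemma weyl_inverse:
  assumes "w \<in> weyl A X"
  shows "\<exists>w' \<in> weyl A X. w \<circ> w' = id \<and> w' \<circ> w = id"
  using assms
proof (induction rule: weyl_induct)
  case id
  show ?case by (rule bexI[OF _ weyl_id]) simp
next
  case (simple i)
  then show ?case
    using weyl_simple by (intro bexI[of _ "simple_refl A i"]) (auto simp: simple_refl_involution diag)
next
  case (comp f g)
  then obtain f' g' where "f' \<in> weyl A X" "g' \<in> weyl A X" "f \<circ> f' = id" "f' \<circ> f = id"
    "g \<circ> g' = id" "g' \<circ> g = id" by blast
  then show ?case
    by (intro bexI[of _ "g' \<circ> f'"]) (auto intro: weyl_comp simp: fun_eq_iff)
qed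

lemma weyl_coord:
  assumes "w \<in> weyl A X" "k \<notin> X"
  shows "w v $ k = v $ k"
  using assms(1)
proof (induction arbitrary: v rule: weyl_induct)
  case (simple i)
  with assms(2) have "k \<noteq> i" by auto
  then show ?case by (simp add: simple_refl_eq axis_def)
qed auto

lemma weyl_integral:
  assumes "w \<in> weyl A X" "\<And>k. v $ k \<in> \<int>"
  shows "w v $ k \<in> \<int>"
  using assms
proof (induction arbitrary: v k rule: weyl_induct)
  case (simple i)
  then show ?case
    by (auto simp: simple_refl_eq axis_def intro!: Ints_diff Ints_mult Ints_sum)
qed auto

lemma weyl_stable:
  assumes "w \<in> weyl A X" "\<And>i v. v \<in> S \<Longrightarrow> simple_refl A i v \<in> S" "v \<in> S"
  shows "w v \<in> S"
  using assms(1,3)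
  by (induction arbitrary: v rule: weyl_induct) (auto intro: assms(2))

end

section \<open>Positivity in finite type\<close>

definition parabolic_span :: "'i set \<Rightarrow> (rat ^ 'i) set" where
  "parabolic_span X = {v. \<forall>k. k \<notin> X \<longrightarrow> v $ k = 0}"

lemma parabolic_span_expand:
  assumes "v \<in> parabolic_span X"
  shows "v = (\<Sum>k\<in>X. v $ k *s simple_root k)"
proof -
  have "(\<Sum>k\<in>UNIV. v $ k *s simple_root k) = (\<Sum>k\<in>X. v $ k *s simple_root k)"
    using assms by (intro sum.mono_neutral_right) (auto simp: parabolic_span_def)
  then show ?thesis using expand_in_simple_roots[of v] by simp
qed

locale finite_parabolic = symmetrized_gcm A eps
  for A :: "int ^ 'i ^ 'i" and eps :: "'i \<Rightarrow> int" +
  fixes X :: "'i set"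
  assumes finite_weyl: "finite (weyl A X)"
begin

text \<open>Averaging over the finite group makes the standard inner product invariant under \<open>W\<^sub>X\<close>.\<close>

definition averaged_form :: "rat ^ 'i \<Rightarrow> rat ^ 'i \<Rightarrow> rat" where
  "averaged_form x y = (\<Sum>g\<in>weyl A X. \<Sum>k\<in>UNIV. g x $ k * g y $ k)"

lemma averaged_add_right: "averaged_form x (y + z) = averaged_form x y + averaged_form x z"
proof -
  have "(\<Sum>k\<in>UNIV. g x $ k * g (y + z) $ k)
     = (\<Sum>k\<in>UNIV. g x $ k * g y $ k) + (\<Sum>k\<in>UNIV. g x $ k * g z $ k)" if "g \<in> weyl A X" for g
    using linear_isometryD(1)[OF weyl_isometry[OF that]] by (simp add: distrib_left sum.distrib)
  then show ?thesis unfolding averaged_form_def by (simp add: sum.distrib)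
qed

lemma averaged_scale_right: "averaged_form x (c *s y) = c * averaged_form x y"
proof -
  have "(\<Sum>k\<in>UNIV. g x $ k * g (c *s y) $ k)
     = c * (\<Sum>k\<in>UNIV. g x $ k * g y $ k)" if "g \<in> weyl A X" for g
    using linear_isometryD(2)[OF weyl_isometry[OF that]] by (simp add: sum_distrib_left mult_ac)
  then show ?thesis unfolding averaged_form_def by (simp add: sum_distrib_left)
qed

lemma averaged_sym: "averaged_form x y = averaged_form y x"
  by (simp add: averaged_form_def mult.commute)

lemma averaged_diff_right: "averaged_form x (y - z) = averaged_form x y - averaged_form x z"
proof -
  have "y = (y - z) + z" by simp
  then show ?thesis using averaged_add_right[of x "y - z" z] by simp
qed

lemma averaged_diff_left: "averaged_form (y - z) x = averaged_form y x - averaged_form z x"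
  using averaged_diff_right averaged_sym by metis

lemma averaged_sum_right: "averaged_form x (\<Sum>i\<in>I. f i) = (\<Sum>i\<in>I. averaged_form x (f i))"
proof -
  have "averaged_form x 0 = 0" using averaged_scale_right[of x 0 0] by simp
  then show ?thesis by (induction I rule: infinite_finite_induct) (auto simp: averaged_add_right)
qed

lemma averaged_nonneg: "averaged_form x x \<ge> 0"
  unfolding averaged_form_def by (intro sum_nonneg) simp

lemma averaged_definite:
  assumes "averaged_form x x \<le> 0"
  shows "x = 0"
proof -
  have nonneg: "(\<Sum>k\<in>UNIV. g x $ k * g x $ k) \<ge> 0" for g :: "rat ^ 'i \<Rightarrow> rat ^ 'i"
    by (intro sum_nonneg) simp
  have "(\<Sum>k\<in>UNIV. id x $ k * id x $ k) \<le> averaged_form x x"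
    unfolding averaged_form_def using finite_weyl weyl_id nonneg
    by (intro member_le_sum[of id "weyl A X" "\<lambda>g. \<Sum>k\<in>UNIV. g x $ k * g x $ k"]) auto
  then have "(\<Sum>k\<in>UNIV. x $ k * x $ k) = 0" using assms nonneg[of id] by simp
  then show ?thesis by (simp add: sum_nonneg_eq_0_iff vec_eq_iff)
qed

lemma averaged_invariant:
  assumes "i \<in> X"
  shows "averaged_form (simple_refl A i x) (simple_refl A i y) = averaged_form x y"
proof -
  let ?s = "simple_refl A i"
  have inv: "?s \<circ> ?s = id" by (rule ext) (simp add: simple_refl_involution diag)
  have "bij_betw (\<lambda>g. g \<circ> ?s) (weyl A X) (weyl A X)"
    by (rule bij_betw_byWitness[of _ "\<lambda>g. g \<circ> ?s"])
      (auto simp: comp_assoc inv intro: weyl_comp weyl_simple assms)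
  from sum.reindex_bij_betw[OF this, of "\<lambda>g. \<Sum>k\<in>UNIV. g x $ k * g y $ k"]
  show ?thesis by (simp add: averaged_form_def)
qed

text \<open>A reflection that preserves an inner product is the orthogonal reflection for it. So for
  \<open>i \<in> X\<close> the averaged form gives the same pairing with the coroot of \<open>i\<close> as \<open>B\<close> does.\<close>

lemma averaged_simple:
  assumes "i \<in> X"
  shows "averaged_form x (simple_root i)
    = B (simple_root i) x / B (simple_root i) (simple_root i) * averaged_form (simple_root i) (simple_root i)"
proof -
  let ?a = "simple_root i :: rat ^ 'i" and ?s = "simple_refl A i"
  let ?c = "2 * (B ?a x / B ?a ?a)"
  have a: "?s ?a = - ?a"
    using B_simple_pos[of i] by (simp add: simple_refl_reflection reflection_def vec_eq_iff)
  have x: "?s x = x - ?c *s ?a" by (simp add: simple_refl_reflection reflection_def)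
  have "averaged_form (?s x) ?a = averaged_form x (?s ?a)"
    using averaged_invariant[OF assms, of "?s x" ?a] averaged_invariant[OF assms, of x "?s ?a"]
    by (simp add: simple_refl_involution diag)
  also have "\<dots> = - averaged_form x ?a"
    unfolding a using averaged_scale_right[of x "- 1" ?a] by (simp add: vector_sneg_minus1[symmetric])
  finally have "averaged_form x ?a - ?c * averaged_form ?a ?a = - averaged_form x ?a"
    unfolding x averaged_diff_left
    using averaged_scale_right[of ?a ?c ?a] averaged_sym by metis
  then show ?thesis by (simp add: field_simps)
qed

lemma averaged_simple_pos: "averaged_form (simple_root i) (simple_root i) > 0"
proof -
  have "simple_root i \<noteq> (0 :: rat ^ 'i)" by (simp add: axis_eq_0_iff)
  then show ?thesis using averaged_definite[of "simple_root i"] by (meson not_le)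
qed

lemma averaged_expand:
  assumes "v \<in> parabolic_span X"
  shows "averaged_form x v = (\<Sum>k\<in>X. v $ k * averaged_form x (simple_root k))"
  using arg_cong[OF parabolic_span_expand[OF assms], of "averaged_form x"]
  by (simp add: averaged_sum_right averaged_scale_right)

lemma orthogonal_in_parabolic_span:
  assumes "x \<in> parabolic_span X" "\<And>k. k \<in> X \<Longrightarrow> B (simple_root k) x = 0"
  shows "x = 0"
proof (rule averaged_definite)
  show "averaged_form x x \<le> 0"
    using assms(2) averaged_simple[of _ x] by (simp add: averaged_expand[OF assms(1)])
qed

text \<open>Split off the negative part \<open>n\<close> of \<open>x\<close>. Dominance gives \<open>(x, n) \<ge> 0\<close>, and \<open>(x + n, n) \<le> 0\<close>
  because \<open>x + n\<close> and \<open>n\<close> have disjoint supports and distinct simple roots have nonpositive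
  products. Hence \<open>(n, n) \<le> 0\<close> in the averaged form.\<close>

lemma dominant_nonneg:
  assumes x: "x \<in> parabolic_span X" and dom: "\<And>k. k \<in> X \<Longrightarrow> B (simple_root k) x \<ge> 0"
  shows "x $ k \<ge> 0"
proof -
  define n :: "rat ^ 'i" where "n = (\<chi> k. max 0 (- x $ k))"
  have n: "n \<in> parabolic_span X" using x by (auto simp: parabolic_span_def n_def)
  have n0: "n $ k \<ge> 0" for k by (simp add: n_def)
  have p: "x + n \<in> parabolic_span X" using x n by (auto simp: parabolic_span_def)
  have "averaged_form x n = (\<Sum>k\<in>X. n $ k * averaged_form x (simple_root k))"
    by (rule averaged_expand[OF n])
  also have "\<dots> \<ge> 0"
  proof (intro sum_nonneg mult_nonneg_nonneg n0)
    fix k assume k: "k \<in> X"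
    have "B (simple_root k) x / B (simple_root k) (simple_root k) \<ge> 0"
      using dom[OF k] B_simple_pos[of k] by simp
    then show "averaged_form x (simple_root k) \<ge> 0"
      unfolding averaged_simple[OF k, of x] using averaged_simple_pos[of k]
      by (intro mult_nonneg_nonneg) simp_all
  qed
  finally have xn: "averaged_form x n \<ge> 0" .
  have "averaged_form (x + n) n = (\<Sum>l\<in>X. n $ l * averaged_form (x + n) (simple_root l))"
    by (rule averaged_expand[OF n])
  also have "\<dots> = (\<Sum>l\<in>X. n $ l * (\<Sum>k\<in>X. (x + n) $ k * averaged_form (simple_root l) (simple_root k)))"
  proof (intro sum.cong HOL.refl arg_cong2[of _ _ _ _ "(*)"])
    fix l
    have "averaged_form (simple_root l) (x + n)
        = (\<Sum>k\<in>X. (x + n) $ k * averaged_form (simple_root l) (simple_root k))"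
      by (rule averaged_expand[OF p])
    then show "averaged_form (x + n) (simple_root l)
        = (\<Sum>k\<in>X. (x + n) $ k * averaged_form (simple_root l) (simple_root k))"
      using averaged_sym by metis
  qed
  also have "\<dots> \<le> 0"
    unfolding sum_distrib_left
  proof (intro sum_nonpos)
    fix l k assume lk: "l \<in> X" "k \<in> X"
    show "n $ l * ((x + n) $ k * averaged_form (simple_root l) (simple_root k)) \<le> 0"
    proof (cases "l = k")
      case True
      have "n $ k * (x + n) $ k = 0" by (simp add: n_def max_def)
      then show ?thesis using True by (metis mult.assoc mult_zero_left order_refl)
    next
      case False
      have "averaged_form (simple_root l) (simple_root k) \<le> 0"
        unfolding averaged_simple[OF lk(2), of "simple_root l"]
        using B_simple_nonpos[of k l] False B_simple_pos[of k] averaged_simple_pos[of k]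
        by (intro mult_nonpos_nonneg divide_nonpos_pos) auto
      moreover have "(x + n) $ k \<ge> 0" by (simp add: n_def max_def)
      ultimately show ?thesis using n0[of l] by (intro mult_nonneg_nonpos) auto
    qed
  qed
  finally have "averaged_form n (x + n) \<le> 0" by (simp add: averaged_sym)
  then have "averaged_form n n \<le> 0" using xn by (simp add: averaged_add_right averaged_sym[of n x])
  then have "n = 0" by (rule averaged_definite)
  then have "n $ k = 0" by simp
  then show ?thesis by (simp add: n_def max_def split: if_splits)
qed

end


section \<open>The involution attached to a compatible decoration\<close>

text \<open>By indecomposability the ratio of \<open>eps \<circ> \<tau>\<close> to \<open>eps\<close> is constant, and it is \<open>1\<close> because
  \<open>\<tau>\<close> is an involution.\<close>

lemma symmetrizer_diagram_aut:
  assumes "indecomposable A" "symmetrized_by A eps" "\<tau> \<in> diagram_aut A" "\<tau> \<circ> \<tau> = id"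
  shows "eps (\<tau> i) = eps i"
proof -
  have pos: "eps k > 0" for k using assms(2) by (simp add: symmetrized_by_def)
  have sym: "eps k * A $ k $ l = eps l * A $ l $ k" for k l using assms(2) by (simp add: symmetrized_by_def)
  have aut: "A $ \<tau> k $ \<tau> l = A $ k $ l" for k l using assms(3) by (simp add: diagram_aut_def)
  let ?J = "{j. eps (\<tau> j) * eps i = eps j * eps (\<tau> i)}"
  have "?J = UNIV"
  proof (rule ccontr)
    assume "?J \<noteq> UNIV"
    moreover have "?J \<noteq> {}" by (auto intro: exI[of _ i])
    ultimately obtain k l where kl: "k \<in> ?J" "l \<notin> ?J" "A $ k $ l \<noteq> 0"
      using spec[OF assms(1)[unfolded indecomposable_def], of ?J] by blast
    have "eps (\<tau> k) * A $ k $ l = eps (\<tau> l) * A $ l $ k" using sym[of "\<tau> k" "\<tau> l"] aut by simp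
    then have "(eps (\<tau> l) * eps i) * (A $ l $ k * eps k) = (eps (\<tau> k) * eps i) * (A $ k $ l * eps k)"
      by algebra
    also have "\<dots> = (eps k * eps (\<tau> i)) * (A $ k $ l * eps k)" using kl(1) by simp
    also have "\<dots> = (eps l * eps (\<tau> i)) * (A $ l $ k * eps k)"
      using sym[of k l] by algebra
    finally have "(eps (\<tau> l) * eps i) * (A $ l $ k * eps k) = (eps l * eps (\<tau> i)) * (A $ l $ k * eps k)" .
    moreover have "A $ l $ k * eps k \<noteq> 0" using sym[of k l] kl(3) pos[of k] pos[of l] by auto
    ultimately show False using kl(2) by simp
  qed
  then have "\<tau> i \<in> ?J" by blast
  then have "eps i * eps i = eps (\<tau> i) * eps (\<tau> i)" using fun_cong[OF assms(4), of i] by simp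
  then have "(eps (\<tau> i))\<^sup>2 = (eps i)\<^sup>2" by (simp add: power2_eq_square)
  then show ?thesis using pos[of i] pos[of "\<tau> i"] by (simp add: power2_eq_iff_nonneg)
qed

locale decorated = finite_parabolic A eps X
  for A :: "int ^ 'i ^ 'i" and eps :: "'i \<Rightarrow> int" and X :: "'i set" +
  fixes \<tau> :: "'i \<Rightarrow> 'i"
  assumes indecomposable: "indecomposable A"
    and decoration: "compatible_decoration A X \<tau>"
begin

definition \<sigma> :: "rat ^ 'i \<Rightarrow> rat ^ 'i" where
  "\<sigma> = longest_elt A X \<circ> diagram_act \<tau>"

lemma \<tau>_\<tau> [simp]: "\<tau> (\<tau> i) = i"
  using decoration unfolding compatible_decoration_def by (metis comp_apply id_apply)

lemma \<tau>_X: "\<tau> i \<in> X \<longleftrightarrow> i \<in> X"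
  using decoration unfolding compatible_decoration_def by (metis image_subset_iff \<tau>_\<tau>)

lemma \<tau>_bij: "bij \<tau>"
  by (rule o_bij[of \<tau>]) auto

lemma \<tau>_A: "A $ \<tau> i $ \<tau> j = A $ i $ j"
  using decoration by (simp add: compatible_decoration_def diagram_aut_def)

lemma \<tau>_eps: "eps (\<tau> i) = eps i"
proof -
  have "\<tau> \<in> diagram_aut A" "\<tau> \<circ> \<tau> = id" using decoration by (auto simp: compatible_decoration_def)
  then show ?thesis by (rule symmetrizer_diagram_aut[OF indecomposable symmetrized])
qed

lemma longest_elt_weyl: "longest_elt A X \<in> weyl A X"
proof -
  let ?l = "weyl_length A X" and ?W = "weyl A X"
  have "finite (?l ` ?W)" "?l ` ?W \<noteq> {}" using finite_weyl weyl_id by auto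
  then have "Max (?l ` ?W) \<in> ?l ` ?W" by (rule Max_in)
  then obtain w where w: "w \<in> ?W" "?l w = Max (?l ` ?W)" by force
  have "is_arg_max ?l (\<lambda>x. x \<in> ?W) w"
    unfolding is_arg_max_def using w finite_weyl by (auto simp: not_less)
  then have "is_arg_max ?l (\<lambda>x. x \<in> ?W) (longest_elt A X)"
    unfolding longest_elt_def arg_max_on_def arg_max_def
    by (rule someI[of "is_arg_max ?l (\<lambda>x. x \<in> ?W)"])
  then show ?thesis by (simp add: is_arg_max_def)
qed

lemma longest_elt_simple: "i \<in> X \<Longrightarrow> longest_elt A X (simple_root i) = - simple_root (\<tau> i)"
  using decoration by (simp add: compatible_decoration_def)

lemma diagram_act_coord: "diagram_act \<tau> v $ k = v $ \<tau> k"
proof -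
  have "diagram_act \<tau> v $ k = (\<Sum>i\<in>UNIV. if i = \<tau> k then v $ i else 0)"
    unfolding diagram_act_def sum_component
    by (intro sum.cong HOL.refl) (auto simp: axis_def)
  then show ?thesis by simp
qed

lemma diagram_act_simple: "diagram_act \<tau> (simple_root i) = simple_root (\<tau> i)"
  unfolding vec_eq_iff diagram_act_coord by (auto simp: axis_def)

lemma diagram_act_isometry: "linear_isometry B (diagram_act \<tau>)"
  unfolding linear_isometry_def
proof (intro conjI allI)
  fix x y :: "rat ^ 'i"
  have re: "(\<Sum>i\<in>UNIV. f (\<tau> i)) = (\<Sum>i\<in>UNIV. f i)" for f :: "'i \<Rightarrow> rat"
    using sum.reindex_bij_betw[OF \<tau>_bij, of f] .
  have "B (diagram_act \<tau> x) (diagram_act \<tau> y)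
      = (\<Sum>i\<in>UNIV. \<Sum>j\<in>UNIV. x $ \<tau> i * y $ \<tau> j * of_int (eps (\<tau> i) * A $ \<tau> i $ \<tau> j))"
    by (simp add: root_form_def diagram_act_coord \<tau>_A \<tau>_eps)
  also have "\<dots> = (\<Sum>i\<in>UNIV. \<Sum>j\<in>UNIV. x $ \<tau> i * y $ j * of_int (eps (\<tau> i) * A $ \<tau> i $ j))"
    by (intro sum.cong HOL.refl re[of "\<lambda>j. x $ \<tau> i * y $ j * of_int (eps (\<tau> i) * A $ \<tau> i $ j)" for i])
  also have "\<dots> = B x y"
    unfolding root_form_def
    by (rule re[of "\<lambda>i. \<Sum>j\<in>UNIV. x $ i * y $ j * of_int (eps i * A $ i $ j)"])
  finally show "B (diagram_act \<tau> x) (diagram_act \<tau> y) = B x y" .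
qed (simp_all add: vec_eq_iff diagram_act_coord)

lemma \<sigma>_isometry: "linear_isometry B \<sigma>"
  unfolding \<sigma>_def by (intro linear_isometry_comp weyl_isometry[OF longest_elt_weyl] diagram_act_isometry)

lemmas \<sigma>_simps = linear_isometryD[OF \<sigma>_isometry]

lemma \<sigma>_coord: "k \<notin> X \<Longrightarrow> \<sigma> v $ k = v $ \<tau> k"
  using weyl_coord[OF longest_elt_weyl] by (simp add: \<sigma>_def diagram_act_coord)

lemma \<sigma>_simple_X: "k \<in> X \<Longrightarrow> \<sigma> (simple_root k) = - simple_root k"
  using longest_elt_simple[of "\<tau> k"] by (simp add: \<sigma>_def diagram_act_simple \<tau>_X)

lemma \<sigma>_parabolic_span:
  assumes "v \<in> parabolic_span X"
  shows "\<sigma> v = - v"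
proof -
  have "\<sigma> v = (\<Sum>k\<in>X. v $ k *s \<sigma> (simple_root k))"
    using arg_cong[OF parabolic_span_expand[OF assms], of \<sigma>] by (simp add: \<sigma>_simps)
  also have "\<dots> = - (\<Sum>k\<in>X. v $ k *s simple_root k)"
    by (simp add: \<sigma>_simple_X sum_negf)
  finally show ?thesis using parabolic_span_expand[OF assms] by simp
qed

text \<open>The defect \<open>\<sigma>\<^sup>2 - 1\<close> takes values in the span of \<open>X\<close>, and these values are orthogonal to
  \<open>X\<close> because \<open>\<sigma>\<^sup>2\<close> is an isometry that fixes \<open>X\<close>; the form is nondegenerate there.\<close>

lemma \<sigma>_\<sigma> [simp]: "\<sigma> (\<sigma> v) = v"
proof -
  have "\<sigma> (\<sigma> v) - v = 0"
  proof (rule orthogonal_in_parabolic_span)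
    show "\<sigma> (\<sigma> v) - v \<in> parabolic_span X" by (simp add: parabolic_span_def \<sigma>_coord \<tau>_X)
    fix k assume k: "k \<in> X"
    have "\<sigma> (\<sigma> (simple_root k)) = simple_root k" using k by (simp add: \<sigma>_simple_X \<sigma>_simps)
    then have "B (simple_root k) (\<sigma> (\<sigma> v)) = B (simple_root k) v"
      using \<sigma>_simps(3)[of "\<sigma> (simple_root k)" "\<sigma> v"] \<sigma>_simps(3)[of "simple_root k" v] by simp
    then show "B (simple_root k) (\<sigma> (\<sigma> v) - v) = 0" by (simp add: B_bilinear)
  qed
  then show ?thesis by simp
qed

abbreviation avg :: "rat ^ 'i \<Rightarrow> rat ^ 'i" where
  "avg \<equiv> average \<sigma>"

abbreviation restricted_simple :: "'i \<Rightarrow> rat ^ 'i" where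
  "restricted_simple i \<equiv> avg (simple_root i)"

lemma avg_linear:
  shows avg_add: "avg (x + y) = avg x + avg y" and avg_scale: "avg (c *s x) = c *s avg x"
    and avg_diff: "avg (x - y) = avg x - avg y"
  by (simp_all add: average_def \<sigma>_simps vec_eq_iff algebra_simps add_divide_distrib diff_divide_distrib)

lemma avg_sum: "avg (\<Sum>i\<in>I. f i) = (\<Sum>i\<in>I. avg (f i))"
proof -
  have "avg 0 = 0" using avg_scale[of 0 0] by simp
  then show ?thesis by (induction I rule: infinite_finite_induct) (auto simp: avg_add)
qed

lemma \<sigma>_avg [simp]: "\<sigma> (avg v) = avg v"
  by (simp add: average_def \<sigma>_simps add.commute)

lemma avg_\<sigma> [simp]: "avg (\<sigma> v) = avg v"
  by (simp add: average_def add.commute)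

lemma avg_fixed: "\<sigma> v = v \<Longrightarrow> avg v = v"
  by (simp add: average_def vec_eq_iff)

lemma avg_parabolic_span: "v \<in> parabolic_span X \<Longrightarrow> avg v = 0"
  by (simp add: average_def \<sigma>_parabolic_span)

lemma B_avg:
  assumes "\<sigma> u = u"
  shows "B u (avg v) = B u v"
proof -
  have "B u (\<sigma> v) = B u v" using \<sigma>_simps(3)[of u v] assms by simp
  then show ?thesis by (simp add: average_def B_bilinear)
qed

lemma simple_root_span: "k \<in> X \<Longrightarrow> simple_root k \<in> parabolic_span X"
  by (auto simp: parabolic_span_def axis_def)

text \<open>For \<open>i \<notin> X\<close> this is the part of \<open>\<sigma>(\<alpha>\<^sub>i)\<close> supported on \<open>X\<close>.\<close>

definition tail :: "'i \<Rightarrow> rat ^ 'i" where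
  "tail i = \<sigma> (simple_root i) - simple_root (\<tau> i)"

lemma tail_span:
  assumes "i \<notin> X"
  shows "tail i \<in> parabolic_span X"
proof -
  have "simple_root i $ \<tau> k = (simple_root (\<tau> i) $ k :: rat)" for k
    by (auto simp: axis_def)
  then show ?thesis using \<sigma>_coord by (simp add: tail_def parabolic_span_def)
qed

lemma B_tail:
  assumes "k \<in> X"
  shows "B (simple_root k) (tail i) = - B (simple_root k) (simple_root i) - B (simple_root k) (simple_root (\<tau> i))"
  using \<sigma>_simps(3)[of "simple_root k" "\<sigma> (simple_root i)"] \<sigma>_simple_X[OF assms]
  by (simp add: tail_def B_bilinear)

text \<open>The tail is dominant for \<open>X\<close>, since \<open>\<sigma>\<close> is \<open>- 1\<close> on the simple roots in \<open>X\<close>.\<close>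

lemma tail_nonneg:
  assumes "i \<notin> X"
  shows "tail i $ k \<ge> 0"
proof (rule dominant_nonneg[OF tail_span[OF assms]])
  fix k assume k: "k \<in> X"
  then have "k \<noteq> i" "k \<noteq> \<tau> i" using assms \<tau>_X by auto
  then show "B (simple_root k) (tail i) \<ge> 0"
    unfolding B_tail[OF k] using B_simple_nonpos[of k i] B_simple_nonpos[of k "\<tau> i"] by linarith
qed

lemma simple_root_integral: "simple_root i $ k \<in> (\<int> :: rat set)"
  by (auto simp: axis_def)

lemma tail_integral: "tail i $ k \<in> \<int>"
  unfolding tail_def \<sigma>_def comp_apply diagram_act_simple vector_minus_component
  by (intro Ints_diff weyl_integral[OF longest_elt_weyl] simple_root_integral)

lemma B_expand_tail:
  assumes "i \<notin> X"
  shows "B v (tail i) = (\<Sum>k\<in>X. tail i $ k * B v (simple_root k))"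
  using arg_cong[OF parabolic_span_expand[OF tail_span[OF assms]], of "B v"]
  by (simp add: B_sum_right B_scale_right)

lemma B_tail_nonpos:
  assumes "i \<notin> X" "k \<notin> X"
  shows "B (simple_root k) (tail i) \<le> 0"
  unfolding B_expand_tail[OF assms(1)]
proof (rule sum_nonpos)
  fix l assume "l \<in> X"
  then have "k \<noteq> l" using assms(2) by auto
  then show "tail i $ l * B (simple_root k) (simple_root l) \<le> 0"
    by (intro mult_nonneg_nonpos tail_nonneg[OF assms(1)] B_simple_nonpos)
qed

text \<open>\<open>\<alpha>\<close> and \<open>\<sigma>(\<alpha>)\<close> have the same average, and the averages of \<open>\<sigma>(\<alpha>\<^sub>i)\<close> and \<open>\<alpha>\<^bsub>\<tau>(i)\<^esub>\<close> agree
  because their difference lies in the span of \<open>X\<close>, where \<open>\<sigma> = - 1\<close>.\<close>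

lemma restricted_simple_\<tau>:
  assumes "i \<notin> X"
  shows "restricted_simple (\<tau> i) = restricted_simple i"
proof -
  have "restricted_simple (\<tau> i) = avg (\<sigma> (simple_root i) - tail i)" by (simp add: tail_def)
  then show ?thesis using avg_parabolic_span[OF tail_span[OF assms]] by (simp add: avg_diff)
qed

lemma restricted_simple_expand: "restricted_simple i = (1 / 2) *s (simple_root i + simple_root (\<tau> i) + tail i)"
  by (simp add: average_def tail_def)

lemma restricted_simple_nonpos:
  assumes "i \<notin> X" "k \<notin> X" "k \<noteq> i" "k \<noteq> \<tau> i"
  shows "B (restricted_simple i) (restricted_simple k) \<le> 0"
proof -
  have "B (restricted_simple i) (restricted_simple k) = B (simple_root k) (restricted_simple i)"
    using B_avg[OF \<sigma>_avg] B_sym by metis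
  also have "\<dots> = (B (simple_root k) (simple_root i) + B (simple_root k) (simple_root (\<tau> i))
      + B (simple_root k) (tail i)) / 2"
    unfolding restricted_simple_expand by (simp add: B_bilinear)
  finally show ?thesis
    using B_simple_nonpos[of k i] B_simple_nonpos[of k "\<tau> i"] B_tail_nonpos[OF assms(1,2)] assms(3,4) by auto
qed

lemma avg_expand: "avg v = (\<Sum>k\<in>-X. v $ k *s restricted_simple k)"
proof -
  have "avg v = (\<Sum>k\<in>UNIV. v $ k *s restricted_simple k)"
    using arg_cong[OF expand_in_simple_roots[of v], of avg] by (simp add: avg_sum avg_scale)
  also have "\<dots> = (\<Sum>k\<in>-X. v $ k *s restricted_simple k)"
    by (intro sum.mono_neutral_right) (auto simp: avg_parabolic_span simple_root_span)
  finally show ?thesis .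
qed

definition outer_height :: "rat ^ 'i \<Rightarrow> rat" where
  "outer_height v = (\<Sum>k\<in>-X. v $ k)"

lemma outer_height_linear:
  "outer_height (x + y) = outer_height x + outer_height y"
  "outer_height (x - y) = outer_height x - outer_height y"
  "outer_height (c *s x) = c * outer_height x"
  by (simp_all add: outer_height_def sum.distrib sum_subtractf sum_distrib_left)

text \<open>On coordinates outside \<open>X\<close> the involution \<open>\<sigma>\<close> acts by the permutation \<open>\<tau>\<close>.\<close>

lemma outer_height_avg: "outer_height (avg v) = outer_height v"
proof -
  have "bij_betw \<tau> (- X) (- X)"
    by (rule bij_betw_byWitness[of _ \<tau>]) (auto simp: \<tau>_X)
  from sum.reindex_bij_betw[OF this, of "\<lambda>k. v $ k"]
  have "outer_height (\<sigma> v) = outer_height v" by (simp add: outer_height_def \<sigma>_coord)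
  then show ?thesis by (simp add: average_def outer_height_linear)
qed

lemma outer_height_simple: "i \<notin> X \<Longrightarrow> outer_height (simple_root i) = 1"
  by (simp add: outer_height_def axis_def sum.delta)

end


section \<open>Reflections in restricted simple roots\<close>

locale satake_roots = decorated A eps X \<tau>
  for A :: "int ^ 'i ^ 'i" and eps :: "'i \<Rightarrow> int" and X :: "'i set" and \<tau> :: "'i \<Rightarrow> 'i" +
  fixes \<Phi> :: "(rat ^ 'i) set"
  assumes satake: "generalized_satake A X \<tau>"
    and \<Phi>_simple_refl: "v \<in> \<Phi> \<Longrightarrow> simple_refl A i v \<in> \<Phi>"
    and \<Phi>_coherent: "v \<in> \<Phi> \<Longrightarrow> \<exists>u s. (s = 1 \<or> s = - 1) \<and> (\<forall>i. v $ i = s * of_nat (u i))"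
begin

text \<open>Such a map commutes with averaging and therefore permutes the restricted roots. As it is its
  own inverse, conjugation by \<open>w\<close> sends \<open>u\<close> to \<open>w \<circ> u \<circ> w\<close>.\<close>

definition root_symmetry :: "(rat ^ 'i \<Rightarrow> rat ^ 'i) \<Rightarrow> bool" where
  "root_symmetry w \<longleftrightarrow> linear_isometry B w \<and> (\<forall>v. w (w v) = v) \<and>
     (\<forall>v. w (\<sigma> v) = \<sigma> (w v)) \<and> (\<forall>v\<in>\<Phi>. w v \<in> \<Phi>)"

lemma root_symmetry_avg:
  assumes "root_symmetry w"
  shows "w (avg v) = avg (w v)"
  using assms linear_isometryD[of B w] by (simp add: root_symmetry_def average_def)

lemma root_symmetry_conj:
  assumes "root_symmetry w" "root_symmetry u"
  shows "root_symmetry (w \<circ> u \<circ> w)"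
  using assms by (auto simp: root_symmetry_def intro: linear_isometry_comp)

lemma root_symmetry_reflection:
  assumes "\<sigma> a = a" "B a a \<noteq> 0" "\<And>v. v \<in> \<Phi> \<Longrightarrow> reflection B a v \<in> \<Phi>"
  shows "root_symmetry (reflection B a)"
  unfolding root_symmetry_def
  using assms reflection_isometry reflection_involution reflection_image[OF \<sigma>_isometry, of a] by simp

lemma \<Phi>_weyl: "w \<in> weyl A Y \<Longrightarrow> v \<in> \<Phi> \<Longrightarrow> w v \<in> \<Phi>"
  using weyl_stable[of w Y \<Phi> v] \<Phi>_simple_refl by blast

text \<open>The reflection is the conjugate by \<open>w\<^sub>X\<close> of the simple reflection at \<open>\<tau>(i)\<close>, hence an element of the
  Weyl group.\<close>

lemma reflection_\<sigma>_simple_stable: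
  assumes "v \<in> \<Phi>"
  shows "reflection B (\<sigma> (simple_root i)) v \<in> \<Phi>"
proof -
  let ?w = "longest_elt A X"
  obtain w' where w': "w' \<in> weyl A X" "?w \<circ> w' = id" using weyl_inverse[OF longest_elt_weyl] by blast
  have "reflection B (?w (simple_root (\<tau> i))) (?w (w' v)) = ?w (simple_refl A (\<tau> i) (w' v))"
    by (simp add: reflection_image[OF weyl_isometry[OF longest_elt_weyl]] simple_refl_reflection)
  moreover have "?w (w' v) = v" using fun_cong[OF w'(2), of v] by simp
  moreover have "?w (simple_refl A (\<tau> i) (w' v)) \<in> \<Phi>"
    by (intro \<Phi>_weyl[OF longest_elt_weyl] \<Phi>_simple_refl \<Phi>_weyl[OF w'(1)] assms)
  ultimately show ?thesis by (simp add: \<sigma>_def diagram_act_simple)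
qed

definition pairing_number :: "'i \<Rightarrow> rat" where
  "pairing_number i = 2 * B (simple_root i) (\<sigma> (simple_root i)) / B (simple_root i) (simple_root i)"

lemma pairing_number_eq:
  assumes "i \<notin> X"
  shows "pairing_number i = of_int (A $ i $ \<tau> i) + (\<Sum>k\<in>X. of_int (A $ i $ k) * tail i $ k)"
proof -
  have e: "of_int (eps i) \<noteq> (0 :: rat)" using eps_pos[of i] by simp
  have "\<sigma> (simple_root i) = simple_root (\<tau> i) + tail i" by (simp add: tail_def)
  then have "B (simple_root i) (\<sigma> (simple_root i))
      = of_int (eps i) * (of_int (A $ i $ \<tau> i) + (\<Sum>k\<in>X. of_int (A $ i $ k) * tail i $ k))"
    using B_expand_tail[OF assms, of "simple_root i"]
    by (simp add: B_add_right B_simple sum_distrib_left distrib_left mult_ac)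
  then show ?thesis using e by (simp add: pairing_number_def B_simple diag)
qed

lemma pairing_number_integral: "i \<notin> X \<Longrightarrow> pairing_number i \<in> \<int>"
  unfolding pairing_number_eq by (intro Ints_add Ints_sum Ints_mult tail_integral) auto

lemma tail_terms_nonpos:
  assumes "i \<notin> X" "k \<in> X"
  shows "of_int (A $ i $ k) * tail i $ k \<le> (0 :: rat)"
proof -
  have "i \<noteq> k" using assms by auto
  then show ?thesis using off_diag[of i k] tail_nonneg[OF assms(1), of k] by (simp add: mult_nonpos_nonneg)
qed

lemma restricted_simple_norm:
  "B (restricted_simple i) (restricted_simple i)
     = B (simple_root i) (simple_root i) * (2 + pairing_number i) / 4"
proof -
  have "B (restricted_simple i) (restricted_simple i) = B (restricted_simple i) (simple_root i)"
    by (rule B_avg[OF \<sigma>_avg])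
  also have "\<dots> = (B (simple_root i) (simple_root i) + B (simple_root i) (\<sigma> (simple_root i))) / 2"
    using B_sym[of "\<sigma> (simple_root i)" "simple_root i"] by (simp add: average_def B_bilinear)
  also have "B (simple_root i) (\<sigma> (simple_root i)) = B (simple_root i) (simple_root i) * pairing_number i / 2"
    using B_simple_pos[of i] by (simp add: pairing_number_def)
  finally show ?thesis by (simp add: field_simps)
qed

lemma B_tail_fixed:
  assumes "\<tau> i = i" "k \<in> X"
  shows "B (simple_root k) (tail i) = - 2 * B (simple_root k) (simple_root i)"
  using B_tail[OF assms(2), of i] assms(1) by simp

text \<open>Such a \<open>k\<close> has positive product with the tail, which is impossible unless \<open>\<alpha>\<^sub>k\<close> occurs in it:
  distinct simple roots have nonpositive products.\<close>

lemma tail_neighbour: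
  assumes "i \<notin> X" "\<tau> i = i" "k \<in> X" "A $ i $ k \<noteq> 0"
  shows "tail i $ k \<ge> 1"
proof -
  have ik: "k \<noteq> i" using assms by auto
  have "B (simple_root k) (simple_root i) < 0"
  proof -
    have "B (simple_root k) (simple_root i) \<noteq> 0"
      using assms(4) zero_sym[of i k] eps_pos[of k] by (simp add: B_simple)
    then show ?thesis using B_simple_nonpos[OF ik] by linarith
  qed
  then have pos: "B (simple_root k) (tail i) > 0" using B_tail_fixed[OF assms(2,3)] by linarith
  have "tail i $ k \<noteq> 0"
  proof
    assume z: "tail i $ k = 0"
    have "B (simple_root k) (tail i) \<le> 0"
      unfolding B_expand_tail[OF assms(1)]
    proof (rule sum_nonpos)
      fix l assume "l \<in> X"
      show "tail i $ l * B (simple_root k) (simple_root l) \<le> 0"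
      proof (cases "l = k")
        case True
        then show ?thesis using z by simp
      next
        case False
        then show ?thesis
          by (intro mult_nonneg_nonpos tail_nonneg[OF assms(1)] B_simple_nonpos) auto
      qed
    qed
    then show False using pos by simp
  qed
  moreover obtain n where "tail i $ k = of_int n" using tail_integral[of i k] by (auto elim: Ints_cases)
  ultimately show ?thesis using tail_nonneg[OF assms(1), of k] by simp
qed

text \<open>Here all terms of the sum defining the pairing number vanish, so \<open>i\<close> has no neighbour in
  \<open>X\<close> and the tail is orthogonal to \<open>X\<close>.\<close>

lemma fixed_simple_root:
  assumes "i \<notin> X" "\<tau> i = i" "pairing_number i = 2"
  shows "\<sigma> (simple_root i) = simple_root i"
proof -
  have "(\<Sum>k\<in>X. of_int (A $ i $ k) * tail i $ k) = (0 :: rat)"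
    using pairing_number_eq[OF assms(1)] assms(2,3) by (simp add: diag)
  then have "\<forall>k\<in>X. - (of_int (A $ i $ k) * tail i $ k) = (0 :: rat)"
    using tail_terms_nonpos[OF assms(1)]
    by (subst sum_nonneg_eq_0_iff[symmetric]) (auto simp: sum_negf)
  then have A0: "A $ i $ k = 0" if "k \<in> X" for k
    using tail_neighbour[OF assms(1,2) that] that by fastforce
  have "tail i = 0"
  proof (rule orthogonal_in_parabolic_span[OF tail_span[OF assms(1)]])
    fix k assume k: "k \<in> X"
    then show "B (simple_root k) (tail i) = 0"
      using B_tail_fixed[OF assms(2) k] A0[OF k] zero_sym[of i k] by (simp add: B_simple)
  qed
  then show ?thesis using assms(2) by (simp add: tail_def)
qed

text \<open>The sum in \<open>pairing_number_eq\<close> is \<open>- 1\<close>, so \<open>i\<close> has exactly one neighbour \<open>j\<close> in \<open>X\<close>, with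
  \<open>A\<^sub>i\<^sub>j = - 1\<close> and coefficient \<open>1\<close> in the tail. Consequently the tail is orthogonal to all
  simple roots of \<open>X\<close> other than \<open>\<alpha>\<^sub>j\<close>, and the averaged norm of its difference from \<open>\<alpha>\<^sub>j\<close>
  is \<open>1 + A\<^sub>j\<^sub>i \<le> 0\<close> times that of \<open>\<alpha>\<^sub>j\<close>. So the tail equals \<open>\<alpha>\<^sub>j\<close>, which gives
  \<open>A\<^sub>j\<^sub>i = - 1\<close> and isolates \<open>j\<close> from the rest of \<open>X\<close>.\<close>

lemma pairing_number_one_type_A2:
  assumes i: "i \<notin> X" "\<tau> i = i" and one: "pairing_number i = 1"
  shows "type_A2 A (component A (X \<union> {i, \<tau> i}) i)"
proof -
  let ?x = "tail i" and ?t = "\<lambda>k. of_int (A $ i $ k) * tail i $ k :: rat"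
  have sum: "(\<Sum>k\<in>X. ?t k) = - 1" using pairing_number_eq[OF i(1)] i(2) one by (simp add: diag)
  have t: "?t k \<le> 0" if "k \<in> X" for k using tail_terms_nonpos[OF i(1) that] .
  have nb: "A $ i $ k \<le> - 1 \<and> tail i $ k \<ge> 1 \<and> ?t k \<le> - 1" if k: "k \<in> X" "A $ i $ k \<noteq> 0" for k
  proof -
    have "i \<noteq> k" using i k by auto
    then have a: "A $ i $ k \<le> - 1" using off_diag[of i k] k(2) by linarith
    moreover have b: "tail i $ k \<ge> 1" by (rule tail_neighbour[OF i k])
    moreover have "?t k \<le> - 1 * 1"
    proof -
      have "of_int (A $ i $ k) \<le> (- 1 :: rat)" using a by (metis of_int_le_iff of_int_minus of_int_1)
      then have "?t k \<le> - 1 * tail i $ k" using b by (intro mult_right_mono) auto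
      also have "\<dots> \<le> - 1 * 1" using b by simp
      finally show ?thesis .
    qed
    ultimately show ?thesis by simp
  qed
  obtain j where j: "j \<in> X" "A $ i $ j \<noteq> 0"
  proof -
    have "\<not> (\<forall>k\<in>X. ?t k = 0)"
    proof
      assume "\<forall>k\<in>X. ?t k = 0"
      then have "(\<Sum>k\<in>X. ?t k) = 0" by (rule sum.neutral)
      then show False using sum by simp
    qed
    then show ?thesis using that by fastforce
  qed
  have rest: "?t j + (\<Sum>k\<in>X - {j}. ?t k) = - 1"
    using sum sum.remove[OF finite j(1), of ?t] by simp
  have rest_le: "(\<Sum>k\<in>X - {j}. ?t k) \<le> 0" using t by (intro sum_nonpos) auto
  have tj: "?t j = - 1" using rest rest_le nb[OF j] by linarith
  have other: "A $ i $ k = 0" if k: "k \<in> X" "k \<noteq> j" for k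
  proof (rule ccontr)
    assume "A $ i $ k \<noteq> 0"
    then have "?t k \<le> - 1" using nb k by blast
    moreover have "(\<Sum>l\<in>X - {j}. ?t l) = ?t k + (\<Sum>l\<in>X - {j} - {k}. ?t l)"
      using k by (intro sum.remove) auto
    moreover have "(\<Sum>l\<in>X - {j} - {k}. ?t l) \<le> 0" using t by (intro sum_nonpos) auto
    ultimately show False using rest tj by linarith
  qed
  have xj: "?x $ j = 1" and Aij: "A $ i $ j = - 1"
  proof -
    have "of_int (A $ i $ j) \<le> (- 1 :: rat)" using nb[OF j] by (metis of_int_le_iff of_int_minus of_int_1)
    then have "?t j \<le> - 1 * ?x $ j" using nb[OF j] by (intro mult_right_mono) auto
    then show xj: "?x $ j = 1" using tj nb[OF j] by linarith
    then have "of_int (A $ i $ j) = (of_int (- 1) :: rat)" using tj by simp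
    then show "A $ i $ j = - 1" by (simp only: of_int_eq_iff)
  qed
  let ?a = "simple_root j :: rat ^ 'i" and ?P = averaged_form
  have Bk: "B (simple_root k) ?x = 0" if "k \<in> X" "k \<noteq> j" for k
    using B_tail_fixed[OF i(2) that(1)] other[OF that] zero_sym[of i k] by (simp add: B_simple)
  have Pk: "?P ?x (simple_root k) = 0" if "k \<in> X" "k \<noteq> j" for k
    using averaged_simple[OF that(1), of ?x] Bk[OF that] by simp
  have Bj: "B ?a ?x = - 2 * of_int (eps j * A $ j $ i)"
    using B_tail_fixed[OF i(2) j(1)] by (simp add: B_simple)
  have ej: "of_int (eps j) > (0 :: rat)" using eps_pos[of j] by simp
  have "B ?a ?x / B ?a ?a = - of_int (A $ j $ i)"
    using ej by (simp add: Bj B_simple diag)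
  then have Pj: "?P ?x ?a = - of_int (A $ j $ i) * ?P ?a ?a"
    using averaged_simple[OF j(1), of ?x] by simp
  have Aji: "A $ j $ i \<le> - 1"
    using zero_sym[of i j] j(2) off_diag[of j i] i(1) j(1) by (cases "i = j") auto
  \<comment> \<open>The tail pairs with \<open>X\<close> only through \<open>j\<close> and has coefficient one there,
    so the averaged form has the same value on (tail, tail) and on (tail, \<open>\<alpha>\<^sub>j\<close>).\<close>
  have "?P ?x ?x = (\<Sum>k\<in>X. if k = j then ?P ?x ?a else 0)"
    unfolding averaged_expand[OF tail_span[OF i(1)], of ?x] using Pk xj by (intro sum.cong HOL.refl) auto
  then have Pxx: "?P ?x ?x = ?P ?x ?a" using j(1) by simp
  have "?P (?x - ?a) (?x - ?a) = (1 + of_int (A $ j $ i)) * ?P ?a ?a"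
    using Pxx Pj averaged_sym[of ?a ?x] by (simp add: averaged_diff_left averaged_diff_right algebra_simps)
  also have "\<dots> \<le> 0"
  proof (rule mult_nonpos_nonneg)
    have "of_int (1 + A $ j $ i) \<le> (0 :: rat)" using Aji by (simp only: of_int_le_0_iff)
    then show "1 + of_int (A $ j $ i) \<le> (0 :: rat)" by simp
  qed (rule averaged_nonneg)
  finally have x: "?x = ?a" using averaged_definite[of "?x - ?a"] by simp
  have "B ?a ?a = - 2 * of_int (eps j * A $ j $ i)" using Bj x by simp
  then have "of_int (eps j * 2) = (of_int (- 2 * (eps j * A $ j $ i)) :: rat)"
    by (simp only: B_simple diag of_int_mult of_int_minus of_int_numeral)
  then have "eps j * 2 = - 2 * (eps j * A $ j $ i)" by (simp only: of_int_eq_iff)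
  then have "eps j * (1 + A $ j $ i) = 0" by (simp only: distrib_left)
  then have Aji: "A $ j $ i = - 1" using eps_pos[of j] by simp
  have isolated: "A $ j $ k = 0" if "k \<in> X" "k \<noteq> j" for k
    using Bk[OF that] eps_pos[of k] zero_sym[of k j] unfolding x by (simp add: B_simple)
  let ?R = "{(k, l). k \<in> X \<union> {i, \<tau> i} \<and> l \<in> X \<union> {i, \<tau> i} \<and> A $ k $ l \<noteq> 0}"
  have "component A (X \<union> {i, \<tau> i}) i = {i, j}"
  proof
    show "component A (X \<union> {i, \<tau> i}) i \<subseteq> {i, j}"
    proof
      fix l assume "l \<in> component A (X \<union> {i, \<tau> i}) i"
      then have "(i, l) \<in> ?R\<^sup>*" by (simp add: component_def)
      then show "l \<in> {i, j}"
      proof (induction rule: rtrancl_induct)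
        case base
        then show ?case by simp
      next
        case (step k l)
        then have "l \<in> X \<union> {i}" "A $ k $ l \<noteq> 0" "k = i \<or> k = j" using i(2) by auto
        then show ?case using other isolated by blast
      qed
    qed
    have "(i, j) \<in> ?R" using j by simp
    then have "(i, j) \<in> ?R\<^sup>*" by (rule r_into_rtrancl)
    then show "{i, j} \<subseteq> component A (X \<union> {i, \<tau> i}) i" by (simp add: component_def)
  qed
  moreover have "i \<noteq> j" using i j by auto
  ultimately show ?thesis using Aij Aji unfolding type_A2_def by blast
qed

theorem restricted_simple_reflection:
  assumes i: "i \<notin> X" and pos: "B (restricted_simple i) (restricted_simple i) > 0"
  shows "\<exists>w. root_symmetry w \<and> (\<forall>v. \<sigma> v = v \<longrightarrow> w v = reflection B (restricted_simple i) v)"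
proof -
  let ?a = "simple_root i :: rat ^ 'i"
  let ?b = "\<sigma> ?a" and ?s = "simple_refl A i" and ?M = "pairing_number i" and ?r = "restricted_simple i"
  have N: "B ?a ?a > 0" by (rule B_simple_pos)
  have Nb: "B ?b ?b = B ?a ?a" by (rule \<sigma>_simps(3))
  have ab: "2 * B ?a ?b = ?M * B ?a ?a" using N by (simp add: pairing_number_def)
  have ba: "B ?b ?a = B ?a ?b" by (rule B_sym)
  have M_gt: "?M > - 2"
    using pos N unfolding restricted_simple_norm by (simp add: zero_less_mult_iff)
  obtain m where m: "?M = of_int m" using pairing_number_integral[OF i] by (auto elim: Ints_cases)
  have "(of_int (- 2) :: rat) < of_int m" using M_gt m by simp
  then have m_gt: "m > - 2" by (simp only: of_int_less_iff)
  consider "?M = 2" "\<tau> i = i" | "?M = 1" "\<tau> i = i" | "?M = 0" | "?M = - 1"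
  proof -
    have sum: "(\<Sum>k\<in>X. of_int (A $ i $ k) * tail i $ k) \<le> (0 :: rat)"
      using tail_terms_nonpos[OF i] by (intro sum_nonpos)
    show ?thesis
    proof (cases "\<tau> i = i")
      case True
      then have "?M \<le> 2" using sum by (simp add: pairing_number_eq[OF i] diag)
      then have "of_int m \<le> (of_int 2 :: rat)" using m by simp
      then have "m \<le> 2" by (simp only: of_int_le_iff)
      then have "m = 2 \<or> m = 1 \<or> m = 0 \<or> m = - 1" using m_gt by linarith
      then show ?thesis using m True that by auto
    next
      case False
      then have "of_int (A $ i $ \<tau> i) \<le> (0 :: rat)" using off_diag[of i "\<tau> i"] by simp
      then have "?M \<le> 0" using sum unfolding pairing_number_eq[OF i] by linarith
      then have "m \<le> 0" using m by simp
      then have "m = 0 \<or> m = - 1" using m_gt by linarith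
      then show ?thesis using m that by auto
    qed
  qed
  then show ?thesis
  proof cases
    case 1
    have fix_a: "?b = ?a" by (rule fixed_simple_root[OF i 1(2,1)])
    have "root_symmetry (reflection B ?a)"
      using fix_a N \<Phi>_simple_refl[of _ i] by (intro root_symmetry_reflection) (auto simp: simple_refl_reflection)
    then show ?thesis using avg_fixed[OF fix_a] by auto
  next
    case 2
    then show ?thesis using pairing_number_one_type_A2[OF i] satake i unfolding generalized_satake_def by blast
  next
    case 3
    let ?w = "\<lambda>v. ?s (reflection B ?b v)"
    have ab0: "B ?a ?b = 0" "B ?b ?a = 0" using ab ba 3 by auto
    have commute: "?s (reflection B ?b v) = reflection B ?b (?s v)" for v
      unfolding simple_refl_reflection reflection_def
      by (simp add: B_bilinear ab0 vec_eq_iff)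
    have Nb0: "B ?b ?b \<noteq> 0" using N Nb by simp
    have "root_symmetry ?w"
      unfolding root_symmetry_def
    proof (intro conjI allI ballI)
      show "linear_isometry B ?w"
        using linear_isometry_comp[OF simple_refl_isometry reflection_isometry[OF Nb0], of i]
        by (simp add: comp_def)
      show "?w (?w v) = v" for v
        by (simp only: commute[of v] reflection_involution[OF Nb0] simple_refl_involution diag)
      show "?w (\<sigma> v) = \<sigma> (?w v)" for v
        using reflection_image[OF \<sigma>_isometry, of ?a "reflection B ?b v"]
          reflection_image[OF \<sigma>_isometry, of ?b v] commute[of "\<sigma> v"]
        by (simp add: simple_refl_reflection)
      show "?w v \<in> \<Phi>" if "v \<in> \<Phi>" for v
        by (intro \<Phi>_simple_refl reflection_\<sigma>_simple_stable that)
    qed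
    moreover have "?w v = reflection B ?r v" if v: "\<sigma> v = v" for v
    proof -
      have Bv: "B ?b v = B ?a v" using \<sigma>_simps(3)[of ?a v] v by simp
      have rv: "B ?r v = B ?a v" using B_avg[OF v, of ?a] B_sym by metis
      have rr: "B ?r ?r = B ?a ?a / 2" unfolding restricted_simple_norm using 3 by simp
      have "?w v = v - (2 * (B ?a v / B ?a ?a)) *s (?a + ?b)"
        unfolding simple_refl_reflection reflection_def
        by (simp add: B_bilinear ab0 Nb Bv vec_eq_iff algebra_simps)
      also have "\<dots> = v - (2 * (B ?r v / B ?r ?r)) *s ?r"
        unfolding rv rr by (simp add: average_def vec_eq_iff algebra_simps)
      finally show ?thesis by (simp add: reflection_def)
    qed
    ultimately show ?thesis by blast
  next
    case 4
    let ?d = "?a + ?b"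
    have s: "?s ?b = ?d"
    proof -
      have "2 * (B ?a ?b / B ?a ?a) = - 1" using ab N 4 by (simp add: field_simps)
      then show ?thesis by (simp add: simple_refl_reflection reflection_def vec_eq_iff)
    qed
    have d: "\<sigma> ?d = ?d" by (simp add: \<sigma>_simps add.commute)
    have dr: "?d = 2 *s ?r" by (simp add: average_def vec_eq_iff)
    have "B ?d ?d \<noteq> 0" using pos unfolding dr by (simp add: B_bilinear)
    moreover have "reflection B ?d v \<in> \<Phi>" if "v \<in> \<Phi>" for v
    proof -
      have "?s (reflection B ?b (?s v)) = reflection B ?d v"
        using reflection_image[OF simple_refl_isometry, of i ?b "?s v"] s
        by (simp add: simple_refl_involution diag)
      moreover have "?s (reflection B ?b (?s v)) \<in> \<Phi>"
        by (intro \<Phi>_simple_refl reflection_\<sigma>_simple_stable that)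
      ultimately show ?thesis by simp
    qed
    ultimately have "root_symmetry (reflection B ?d)" by (intro root_symmetry_reflection[OF d])
    moreover have "reflection B ?d = reflection B ?r" unfolding dr by (simp add: reflection_scale)
    ultimately show ?thesis by auto
  qed
qed


section \<open>Descent to restricted simple roots\<close>

text \<open>The descent works with nonnegative vectors. Admitting negatives of roots replaces an appeal
  to \<open>- \<Phi> = \<Phi>\<close>.\<close>

definition signed_root :: "rat ^ 'i \<Rightarrow> bool" where
  "signed_root v \<longleftrightarrow> v \<in> \<Phi> \<or> - v \<in> \<Phi>"

lemma signed_root_coherent:
  assumes "signed_root v"
  shows "(\<forall>k. v $ k \<in> \<nat>) \<or> (\<forall>k. - v $ k \<in> \<nat>)"
proof -
  have coh: "(\<forall>k. x $ k \<in> \<nat>) \<or> (\<forall>k. - x $ k \<in> \<nat>)" if x: "x \<in> \<Phi>" for x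
  proof -
    obtain u s where us: "s = 1 \<or> s = - 1" "\<forall>i. x $ i = s * of_nat (u i)"
      using \<Phi>_coherent[OF x] by blast
    from us(1) show ?thesis by (rule disjE) (simp_all add: us(2))
  qed
  from assms[unfolded signed_root_def] show ?thesis
  proof
    assume "- v \<in> \<Phi>"
    from coh[OF this] show ?thesis by simp blast
  qed (rule coh)
qed

lemma outer_height_Nats:
  assumes "\<forall>k. v $ k \<in> \<nat>"
  shows "outer_height v \<in> \<nat>"
proof -
  have "(\<Sum>k\<in>K. v $ k) \<in> \<nat>" for K
    by (induction K rule: infinite_finite_induct) (use assms in auto)
  then show ?thesis unfolding outer_height_def .
qed

text \<open>Induction on the height outside \<open>X\<close>: a restricted simple root with positive product with
  \<open>avg v\<close> has positive norm, and its reflection lowers the height or makes \<open>v\<close> nonpositive.\<close>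

lemma restricted_reflection:
  assumes "signed_root v" "\<And>k. v $ k \<in> \<nat>" "B (avg v) (avg v) > 0" "outer_height v = of_nat n"
  shows "\<exists>w. root_symmetry w \<and> (\<forall>u. \<sigma> u = u \<longrightarrow> w u = reflection B (avg v) u)"
  using assms
proof (induction n arbitrary: v rule: less_induct)
  case (less n)
  let ?\<beta> = "avg v"
  have v0: "v $ k \<ge> 0" for k using less.prems(2)[of k] by (auto elim: Nats_cases)
  have "B ?\<beta> ?\<beta> = (\<Sum>k\<in>-X. v $ k * B ?\<beta> (restricted_simple k))"
    using arg_cong[OF avg_expand[of v], of "B ?\<beta>"] by (simp add: B_sum_right B_scale_right)
  then have "\<exists>i\<in>-X. v $ i * B ?\<beta> (restricted_simple i) > 0"
    using less.prems(3) sum_nonpos[of "- X" "\<lambda>k. v $ k * B ?\<beta> (restricted_simple k)"]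
    by (metis not_le)
  then obtain i where i: "i \<notin> X" and vi: "v $ i * B ?\<beta> (restricted_simple i) > 0" by auto
  let ?r = "restricted_simple i"
  have \<beta>r: "B ?\<beta> ?r > 0" using vi v0[of i] by (simp add: zero_less_mult_iff)
  \<comment> \<open>\<open>avg v\<close> is a nonnegative combination of vectors whose products with \<open>?r\<close> are
    nonpositive or equal to the norm of \<open>?r\<close>.\<close>
  have rr: "B ?r ?r > 0"
  proof (rule ccontr)
    assume neg: "\<not> B ?r ?r > 0"
    have "B ?r ?\<beta> = (\<Sum>k\<in>-X. v $ k * B ?r (restricted_simple k))"
      using arg_cong[OF avg_expand[of v], of "B ?r"] by (simp add: B_sum_right B_scale_right)
    also have "\<dots> \<le> 0"
    proof (rule sum_nonpos)
      fix k assume k: "k \<in> - X"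
      have "B ?r (restricted_simple k) \<le> 0"
        using restricted_simple_nonpos[OF i, of k] k neg restricted_simple_\<tau>[OF i]
        by (cases "k = i \<or> k = \<tau> i") auto
      then show "v $ k * B ?r (restricted_simple k) \<le> 0" using v0 by (simp add: mult_nonneg_nonpos)
    qed
    finally show False using \<beta>r B_sym[of ?r ?\<beta>] by simp
  qed
  obtain w where w: "root_symmetry w" "\<And>u. \<sigma> u = u \<Longrightarrow> w u = reflection B ?r u"
    using restricted_simple_reflection[OF i rr] by blast
  note w_iso = w(1)[unfolded root_symmetry_def, THEN conjunct1]
  have w_w: "w (w u) = u" for u using w(1) by (simp add: root_symmetry_def)
  let ?c = "2 * (B ?r ?\<beta> / B ?r ?r)"
  have c: "?c > 0" using \<beta>r rr B_sym[of ?r ?\<beta>] by simp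
  have w\<beta>: "w ?\<beta> = ?\<beta> - ?c *s ?r" using w(2)[OF \<sigma>_avg] by (simp add: reflection_def)
  have avg_wv: "avg (w v) = w ?\<beta>" using root_symmetry_avg[OF w(1)] by simp
  have sr: "signed_root (w v)"
    using less.prems(1) w(1) linear_isometryD(4)[OF w_iso, of v]
    unfolding signed_root_def root_symmetry_def by metis
  show ?case
  proof (cases "\<forall>k. w v $ k \<in> \<nat>")
    case True
    have "outer_height (w v) \<in> \<nat>" using True by (rule outer_height_Nats)
    then obtain n' where n': "outer_height (w v) = of_nat n'" by (auto elim: Nats_cases)
    have "outer_height (w v) = outer_height (w ?\<beta>)" by (simp add: outer_height_avg flip: avg_wv)
    also have "\<dots> = outer_height v - ?c"
      by (simp add: w\<beta> outer_height_linear outer_height_avg outer_height_simple i)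
    finally have "outer_height (w v) < outer_height v" using c by simp
    then have "n' < n" using n' less.prems(4) by simp
    moreover have "B (avg (w v)) (avg (w v)) > 0"
      using less.prems(3) linear_isometryD(3)[OF w_iso] by (simp add: avg_wv)
    ultimately obtain u where u: "root_symmetry u" "\<And>x. \<sigma> x = x \<Longrightarrow> u x = reflection B (avg (w v)) x"
      using less.IH[of n' "w v"] sr True n' by blast
    have "(w \<circ> u \<circ> w) x = reflection B ?\<beta> x" if x: "\<sigma> x = x" for x
    proof -
      have "\<sigma> (w x) = w x" using w(1) x by (metis root_symmetry_def)
      then have "w (u (w x)) = w (reflection B (w ?\<beta>) (w x))" using u(2) avg_wv by simp
      also have "\<dots> = reflection B ?\<beta> x" using reflection_image[OF w_iso] by (simp add: w_w)
      finally show ?thesis by simp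
    qed
    then show ?thesis using root_symmetry_conj[OF w(1) u(1)] by blast
  next
    case False
    \<comment> \<open>Now \<open>w v\<close> is nonpositive although the reflection only changed the coefficient of
      the restricted simple root at \<open>i\<close>, so there was no other one.\<close>
    then have neg: "w v $ k \<le> 0" for k
      using signed_root_coherent[OF sr] Nats_cases[of "- w v $ k"] by (metis of_nat_0_le_iff neg_0_le_iff_le)
    have avg_coord: "avg x $ k = (x $ k + x $ \<tau> k) / 2" if "k \<notin> X" for x k
      using that by (simp add: average_def \<sigma>_coord)
    have vk: "v $ k = 0" if k: "k \<notin> X" "k \<noteq> i" "k \<noteq> \<tau> i" for k
    proof -
      have "?r $ k = 0" using k by (auto simp: avg_coord axis_def)
      then have "w ?\<beta> $ k = ?\<beta> $ k" by (simp add: w\<beta>)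
      then have "(v $ k + v $ \<tau> k) / 2 = (w v $ k + w v $ \<tau> k) / 2"
        using avg_wv avg_coord[OF k(1)] by metis
      then have "v $ k \<le> 0" using neg[of k] neg[of "\<tau> k"] v0[of "\<tau> k"] by simp
      then show ?thesis using v0[of k] by simp
    qed
    define t where "t = (\<Sum>k\<in>-X. v $ k)"
    have "v $ k *s restricted_simple k = v $ k *s ?r" if "k \<in> - X" for k
      using vk[of k] that restricted_simple_\<tau>[OF i] by (cases "k = i \<or> k = \<tau> i") auto
    then have "(\<Sum>k\<in>-X. v $ k *s restricted_simple k) = (\<Sum>k\<in>-X. v $ k *s ?r)"
      by (intro sum.cong) auto
    then have \<beta>: "?\<beta> = t *s ?r" unfolding avg_expand[of v] t_def by (simp add: vec.scale_sum_left)
    have "t \<noteq> 0" using less.prems(3) unfolding \<beta> by (auto simp: B_bilinear)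
    then have "reflection B ?\<beta> = reflection B ?r" unfolding \<beta> by (rule reflection_scale)
    then show ?thesis using w by auto
  qed
qed

theorem restricted_root_reflection:
  assumes "\<beta> \<in> restricted_roots \<sigma> \<Phi>" "B \<beta> \<beta> > 0"
  shows "\<exists>w. root_symmetry w \<and> (\<forall>u. \<sigma> u = u \<longrightarrow> w u = reflection B \<beta> u)"
proof -
  obtain \<alpha> where \<alpha>: "\<alpha> \<in> \<Phi>" "\<beta> = avg \<alpha>" using assms(1) by (auto simp: restricted_roots_def)
  have nonneg_case: ?thesis if v: "signed_root v" "\<forall>k. v $ k \<in> \<nat>" "\<beta> = s *s avg v" "s \<noteq> 0" for v s
  proof -
    have "outer_height v \<in> \<nat>" using v(2) by (rule outer_height_Nats)
    then obtain n where n: "outer_height v = of_nat n" by (auto elim: Nats_cases)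
    have "s * (s * B (avg v) (avg v)) > 0" using assms(2) v(3) by (simp add: B_bilinear)
    moreover have "s * s > 0" using v(4) by (metis zero_less_power2 power2_eq_square)
    ultimately have "B (avg v) (avg v) > 0" by (metis mult.assoc zero_less_mult_pos)
    then have "\<exists>w. root_symmetry w \<and> (\<forall>u. \<sigma> u = u \<longrightarrow> w u = reflection B (avg v) u)"
      using restricted_reflection[OF v(1) _ _ n] v(2) by blast
    then show ?thesis unfolding v(3) using reflection_scale[OF v(4)] by simp
  qed
  have sr: "signed_root \<alpha>" "signed_root (- \<alpha>)" using \<alpha>(1) by (auto simp: signed_root_def)
  have neg: "\<beta> = (- 1) *s avg (- \<alpha>)" using \<alpha>(2) avg_diff[of 0 \<alpha>] avg_scale[of 0 0] by (simp add: vec_eq_iff)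
  show ?thesis
    using signed_root_coherent[OF sr(1)]
  proof
    assume "\<forall>k. \<alpha> $ k \<in> \<nat>"
    then show ?thesis using nonneg_case[OF sr(1), of 1] \<alpha>(2) by simp
  next
    assume "\<forall>k. - \<alpha> $ k \<in> \<nat>"
    then show ?thesis using nonneg_case[OF sr(2), of "- 1"] neg by simp
  qed
qed

lemma restricted_roots_fixed: "restricted_roots \<sigma> \<Phi> \<subseteq> fixed_space \<sigma>"
  by (auto simp: restricted_roots_def fixed_space_def)

theorem restricted_roots_reflection_stable:
  assumes \<beta>: "\<beta> \<in> restricted_roots \<sigma> \<Phi>" "B \<beta> \<beta> > 0" and \<gamma>: "\<gamma> \<in> restricted_roots \<sigma> \<Phi>"
  shows "reflection B \<beta> \<gamma> \<in> restricted_roots \<sigma> \<Phi>"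
proof -
  obtain w where w: "root_symmetry w" "\<And>u. \<sigma> u = u \<Longrightarrow> w u = reflection B \<beta> u"
    using restricted_root_reflection[OF \<beta>] by blast
  obtain \<alpha> where \<alpha>: "\<alpha> \<in> \<Phi>" "\<gamma> = avg \<alpha>" "\<gamma> \<noteq> 0" using \<gamma> by (auto simp: restricted_roots_def)
  have "reflection B \<beta> \<gamma> = avg (w \<alpha>)"
    using w(2)[of \<gamma>] \<alpha>(2) root_symmetry_avg[OF w(1)] by simp
  moreover have "w \<alpha> \<in> \<Phi>" using w(1) \<alpha>(1) by (simp add: root_symmetry_def)
  moreover have "reflection B \<beta> \<gamma> \<noteq> 0"
  proof
    assume "reflection B \<beta> \<gamma> = 0"
    then have "reflection B \<beta> 0 = \<gamma>" using reflection_involution[of \<beta> \<gamma>] \<beta>(2) by simp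
    then show False using \<alpha>(3) by (simp add: reflection_def root_form_def)
  qed
  ultimately show ?thesis by (auto simp: restricted_roots_def)
qed

text \<open>Generators are involutions of the fixed space, so mapping the restricted roots into
  themselves is enough.\<close>

theorem restricted_weyl_stable:
  assumes "w \<in> restricted_weyl B \<sigma> (restricted_roots \<sigma> \<Phi>)"
  shows "w ` restricted_roots \<sigma> \<Phi> = restricted_roots \<sigma> \<Phi>"
proof -
  let ?F = "fixed_space \<sigma>" and ?R = "restricted_roots \<sigma> \<Phi>"
  note RF = restricted_roots_fixed
  have gen: "restrict (reflection B \<beta>) ?F \<in> Bij ?F \<and> restrict (reflection B \<beta>) ?F ` ?R = ?R"
    if \<beta>: "\<beta> \<in> ?R" "B \<beta> \<beta> > 0" for \<beta>
  proof
    let ?g = "reflection B \<beta>"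
    have inv: "?g (?g x) = x" for x using reflection_involution[of \<beta> x] \<beta>(2) by simp
    have "\<sigma> \<beta> = \<beta>" using \<beta>(1) RF by (auto simp: fixed_space_def)
    then have F: "?g x \<in> ?F" if "x \<in> ?F" for x
      using that reflection_image[OF \<sigma>_isometry, of \<beta> x] by (simp add: fixed_space_def)
    have "bij_betw ?g ?F ?F" by (rule bij_betw_byWitness[of _ ?g]) (auto simp: inv F)
    then show "restrict ?g ?F \<in> Bij ?F" by (simp add: Bij_def)
    have sub: "?g ` ?R \<subseteq> ?R" using restricted_roots_reflection_stable[OF \<beta>] by blast
    have "x \<in> ?g ` ?R" if "x \<in> ?R" for x
      using sub that by (intro image_eqI[of _ _ "?g x"]) (auto simp: inv)
    with sub have "?g ` ?R = ?R" by blast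
    moreover have "restrict ?g ?F ` ?R = ?g ` ?R" using RF by (intro image_cong) auto
    ultimately show "restrict ?g ?F ` ?R = ?R" by simp
  qed
  have "w \<in> Bij ?F \<and> w ` ?R = ?R"
    using assms unfolding restricted_weyl_def
  proof (induction rule: generate.induct)
    case one
    have "(\<lambda>x\<in>?F. x) ` ?R = ?R" using RF by force
    moreover have "\<one>\<^bsub>BijGroup ?F\<^esub> = (\<lambda>x\<in>?F. x)" by (simp add: BijGroup_def)
    ultimately show ?case using id_Bij[of ?F] by (simp only:)
  next
    case (incl h)
    then show ?case using gen by blast
  next
    case (inv h)
    then have h: "h \<in> Bij ?F" "h ` ?R = ?R" using gen by blast+
    have "inj_on h ?F" using h(1) by (simp add: Bij_def bij_betw_def)
    then have "inv_into ?F h ` (h ` ?R) = ?R" using RF by (intro inv_into_image_cancel) auto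
    moreover have "(\<lambda>x\<in>?F. inv_into ?F h x) ` ?R = inv_into ?F h ` ?R"
      using RF by (intro image_cong) auto
    ultimately have "(\<lambda>x\<in>?F. inv_into ?F h x) ` ?R = ?R" using h(2) by simp
    then show ?case using restrict_inv_into_Bij[OF h(1)] by (simp only: inv_BijGroup[OF h(1)])
  next
    case (eng f g)
    have "compose ?F f g ` ?R = (f \<circ> g) ` ?R"
      using RF by (intro image_cong) (auto simp: compose_def)
    also have "\<dots> = f ` g ` ?R" by (rule image_comp[symmetric])
    finally have "compose ?F f g ` ?R = f ` g ` ?R" .
    moreover have "f \<otimes>\<^bsub>BijGroup ?F\<^esub> g = compose ?F f g" using eng by (simp add: BijGroup_def)
    ultimately show ?case using eng compose_Bij[of f ?F g] by simp
  qed
  then show ?thesis by simp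
qed

end

theorem corollary4p25:
  fixes A :: "int ^ 'i ^ 'i"
    and eps :: "'i \<Rightarrow> int"
    and coroot rt :: "'i \<Rightarrow> complex ^ 'm"
    and X :: "'i set"
    and \<tau> :: "'i \<Rightarrow> 'i"
    and \<sigma> :: "rat ^ 'i \<Rightarrow> rat ^ 'i"
    and \<Phi> R :: "(rat ^ 'i) set"
  assumes "gcm A" and "indecomposable A" and "symmetrized_by A eps"
    and "realization A coroot rt"
    and "\<Phi> = root_system coroot rt"
    and "generalized_satake A X \<tau>"
    and "\<sigma> = longest_elt A X \<circ> diagram_act \<tau>"
    and "R = restricted_roots \<sigma> \<Phi>"
  shows "\<forall>w \<in> restricted_weyl (root_form A eps) \<sigma> R. w ` R = R"
proof -
  have decoration: "compatible_decoration A X \<tau>"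
    using assms(6) by (simp add: generalized_satake_def)
  interpret satake_roots A eps X \<tau> \<Phi>
  proof
    show "finite (weyl A X)"
      using decoration by (simp add: compatible_decoration_def finite_type_def)
    show "simple_refl A i v \<in> \<Phi>" if "v \<in> \<Phi>" for v i
      using that root_system_simple_refl[OF assms(4,1)] assms(5) by simp
    show "\<exists>u s. (s = 1 \<or> s = - 1) \<and> (\<forall>i. v $ i = s * of_nat (u i))" if "v \<in> \<Phi>" for v
      using that root_coherent[OF assms(4,1)] assms(5) by simp
  qed (use assms decoration in auto)
  have "\<sigma> = local.\<sigma>" by (simp add: \<sigma>_def assms(7))
  then show ?thesis using restricted_weyl_stable assms(8) by simp
qed


end
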